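(* Let $f$ be a transcendental entire function, $z_0$ a repelling or parabolic fixed point of $f$, and assume that there is an admissible expansion domain $U$ of $f$ at $z_0$. Suppose that for every periodic external address $\underline s$ there exists a periodic ray of $f$ with external address $\underline s$. Then there is a periodic ray of $f$ landing at $z_0$.
   Context: $S(f)$ is the closure of the set of finite critical and asymptotic values; $P(f)=\overline{\bigcup_{n\ge0}f^n(S(f))}$; $I(f)=\{z: f^n(z)\to\infty\}$. Admissible expansion domain of $f$ at $z_0$: a domain $U\subset\mathbb C$ with (a) $U\subset\mathbb C\setminus(P(f)\cup\{z_0\})$ and $\infty$ an isolated boundary point of $U$; (b) $f^{-1}(U)\subsetneq U$; (c) $U$ finitely connected and $U\ne\mathbb C\setminus P(f)$; (d) $z_0\in\partial U$ accessible from $U$, and $K_0\setminus\{z_0\}$ has finitely many components where $K_0$ is the component of $\mathbb C\setminus U$ containing $z_0$. (In particular $P(f)$ is bounded.) Tracts and fundamental domains: fix a Jordan domain $D\supset P(f)$, put $A=\mathbb C\setminus\overline D$; the components of $f^{-1}(A)$ are the tracts; fix a curve $\alpha\subset A$ from $\partial D$ to $\infty$ disjoint from all tracts; the components of $T\setminus f^{-1}(\alpha)$, $T$ a tract, are fundamental domains. A ray tail is an injective curve $g:[t_0,\infty)\to I(f)$ ($t_0>0$) with $f^n(g(t))\to\infty$ as $t\to\infty$ for each $n$, and $f^n\circ g\to\infty$ uniformly in $t$ as $n\to\infty$. A dynamic ray is a maximal injective curve $g:(0,\infty)\to I(f)$ whose restriction to $[t_0,\infty)$ is a ray tail for every $t_0>0$;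 its external address is the sequence $F_0F_1F_2\dots$ of fundamental domains with $f^n(g([t_0,\infty)))\subset F_n$ for all $n\ge0$ and some $t_0$. An external address is periodic if it is fixed by some iterate $\sigma^n$, $n\ge1$, of the shift $\sigma(F_0F_1F_2\dots)=F_1F_2\dots$. A periodic ray is an injective curve $g:(0,\infty)\to\mathbb C$ with $g(t)\to\infty$ as $t\to\infty$ and $g(2t)=f^n(g(t))$ for some $n\ge1$ and all $t$ (it is a dynamic ray); it lands at $z_0$ if $\lim_{t\to0}g(t)=z_0$. *)

theory Defs
  imports "HOL-Analysis.Analysis" "HOL-Computational_Algebra.Polynomial"
begin

definition transcendental_entire :: "(complex \<Rightarrow> complex) \<Rightarrow> bool" where
  "transcendental_entire f \<longleftrightarrow> f holomorphic_on UNIV \<and> \<not> (\<exists>p :: complex poly. \<forall>z. f z = poly p z)"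

definition repelling_fixed_point :: "(complex \<Rightarrow> complex) \<Rightarrow> complex \<Rightarrow> bool" where
  "repelling_fixed_point f z0 \<longleftrightarrow> f z0 = z0 \<and> norm (deriv f z0) > 1"

definition parabolic_fixed_point :: "(complex \<Rightarrow> complex) \<Rightarrow> complex \<Rightarrow> bool" where
  "parabolic_fixed_point f z0 \<longleftrightarrow> f z0 = z0 \<and> (\<exists>q::nat. q \<ge> 1 \<and> (deriv f z0) ^ q = 1)"

definition critical_values :: "(complex \<Rightarrow> complex) \<Rightarrow> complex set" where
  "critical_values f = {f c | c. deriv f c = 0}"

definition asymptotic_values :: "(complex \<Rightarrow> complex) \<Rightarrow> complex set" where
  "asymptotic_values f = {a. \<exists>\<gamma> :: real \<Rightarrow> complex. continuous_on {0..} \<gamma> \<and>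
      filterlim \<gamma> at_infinity at_top \<and> ((f \<circ> \<gamma>) \<longlongrightarrow> a) at_top}"

definition sing_set :: "(complex \<Rightarrow> complex) \<Rightarrow> complex set" where
  "sing_set f = closure (critical_values f \<union> asymptotic_values f)"

definition postsing_set :: "(complex \<Rightarrow> complex) \<Rightarrow> complex set" where
  "postsing_set f = closure (\<Union>n. (f ^^ n) ` sing_set f)"

definition admissible_expansion_domain ::
  "(complex \<Rightarrow> complex) \<Rightarrow> complex \<Rightarrow> complex set \<Rightarrow> bool" where
  "admissible_expansion_domain f z0 U \<longleftrightarrow>
     open U \<and> connected U \<and> U \<noteq> {} \<and>
     \<comment> \<open>(a)\<close>
     U \<subseteq> - (postsing_set f \<union> {z0}) \<and>
     (\<exists>R. \<forall>z. R < norm z \<longrightarrow> z \<in> U) \<and>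
     \<comment> \<open>(b)\<close>
     f -` U \<subset> U \<and>
     \<comment> \<open>(c) finitely connected (complement in the sphere has finitely many components;
         infinity is interior to U, so this is finiteness of the components of the
         complement in the plane)\<close>
     finite (components (- U)) \<and> U \<noteq> - postsing_set f \<and>
     \<comment> \<open>(d)\<close>
     z0 \<in> frontier U \<and>
     (\<exists>\<gamma>. path \<gamma> \<and> pathfinish \<gamma> = z0 \<and> (\<forall>t\<in>{0..<1}. \<gamma> t \<in> U)) \<and>
     finite (components (connected_component_set (- U) z0 - {z0}))"

definition jordan_domain :: "complex set \<Rightarrow> bool" where
  "jordan_domain D \<longleftrightarrow> (\<exists>c. simple_path c \<and> pathfinish c = pathstart c \<and> D = inside (path_image c))"

definition tracts :: "(complex \<Rightarrow> complex) \<Rightarrow> complex set \<Rightarrow> complex set set" where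
  "tracts f D = components (f -` (- closure D))"

definition valid_alpha :: "(complex \<Rightarrow> complex) \<Rightarrow> complex set \<Rightarrow> (real \<Rightarrow> complex) \<Rightarrow> bool" where
  "valid_alpha f D \<alpha> \<longleftrightarrow> continuous_on {0..} \<alpha> \<and> \<alpha> 0 \<in> frontier D \<and>
     (\<forall>t>0. \<alpha> t \<in> - closure D) \<and> filterlim \<alpha> at_infinity at_top \<and>
     (\<forall>T\<in>tracts f D. T \<inter> \<alpha> ` {0..} = {})"

definition fundamental_domains ::
  "(complex \<Rightarrow> complex) \<Rightarrow> complex set \<Rightarrow> (real \<Rightarrow> complex) \<Rightarrow> complex set set" where
  "fundamental_domains f D \<alpha> =
     (\<Union>T\<in>tracts f D. components (T - f -` (\<alpha> ` {0..})))"

definition external_address ::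
  "(complex \<Rightarrow> complex) \<Rightarrow> complex set \<Rightarrow> (real \<Rightarrow> complex) \<Rightarrow> (nat \<Rightarrow> complex set) \<Rightarrow> bool" where
  "external_address f D \<alpha> s \<longleftrightarrow> (\<forall>k. s k \<in> fundamental_domains f D \<alpha>)"

definition periodic_address :: "(nat \<Rightarrow> complex set) \<Rightarrow> bool" where
  "periodic_address s \<longleftrightarrow> (\<exists>n\<ge>1. \<forall>k. s (k + n) = s k)"

definition periodic_ray :: "(complex \<Rightarrow> complex) \<Rightarrow> (real \<Rightarrow> complex) \<Rightarrow> bool" where
  "periodic_ray f g \<longleftrightarrow> continuous_on {0<..} g \<and> inj_on g {0<..} \<and>
     filterlim g at_infinity at_top \<and>
     (\<exists>n\<ge>1. \<forall>t>0. g (2 * t) = (f ^^ n) (g t))"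

definition has_address ::
  "(complex \<Rightarrow> complex) \<Rightarrow> (real \<Rightarrow> complex) \<Rightarrow> (nat \<Rightarrow> complex set) \<Rightarrow> bool" where
  "has_address f g s \<longleftrightarrow> (\<exists>t0>0. \<forall>n. (f ^^ n) ` g ` {t0..} \<subseteq> s n)"

definition lands_at :: "(real \<Rightarrow> complex) \<Rightarrow> complex \<Rightarrow> bool" where
  "lands_at g z0 \<longleftrightarrow> (g \<longlongrightarrow> z0) (at_right 0)"

end

(*
  No hyperbolic metric is used. Over the domain U the iterates of f are coverings, and since
  f^-1(U) is strictly smaller than U, Montel's theorem (in the form of Schottky's bound) shows that
  inverse branches of f^n on a fixed disc of U have small image as n grows. Hence convergence to z0
  of a backward orbit in U is preserved under continuation along paths in U.

  A backward orbit converging to z0 exists. Alternately shift it by one and continue it radially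
  back to a neighbourhood of infinity: the shift lowers the time needed to settle near z0, the
  continuation barely changes the late points, so the settling times stay bounded. By compactness
  two of these backward orbits arise from each other by continuation near infinity, and the classes
  under such continuation form a cycle under the shift. Each class of the cycle determines a
  fundamental domain, and these form a periodic address. The ray with that address is obtained by
  continuing a backward orbit of the cycle along a fundamental segment, so it converges to z0.
*)
theory Submission
  imports Defs "HOL-Complex_Analysis.Complex_Analysis"
begin

section \<open>Coverings by entire functions without singular values\<close>

text \<open>Montel needs two omitted values. Branches over subsets of \<open>U\<close> miss
  \<open>z0\<close>, which is fixed and outside \<open>U\<close>, and a point \<open>q0\<close> of
  \<open>U\<close> with \<open>f q0\<close> outside \<open>U\<close>. A nonconstant limit of
  branches would produce, after composition with iterates, branches tending to the identity;
  continued to \<open>q0\<close>, these would attain \<open>q0\<close> by Hurwitz's theorem.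

  The resulting contraction has no rate and is uniform only over compact sets. Hence all radial
  moves take place in one closed annulus, and a fixed number of rounds is weighed against a fixed
  error budget.

  The radii \<open>R0 < R < S\<close> satisfy that preimages of points beyond \<open>S\<close> lie
  beyond \<open>R\<close>. A shift may therefore lose the range between \<open>R\<close> and
  \<open>S\<close>, and a homotopy in the exterior of a disc regains it. Preimages of the far region
  also miss the curve \<open>\<alpha>\<close>, which meets no tract. This is why classes can be
  formed without regard to the slit and still select fundamental domains.\<close>

lemma tendsto_of_lift_at_left:
  fixes f :: "complex \<Rightarrow> complex" and g q :: "real \<Rightarrow> complex"
  assumes hol: "f holomorphic_on UNIV"
    and g: "continuous_on {0..<1} g" and q: "continuous_on {0..1} q"
    and fg: "\<And>t. t \<in> {0..<1} \<Longrightarrow> f (g t) = q t"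
    and ns: "q 1 \<notin> critical_values f" "q 1 \<notin> asymptotic_values f"
  obtains y where "f y = q 1" "deriv f y \<noteq> 0" "(g \<longlongrightarrow> y) (at_left 1)"
proof -
  have contf: "continuous_on UNIV f"
    using hol holomorphic_on_imp_continuous_on by blast
  have q1: "(q \<longlongrightarrow> q 1) (at_left 1)"
    using q by (simp add: continuous_on_Icc_at_leftD)
  \<comment> \<open>A lift escaping to infinity would make \<open>q 1\<close> an asymptotic value;
    \<open>h\<close> reparametrises it over the half-line that \<open>asymptotic_values\<close> asks
    for.\<close>
  have "\<not> filterlim g at_infinity (at_left 1)"
  proof
    assume ginf: "filterlim g at_infinity (at_left 1)"
    define h where "h = (\<lambda>s::real. 1 - inverse (1 + s))"
    have h01: "h s \<in> {0..<1}" if "s \<ge> 0" for s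
      using that by (auto simp: h_def field_simps)
    have conth: "continuous_on {0..} h"
      unfolding h_def by (intro continuous_intros) auto
    have "((\<lambda>s::real. inverse (1 + s)) \<longlongrightarrow> 0) at_top"
      by (intro tendsto_inverse_0_at_top filterlim_tendsto_add_at_top[OF tendsto_const] filterlim_ident)
    then have "(h \<longlongrightarrow> 1 - 0) at_top"
      unfolding h_def by (intro tendsto_intros)
    moreover have "eventually (\<lambda>s. h s \<in> {..<1} \<and> h s \<noteq> 1) at_top"
    proof (rule eventually_mono[OF eventually_ge_at_top[of 0]])
      fix s :: real assume "0 \<le> s"
      from h01[OF this] show "h s \<in> {..<1} \<and> h s \<noteq> 1" by auto
    qed
    ultimately have hlim: "filterlim h (at_left 1) at_top"
      unfolding filterlim_at by simp
    have "continuous_on {0..} (g \<circ> h)"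
    proof (rule continuous_on_compose[OF conth continuous_on_subset[OF g]])
      show "h ` {0..} \<subseteq> {0..<1}" using h01 by blast
    qed
    moreover have "filterlim (g \<circ> h) at_infinity at_top"
      using filterlim_compose[OF ginf hlim] by (simp add: o_def)
    moreover have "((f \<circ> (g \<circ> h)) \<longlongrightarrow> q 1) at_top"
    proof (rule Lim_transform_eventually)
      show "((\<lambda>s. q (h s)) \<longlongrightarrow> q 1) at_top"
        using filterlim_compose[OF q1 hlim] .
      show "\<forall>\<^sub>F s in at_top. q (h s) = (f \<circ> (g \<circ> h)) s"
      proof (rule eventually_mono[OF eventually_ge_at_top[of 0]])
        fix s :: real assume "0 \<le> s"
        from fg[OF h01[OF this]] show "q (h s) = (f \<circ> (g \<circ> h)) s" by simp
      qed
    qed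
    ultimately show False
      using ns(2) unfolding asymptotic_values_def by blast
  qed
  then obtain r where "r > 0" and r: "\<not> eventually (\<lambda>t. r \<le> norm (g t)) (at_left 1)"
    by (auto simp: filterlim_at_infinity[OF order_refl])
  have "\<exists>t. t \<in> {1 - inverse (real (Suc n))<..<1} \<and> norm (g t) \<le> r" for n
  proof (rule ccontr)
    assume "\<not> ?thesis"
    then have "\<forall>t>1 - inverse (real (Suc n)). t < 1 \<longrightarrow> r \<le> norm (g t)"
      by (metis greaterThanLessThan_iff linorder_le_cases)
    moreover have "1 - inverse (real (Suc n)) < 1" by simp
    ultimately show False
      using r unfolding eventually_at_left_field by blast
  qed
  then obtain t where t: "\<And>n. t n \<in> {1 - inverse (real (Suc n))<..<1}" and gt: "\<And>n. norm (g (t n)) \<le> r"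
    by metis
  have t01: "t n \<in> {0..<1}" for n
  proof -
    have "inverse (real (Suc n)) \<le> 1" by (simp add: field_simps)
    then show ?thesis using t[of n] by (auto simp del: of_nat_Suc)
  qed
  have tlim: "t \<longlonglongrightarrow> 1"
  proof (rule tendsto_sandwich)
    show "(\<lambda>n. 1 - inverse (real (Suc n))) \<longlonglongrightarrow> 1"
      using tendsto_diff[OF tendsto_const LIMSEQ_inverse_real_of_nat, of 1] by simp
    show "\<forall>\<^sub>F n in sequentially. 1 - inverse (real (Suc n)) \<le> t n"
      using t by (auto intro!: always_eventually less_imp_le simp del: of_nat_Suc)
    show "\<forall>\<^sub>F n in sequentially. t n \<le> 1"
      using t by (auto intro!: always_eventually less_imp_le simp del: of_nat_Suc)
  qed simp
  have "\<forall>n. g (t n) \<in> cball 0 r"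
    using gt by auto
  then obtain y \<sigma> where y: "strict_mono \<sigma>" "((\<lambda>n. g (t n)) \<circ> \<sigma>) \<longlonglongrightarrow> y"
    using compact_cball[of "0::complex" r] unfolding compact_def by metis
  have "(\<lambda>n. f (g (t (\<sigma> n)))) \<longlonglongrightarrow> f y"
    using y(2) contf by (auto simp: o_def continuous_on_eq_continuous_at intro: isCont_tendsto_compose)
  moreover have "(\<lambda>n. q (t (\<sigma> n))) \<longlonglongrightarrow> q 1"
  proof (rule continuous_on_tendsto_compose[OF q])
    show "(\<lambda>n. t (\<sigma> n)) \<longlonglongrightarrow> 1"
      using LIMSEQ_subseq_LIMSEQ[OF tlim y(1)] by (simp add: o_def)
    show "\<forall>\<^sub>F n in sequentially. t (\<sigma> n) \<in> {0..1}"
      using t01 by (auto intro!: always_eventually less_imp_le)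
  qed simp
  ultimately have fy: "f y = q 1"
    using fg t01 LIMSEQ_unique by fastforce
  then have dy: "deriv f y \<noteq> 0"
    using ns(1) unfolding critical_values_def by force
  obtain r0 where r0: "r0 > 0" "inj_on f (ball y r0)"
    using has_complex_derivative_locally_injective[OF hol UNIV_I open_UNIV dy] by metis
  have "(g \<longlongrightarrow> y) (at_left 1)"
  proof (rule tendstoI)
    fix \<epsilon> :: real assume "\<epsilon> > 0"
    define e where "e = min \<epsilon> r0 / 2"
    have e: "0 < e" "e < \<epsilon>" "e < r0"
      using \<open>\<epsilon> > 0\<close> r0(1) by (auto simp: e_def)
    \<comment> \<open>The lift returns close to \<open>y\<close> infinitely often. On a small circle
      about \<open>y\<close> the values of \<open>f\<close> keep a distance from \<open>q 1\<close>,
      so once \<open>q\<close> is close to \<open>q 1\<close> the lift can no longer cross the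
      circle.\<close>
    have fne: "f x \<noteq> q 1" if "x \<in> sphere y e" for x
      using that e r0 fy by (metis centre_in_ball dist_self inj_onD less_irrefl mem_ball mem_sphere)
    obtain \<eta> where \<eta>: "\<eta> > 0" "\<And>x. x \<in> sphere y e \<Longrightarrow> \<eta> \<le> dist (q 1) (f x)"
    proof -
      have "compact (f ` sphere y e)"
        by (intro compact_continuous_image continuous_on_subset[OF contf]) auto
      moreover have "q 1 \<notin> f ` sphere y e" using fne by force
      ultimately show thesis
        using separate_point_closed[of "f ` sphere y e" "q 1"] that compact_imp_closed by blast
    qed
    from tendstoD[OF q1 \<eta>(1)] obtain t0 where t0: "t0 < 1" "\<And>t. t0 < t \<Longrightarrow> t < 1 \<Longrightarrow> dist (q t) (q 1) < \<eta>"
      unfolding eventually_at_left_field by blast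
    have "eventually (\<lambda>n. t (\<sigma> n) > t0) sequentially"
      using LIMSEQ_subseq_LIMSEQ[OF tlim y(1)] t0(1) by (auto simp: o_def intro: order_tendstoD)
    moreover have "eventually (\<lambda>n. dist (g (t (\<sigma> n))) y < e) sequentially"
      using tendstoD[OF y(2) e(1)] by (simp add: o_def)
    ultimately obtain n where n: "t (\<sigma> n) > t0" "dist (g (t (\<sigma> n))) y < e"
      using eventually_happens[OF eventually_conj] by force
    define a where "a = t (\<sigma> n)"
    have "dist (g s) y < e" if as: "a < s" "s < 1" for s
    proof (rule ccontr)
      assume "\<not> dist (g s) y < e"
      moreover have "continuous_on {a..s} (\<lambda>s. dist (g s) y)"
        using t01[of "\<sigma> n"] that
        by (intro continuous_intros continuous_on_subset[OF g]) (auto simp: a_def)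
      ultimately obtain x where x: "a \<le> x" "x \<le> s" "dist (g x) y = e"
        using IVT'[of "\<lambda>s. dist (g s) y" a e s] n(2)[folded a_def] as(1)
        by (auto simp: not_less less_imp_le)
      then have "\<eta> \<le> dist (q 1) (f (g x))"
        by (intro \<eta>(2)) (simp add: dist_commute)
      moreover have "f (g x) = q x"
        using fg x that t01[of "\<sigma> n"] by (auto simp: a_def)
      moreover have "dist (q x) (q 1) < \<eta>"
        using t0(2) x that n(1) by (auto simp: a_def)
      ultimately show False by (simp add: dist_commute)
    qed
    then show "\<forall>\<^sub>F s in at_left 1. dist (g s) y < \<epsilon>"
      unfolding eventually_at_left_field using e(2) t01[of "\<sigma> n"] by (force simp: a_def)
  qed
  with fy dy that show thesis by blast
qed

text \<open>The set of agreement is closed by continuity and open because \<open>f\<close> is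
  injective near \<open>g x\<close>. The argument is local along \<open>g\<close>, so uniqueness is
  available before \<open>f\<close> is known to be a covering.\<close>

lemma lifts_agree_on_connected:
  fixes f :: "complex \<Rightarrow> complex" and g k :: "'a::topological_space \<Rightarrow> complex"
  assumes hol: "f holomorphic_on UNIV" and X: "connected X"
    and g: "continuous_on X g" and k: "continuous_on X k"
    and eq: "\<And>x. x \<in> X \<Longrightarrow> f (g x) = f (k x)"
    and reg: "\<And>x. x \<in> X \<Longrightarrow> deriv f (g x) \<noteq> 0"
    and a: "a \<in> X" "g a = k a" and x: "x \<in> X"
  shows "g x = k x"
proof -
  define E where "E = {x \<in> X. g x - k x = 0}"
  have "closedin (top_of_set X) E"
    unfolding E_def by (intro continuous_closedin_preimage_constant continuous_intros g k)
  moreover have "openin (top_of_set X) E"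
  proof (subst openin_subopen, intro ballI)
    fix x assume "x \<in> E"
    then have x: "x \<in> X" "g x = k x" by (auto simp: E_def)
    obtain r where r: "r > 0" "inj_on f (ball (g x) r)"
      using has_complex_derivative_locally_injective[OF hol UNIV_I open_UNIV reg[OF x(1)]] by metis
    have "openin (top_of_set X) (X \<inter> g -` ball (g x) r)" "openin (top_of_set X) (X \<inter> k -` ball (g x) r)"
      using g k by (auto intro: continuous_openin_preimage_gen)
    then have "openin (top_of_set X) ((X \<inter> g -` ball (g x) r) \<inter> (X \<inter> k -` ball (g x) r))"
      by blast
    moreover have "x \<in> (X \<inter> g -` ball (g x) r) \<inter> (X \<inter> k -` ball (g x) r)"
      using x r by auto
    moreover have "(X \<inter> g -` ball (g x) r) \<inter> (X \<inter> k -` ball (g x) r) \<subseteq> E"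
    proof
      fix x' assume "x' \<in> (X \<inter> g -` ball (g x) r) \<inter> (X \<inter> k -` ball (g x) r)"
      then show "x' \<in> E"
        using inj_onD[OF r(2) eq[of x']] by (simp add: E_def)
    qed
    ultimately show "\<exists>T. openin (top_of_set X) T \<and> x \<in> T \<and> T \<subseteq> E"
      by blast
  qed
  ultimately have "E = {} \<or> E = X"
    using X connected_clopen by blast
  then show ?thesis
    using a x by (auto simp: E_def)
qed

lemma local_inverse_branch:
  assumes hol: "f holomorphic_on UNIV" and dy: "deriv f y \<noteq> 0"
  obtains \<delta> k where "\<delta> > 0" "continuous_on (ball (f y) \<delta>) k"
    "\<And>z. z \<in> ball (f y) \<delta> \<Longrightarrow> f (k z) = z" "k (f y) = y"
proof -
  obtain r where r: "r > 0" "open (f ` ball y r)" "inj_on f (ball y r)"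
    using has_complex_derivative_locally_invertible[OF hol UNIV_I open_UNIV dy] by metis
  have "f holomorphic_on ball y r"
    using hol holomorphic_on_subset by blast
  then obtain k where k: "k holomorphic_on (f ` ball y r)" "\<And>z. z \<in> ball y r \<Longrightarrow> k (f z) = z"
    using holomorphic_has_inverse[OF _ open_ball r(3)] by metis
  obtain \<delta> where "\<delta> > 0" "ball (f y) \<delta> \<subseteq> f ` ball y r"
    using r by (meson centre_in_ball imageI openE)
  then show thesis
    using k r(1) holomorphic_on_imp_continuous_on[OF k(1)]
    by (intro that[of \<delta> k]) (auto intro: continuous_on_subset)
qed

text \<open>A branch on a smaller concentric ball extends across each boundary point: along the
  radius it converges by \<open>tendsto_of_lift_at_left\<close>, and the local inverse at the limit
  continues it. Compactness of the sphere turns these extensions into a larger ball, so the supremum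
  of the admissible radii is \<open>r\<close>.\<close>

lemma inverse_branch_on_ball:
  assumes hol: "f holomorphic_on UNIV" and r: "r > 0"
    and ns: "ball (f y) r \<inter> (critical_values f \<union> asymptotic_values f) = {}"
  obtains g where "continuous_on (ball (f y) r) g" "\<And>z. z \<in> ball (f y) r \<Longrightarrow> f (g z) = z" "g (f y) = y"
proof -
  define c where "c = f y"
  define br where "br = (\<lambda>g \<rho>. continuous_on (ball c \<rho>) g \<and> (\<forall>z\<in>ball c \<rho>. f (g z) = z) \<and> g c = y)"
  define R where "R = {\<rho>. 0 < \<rho> \<and> \<rho> \<le> r \<and> (\<exists>g. br g \<rho>)}"
  have reg: "deriv f w \<noteq> 0" if "f w \<in> ball c r" for w
    using that ns by (force simp: c_def critical_values_def)
  have "c \<in> ball c r" using r by simp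
  obtain \<delta> k where \<delta>: "\<delta> > 0" "continuous_on (ball c \<delta>) k" "\<And>z. z \<in> ball c \<delta> \<Longrightarrow> f (k z) = z" "k c = y"
    using local_inverse_branch[OF hol reg[of y]] r by (auto simp: c_def)
  have "br k (min \<delta> r)"
    using \<delta> by (auto simp: br_def intro: continuous_on_subset)
  then have R0: "min \<delta> r \<in> R"
    using \<delta>(1) r by (simp only: R_def mem_Collect_eq min_less_iff_conj min.cobounded2) blast
  have bdd: "bdd_above R"
    by (auto simp: R_def bdd_above_def)
  obtain gg where gg: "\<And>\<rho>. \<rho> \<in> R \<Longrightarrow> br (gg \<rho>) \<rho>"
  proof -
    have "\<forall>\<rho>. \<exists>g. \<rho> \<in> R \<longrightarrow> br g \<rho>" by (auto simp: R_def)
    then show thesis using that by metis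
  qed
  define s where "s = Sup R"
  have s: "0 < s" "s \<le> r"
  proof -
    have "min \<delta> r \<le> s"
      unfolding s_def using R0 bdd by (rule cSup_upper)
    then show "0 < s"
      using \<delta>(1) r by auto
    show "s \<le> r"
      unfolding s_def using R0 by (intro cSup_least) (blast, simp add: R_def)
  qed
  define G where "G = (\<lambda>z. gg (SOME \<rho>. \<rho> \<in> R \<and> dist c z < \<rho>) z)"
  have agree: "gg \<rho> z = gg \<rho>' z" if "\<rho> \<in> R" "\<rho>' \<in> R" "dist c z < \<rho>" "dist c z < \<rho>'" for \<rho> \<rho>' z
  proof (rule lifts_agree_on_connected[OF hol, of "ball c (min \<rho> \<rho>')" "gg \<rho>" "gg \<rho>'" c])
    show "deriv f (gg \<rho> x) \<noteq> 0" if "x \<in> ball c (min \<rho> \<rho>')" for x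
      using gg[OF \<open>\<rho> \<in> R\<close>] that \<open>\<rho> \<in> R\<close> by (intro reg) (auto simp: br_def R_def)
    show "continuous_on (ball c (min \<rho> \<rho>')) (gg \<rho>)" "continuous_on (ball c (min \<rho> \<rho>')) (gg \<rho>')"
      using gg[OF that(1)] gg[OF that(2)]
      by (auto simp: br_def elim!: continuous_on_subset)
  qed (use gg that in \<open>auto simp: br_def R_def\<close>)
  have G: "G z = gg \<rho> z" if "\<rho> \<in> R" "dist c z < \<rho>" for \<rho> z
  proof -
    have "(SOME \<rho>. \<rho> \<in> R \<and> dist c z < \<rho>) \<in> R \<and> dist c z < (SOME \<rho>. \<rho> \<in> R \<and> dist c z < \<rho>)"
      by (rule someI[of _ \<rho>]) (use that in auto)
    then show ?thesis
      unfolding G_def using agree that by blast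
  qed
  have exR: "\<exists>\<rho>\<in>R. dist c z < \<rho>" if "z \<in> ball c s" for z
    using that less_cSup_iff[of R] R0 bdd by (auto simp: s_def)
  have "br G s"
    unfolding br_def
  proof (intro conjI ballI)
    have "continuous_on (\<Union>((\<lambda>\<rho>. ball c \<rho>) ` R)) G"
    proof (rule continuous_on_open_Union)
      fix S assume "S \<in> ball c ` R"
      then obtain \<rho> where \<rho>: "\<rho> \<in> R" "S = ball c \<rho>" by auto
      have "continuous_on S (gg \<rho>)"
        using gg[OF \<rho>(1)] \<rho>(2) by (simp add: br_def)
      then show "continuous_on S G"
        by (rule continuous_on_eq) (use \<rho> G in auto)
    qed auto
    then show "continuous_on (ball c s) G"
      by (rule continuous_on_subset) (use exR in auto)
    show "f (G z) = z" if "z \<in> ball c s" for z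
      using exR[OF that] G gg by (force simp: br_def)
    show "G c = y"
      using exR[of c] s(1) G gg by (force simp: br_def)
  qed
  have "s = r"
  proof (rule ccontr)
    assume "s \<noteq> r"
    then have sr: "s < r" using s by simp
    have "\<exists>\<delta> k. \<delta> > 0 \<and> continuous_on (ball \<zeta> \<delta>) k \<and> (\<forall>z\<in>ball \<zeta> \<delta>. f (k z) = z)
        \<and> (\<forall>z\<in>ball \<zeta> \<delta> \<inter> ball c s. k z = G z) \<and> ball \<zeta> \<delta> \<subseteq> ball c r"
      if \<zeta>: "\<zeta> \<in> sphere c s" for \<zeta>
    proof -
      define q where "q = (\<lambda>t::real. c + of_real t * (\<zeta> - c))"
      have contq: "continuous_on A q" for A
        unfolding q_def by (intro continuous_intros)
      have dq: "dist c (q t) = t * s" if "t \<ge> 0" for t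
        using that \<zeta> by (simp add: q_def dist_norm norm_mult norm_minus_commute)
      have qs: "q t \<in> ball c s" if "t \<in> {0..<1}" for t
        using that s(1) by (simp add: dq)
      have q1: "q 1 = \<zeta>" by (simp add: q_def)
      have \<zeta>r: "\<zeta> \<in> ball c r" using \<zeta> sr by simp
      obtain y' where y': "f y' = \<zeta>" "deriv f y' \<noteq> 0" "((G \<circ> q) \<longlongrightarrow> y') (at_left 1)"
      proof (rule tendsto_of_lift_at_left[OF hol, of "G \<circ> q" q])
        show "continuous_on {0..<1} (G \<circ> q)"
        proof (rule continuous_on_compose[OF contq continuous_on_subset])
          show "continuous_on (ball c s) G" using \<open>br G s\<close> by (simp add: br_def)
        qed (use qs in blast)
        show "q 1 \<notin> critical_values f" "q 1 \<notin> asymptotic_values f"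
          using ns \<zeta>r by (auto simp: q1 c_def)
      qed (use \<open>br G s\<close> qs contq q1 in \<open>auto simp: br_def\<close>)
      obtain \<delta>1 k where k: "\<delta>1 > 0" "continuous_on (ball \<zeta> \<delta>1) k"
         "\<And>z. z \<in> ball \<zeta> \<delta>1 \<Longrightarrow> f (k z) = z" "k \<zeta> = y'"
        using local_inverse_branch[OF hol y'(2)] y'(1) by metis
      define \<delta> where "\<delta> = min \<delta>1 (r - s)"
      have \<delta>: "\<delta> > 0" "ball \<zeta> \<delta> \<subseteq> ball c r" "ball \<zeta> \<delta> \<subseteq> ball \<zeta> \<delta>1"
      proof -
        show "ball \<zeta> \<delta> \<subseteq> ball c r"
        proof
          fix x assume "x \<in> ball \<zeta> \<delta>"
          then show "x \<in> ball c r"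
            using \<zeta> dist_triangle[of c x \<zeta>] by (auto simp: \<delta>_def)
        qed
      qed (use k(1) sr in \<open>auto simp: \<delta>_def\<close>)
      obtain \<rho> where \<rho>: "\<rho> > 0" "inj_on f (ball y' \<rho>)"
        using has_complex_derivative_locally_injective[OF hol UNIV_I open_UNIV y'(2)] by metis
      have qlim: "(q \<longlongrightarrow> \<zeta>) (at_left 1)"
        using continuous_on_Icc_at_leftD[OF contq, of 0 1] q1 by simp
      have klim: "((\<lambda>t. k (q t)) \<longlongrightarrow> y') (at_left 1)"
      proof -
        have "isCont k \<zeta>"
          using k(1,2) by (simp add: continuous_on_eq_continuous_at)
        from isCont_tendsto_compose[OF this qlim] show ?thesis using k(4) by simp
      qed
      have "eventually (\<lambda>t. dist (k (q t)) y' < \<rho>) (at_left 1)" "eventually (\<lambda>t. dist ((G \<circ> q) t) y' < \<rho>) (at_left 1)"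
           "eventually (\<lambda>t. dist (q t) \<zeta> < \<delta>) (at_left 1)"
        using tendstoD[OF klim \<rho>(1)] tendstoD[OF y'(3) \<rho>(1)] tendstoD[OF qlim \<delta>(1)] by auto
      moreover have "eventually (\<lambda>t::real. t \<in> {0<..<1}) (at_left 1)"
        by (auto simp: eventually_at_left_field intro: exI[of _ 0])
      ultimately have "eventually (\<lambda>t. t \<in> {0<..<1} \<and> dist (k (q t)) y' < \<rho> \<and> dist (G (q t)) y' < \<rho> \<and> dist (q t) \<zeta> < \<delta>) (at_left 1)"
        by eventually_elim auto
      then obtain t where t: "t \<in> {0<..<1}" "dist (k (q t)) y' < \<rho>" "dist (G (q t)) y' < \<rho>" "dist (q t) \<zeta> < \<delta>"
        using eventually_happens'[OF trivial_limit_at_left_real] by blast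
      have qt: "q t \<in> ball \<zeta> \<delta> \<inter> ball c s"
        using t qs by (auto simp: dist_commute)
      have kGt: "k (q t) = G (q t)"
      proof (rule inj_onD[OF \<rho>(2)])
        show "f (k (q t)) = f (G (q t))"
          using qt k(3)[of "q t"] \<delta>(3) \<open>br G s\<close> by (auto simp: br_def)
      qed (use t in \<open>auto simp: dist_commute\<close>)
      have "k z = G z" if "z \<in> ball \<zeta> \<delta> \<inter> ball c s" for z
      proof (rule lifts_agree_on_connected[OF hol, of "ball \<zeta> \<delta> \<inter> ball c s" k G "q t"])
        show "connected (ball \<zeta> \<delta> \<inter> ball c s)"
          by (intro convex_connected convex_Int convex_ball)
        show "continuous_on (ball \<zeta> \<delta> \<inter> ball c s) k" "continuous_on (ball \<zeta> \<delta> \<inter> ball c s) G"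
          using k \<delta> \<open>br G s\<close> by (auto simp: br_def intro: continuous_on_subset)
        show "deriv f (k x) \<noteq> 0" if "x \<in> ball \<zeta> \<delta> \<inter> ball c s" for x
          using that k(3)[of x] \<delta>(2,3) by (intro reg) (metis IntD1 subsetD)
        show "f (k x) = f (G x)" if "x \<in> ball \<zeta> \<delta> \<inter> ball c s" for x
          using that k(3)[of x] \<delta>(3) \<open>br G s\<close> by (auto simp: br_def)
      qed (use that qt kGt in auto)
      then show ?thesis
        using \<delta> k by (intro exI[of _ \<delta>] exI[of _ k]) (auto intro: continuous_on_subset)
    qed
    then obtain d k where dk: "\<And>\<zeta>. \<zeta> \<in> sphere c s \<Longrightarrow> d \<zeta> > 0 \<and> continuous_on (ball \<zeta> (d \<zeta>)) (k \<zeta>)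
        \<and> (\<forall>z\<in>ball \<zeta> (d \<zeta>). f (k \<zeta> z) = z)
        \<and> (\<forall>z\<in>ball \<zeta> (d \<zeta>) \<inter> ball c s. k \<zeta> z = G z) \<and> ball \<zeta> (d \<zeta>) \<subseteq> ball c r"
      by metis
    \<comment> \<open>The point that divides the chord between the centres in the ratio of the radii
      lies in both discs and, by strict convexity, inside \<open>ball c s\<close>, where both
      branches equal \<open>G\<close>. Uniqueness spreads the agreement over the
      intersection.\<close>
    have lens: "k \<zeta> z = k \<zeta>' z" if \<zeta>: "\<zeta> \<in> sphere c s" "\<zeta>' \<in> sphere c s"
      and z: "z \<in> ball \<zeta> (d \<zeta>)" "z \<in> ball \<zeta>' (d \<zeta>')" for \<zeta> \<zeta>' z
    proof (cases "\<zeta> = \<zeta>'")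
      case False
      define l where "l = d \<zeta> / (d \<zeta> + d \<zeta>')"
      define x where "x = (1 - l) *\<^sub>R \<zeta> + l *\<^sub>R \<zeta>'"
      have dpos: "d \<zeta> > 0" "d \<zeta>' > 0" using dk \<zeta> by auto
      then have l: "0 < l" "l < 1" by (auto simp: l_def)
      have D: "dist \<zeta> \<zeta>' < d \<zeta> + d \<zeta>'"
        using z dist_triangle_less_add[of \<zeta> z "d \<zeta>" \<zeta>' "d \<zeta>'"] by (simp add: dist_commute)
      have "x \<in> open_segment \<zeta> \<zeta>'"
        using False l by (auto simp: in_segment x_def)
      then have "dist c x < s"
        using dist_decreases_open_segment[of x \<zeta> \<zeta>' c] \<zeta> by auto
      moreover have "x \<in> ball \<zeta> (d \<zeta>)"
      proof -
        have "x - \<zeta> = l *\<^sub>R (\<zeta>' - \<zeta>)" by (simp add: x_def algebra_simps)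
        then have "dist x \<zeta> = l * dist \<zeta>' \<zeta>"
          using l(1) by (simp add: dist_norm)
        then have "dist \<zeta> x = l * dist \<zeta> \<zeta>'"
          by (simp add: dist_commute)
        also have "\<dots> < l * (d \<zeta> + d \<zeta>')" using l D by simp
        finally show ?thesis using dpos by (simp add: l_def)
      qed
      moreover have "x \<in> ball \<zeta>' (d \<zeta>')"
      proof -
        have "x - \<zeta>' = (1 - l) *\<^sub>R (\<zeta> - \<zeta>')" by (simp add: x_def algebra_simps)
        then have "dist \<zeta>' x = (1 - l) * dist \<zeta> \<zeta>'"
          using l(2) by (simp add: dist_norm norm_minus_commute[of \<zeta>' x])
        also have "\<dots> < (1 - l) * (d \<zeta> + d \<zeta>')" using l D by simp
        also have "1 - l = d \<zeta>' / (d \<zeta> + d \<zeta>')" using dpos by (simp add: l_def field_simps)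
        finally show ?thesis using dpos by simp
      qed
      ultimately have x: "x \<in> ball \<zeta> (d \<zeta>) \<inter> ball \<zeta>' (d \<zeta>')" "k \<zeta> x = k \<zeta>' x"
        using dk[OF \<zeta>(1)] dk[OF \<zeta>(2)] by auto
      show ?thesis
      proof (rule lifts_agree_on_connected[OF hol, of "ball \<zeta> (d \<zeta>) \<inter> ball \<zeta>' (d \<zeta>')" "k \<zeta>" "k \<zeta>'" x])
        show "connected (ball \<zeta> (d \<zeta>) \<inter> ball \<zeta>' (d \<zeta>'))"
          by (intro convex_connected convex_Int convex_ball)
        show "continuous_on (ball \<zeta> (d \<zeta>) \<inter> ball \<zeta>' (d \<zeta>')) (k \<zeta>)"
             "continuous_on (ball \<zeta> (d \<zeta>) \<inter> ball \<zeta>' (d \<zeta>')) (k \<zeta>')"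
          using dk[OF \<zeta>(1)] dk[OF \<zeta>(2)] by (auto intro: continuous_on_subset)
        show "f (k \<zeta> x) = f (k \<zeta>' x)" if "x \<in> ball \<zeta> (d \<zeta>) \<inter> ball \<zeta>' (d \<zeta>')" for x
          using that dk[OF \<zeta>(1)] dk[OF \<zeta>(2)] by auto
        show "deriv f (k \<zeta> x) \<noteq> 0" if "x \<in> ball \<zeta> (d \<zeta>) \<inter> ball \<zeta>' (d \<zeta>')" for x
          using that dk[OF \<zeta>(1)] by (intro reg) (metis IntD1 subsetD)
      qed (use x z in auto)
    qed auto
    define ch where "ch = (\<lambda>z. SOME \<zeta>. \<zeta> \<in> sphere c s \<and> z \<in> ball \<zeta> (d \<zeta>))"
    define H where "H = (\<lambda>z. if z \<in> ball c s then G z else k (ch z) z)"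
    have Hk: "H z = k \<zeta> z" if "\<zeta> \<in> sphere c s" "z \<in> ball \<zeta> (d \<zeta>)" for \<zeta> z
    proof (cases "z \<in> ball c s")
      case True then show ?thesis using dk[OF that(1)] that by (auto simp: H_def)
    next
      case False
      have "ch z \<in> sphere c s \<and> z \<in> ball (ch z) (d (ch z))"
        unfolding ch_def by (rule someI[of _ \<zeta>]) (use that in simp)
      then have "k (ch z) z = k \<zeta> z" using lens that by blast
      then show ?thesis using False by (simp add: H_def)
    qed
    define \<O> where "\<O> = insert (ball c s) ((\<lambda>\<zeta>. ball \<zeta> (d \<zeta>)) ` sphere c s)"
    have contH: "continuous_on (\<Union>\<O>) H"
    proof (rule continuous_on_open_Union)
      fix S assume "S \<in> \<O>"
      then consider "S = ball c s" | \<zeta> where "\<zeta> \<in> sphere c s" "S = ball \<zeta> (d \<zeta>)"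
        by (auto simp: \<O>_def)
      then show "continuous_on S H"
      proof cases
        case 1
        then show ?thesis
          using \<open>br G s\<close> by (auto simp: br_def H_def intro: continuous_on_eq[of _ G])
      next
        case 2
        have "continuous_on S (k \<zeta>)" using dk 2 by auto
        then show ?thesis
          by (rule continuous_on_eq) (use 2 Hk in auto)
      qed
    qed (auto simp: \<O>_def)
    have "cball c s \<subseteq> \<Union>\<O>"
    proof
      fix x assume "x \<in> cball c s"
      then consider "x \<in> ball c s" | "x \<in> sphere c s" by fastforce
      then show "x \<in> \<Union>\<O>"
        using dk by cases (force simp: \<O>_def)+
    qed
    moreover have "open (\<Union>\<O>)" by (auto simp: \<O>_def)
    ultimately obtain e where e: "e > 0" "(\<Union>x\<in>cball c s. ball x e) \<subseteq> \<Union>\<O>"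
      using compact_subset_open_imp_ball_epsilon_subset[OF compact_cball] by metis
    define s' where "s' = min (s + e/2) r"
    have s': "s < s'" "s' \<le> r" using e sr by (auto simp: s'_def)
    have sub: "ball c s' \<subseteq> \<Union>\<O>"
    proof
      fix x assume x: "x \<in> ball c s'"
      show "x \<in> \<Union>\<O>"
      proof (cases "x \<in> cball c s")
        case True then show ?thesis using \<open>cball c s \<subseteq> \<Union>\<O>\<close> by blast
      next
        case False
        \<comment> \<open>The radial projection of \<open>x\<close> to the sphere; \<open>x\<close>
          is less than \<open>e / 2\<close> further out.\<close>
        define w where "w = c + of_real (s / dist c x) * (x - c)"
        have dx: "dist c x > s" using False by simp
        have "dist w c = (s / dist c x) * dist x c"
          using s(1) by (simp add: w_def dist_norm norm_mult norm_divide)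
        then have "dist c w = s" using dx s(1) by (auto simp: dist_commute)
        moreover have "dist w x < e"
        proof -
          have "x - w = of_real (1 - s / dist c x) * (x - c)" by (simp add: w_def algebra_simps)
          moreover have "0 \<le> 1 - s / dist c x"
            using dx s(1) by (simp add: divide_le_eq_1)
          ultimately have "dist x w = (1 - s / dist c x) * dist x c"
            by (metis abs_of_nonneg dist_norm norm_mult norm_of_real)
          then have "dist w x = (1 - s / dist c x) * dist c x"
            by (simp add: dist_commute)
          also have "\<dots> = dist c x - s" using dx s(1) by (auto simp: field_simps)
          also have "\<dots> < e" using x e by (auto simp: s'_def)
          finally show ?thesis .
        qed
        ultimately have "w \<in> cball c s" "x \<in> ball w e" by auto
        then show ?thesis using e(2) by blast
      qed
    qed
    have "br H s'"
      unfolding br_def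
    proof (intro conjI ballI)
      show "continuous_on (ball c s') H"
        using contH sub continuous_on_subset by blast
      show "H c = y"
        using s(1) \<open>br G s\<close> by (auto simp: H_def br_def)
      show "f (H z) = z" if "z \<in> ball c s'" for z
      proof -
        have "z \<in> \<Union>\<O>" using that sub by blast
        then consider "z \<in> ball c s" | \<zeta> where "\<zeta> \<in> sphere c s" "z \<in> ball \<zeta> (d \<zeta>)"
          by (auto simp: \<O>_def)
        then show ?thesis
        proof cases
          case 1 then show ?thesis using \<open>br G s\<close> by (auto simp: H_def br_def)
        next
          case 2 then show ?thesis using Hk dk by auto
        qed
      qed
    qed
    then have "s' \<in> R"
      using s' s by (auto simp: R_def)
    then have "s' \<le> s"
      unfolding s_def using bdd by (rule cSup_upper)
    with s' show False by simp
  qed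
  with \<open>br G s\<close> that show thesis
    by (auto simp: br_def c_def)
qed

text \<open>The sheets over a small disc are the images of the branches through the points of the
  fibre; two sheets that meet coincide by uniqueness of lifts.\<close>

theorem covering_space_of_no_singular_values:
  assumes hol: "f holomorphic_on UNIV" and G: "open G" "connected G"
    and ns: "G \<inter> (critical_values f \<union> asymptotic_values f) = {}"
    and ne: "f -` G \<noteq> {}"
  shows "covering_space (f -` G) f G"
proof
  have contf: "continuous_on A f" for A
    using hol holomorphic_on_imp_continuous_on holomorphic_on_subset by blast
  show "continuous_on (f -` G) f" by (rule contf)
  have opV: "open (f -` H)" if "open H" for H
    using that contf[of UNIV] by (simp add: continuous_open_vimage continuous_on_eq_continuous_at)
  have reg: "deriv f w \<noteq> 0" if "f w \<in> G" for w
    using that ns by (force simp: critical_values_def)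
  have br: "\<exists>g. continuous_on (ball x r) g \<and> (\<forall>z\<in>ball x r. f (g z) = z) \<and> g (f p) = p"
    if that: "r > 0" "ball x (3 * r) \<subseteq> G" "f p \<in> ball x r" for x r p
  proof -
    \<comment> \<open>The branch has to be centred at \<open>f p\<close>, not at \<open>x\<close>.
      Radius \<open>2 * r\<close> about \<open>f p\<close> covers \<open>ball x r\<close> and stays
      within \<open>ball x (3 * r)\<close>, so one disc about \<open>x\<close> serves all points
      above it.\<close>
    have sub: "ball (f p) (2 * r) \<subseteq> ball x (3 * r)" "ball x r \<subseteq> ball (f p) (2 * r)"
      using that(3) by (auto simp: ball_subset_ball_iff dist_commute)
    have "ball (f p) (2 * r) \<inter> (critical_values f \<union> asymptotic_values f) = {}"
      using sub(1) that(2) ns by blast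
    moreover have "0 < 2 * r" using that(1) by simp
    ultimately obtain g where "continuous_on (ball (f p) (2 * r)) g" "\<And>z. z \<in> ball (f p) (2 * r) \<Longrightarrow> f (g z) = z" "g (f p) = p"
      using inverse_branch_on_ball[OF hol] by metis
    then show ?thesis
      using sub(2) continuous_on_subset by blast
  qed
  \<comment> \<open>Surjectivity by connectedness of \<open>G\<close>: a branch on all of
    \<open>ball x r\<close> exists as soon as one value of \<open>f\<close> falls into that disc, so
    the image is relatively closed as well as open.\<close>
  show "f ` (f -` G) = G"
  proof -
    have "openin (top_of_set G) (f ` (f -` G))"
    proof -
      have "open (f ` (f -` G))"
      proof (subst open_subopen, intro ballI)
        fix w assume "w \<in> f ` (f -` G)"
        then obtain p where p: "w = f p" "f p \<in> G" by auto
        obtain r where r: "r > 0" "ball w (3 * r) \<subseteq> G"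
        proof -
          obtain e where "e > 0" "ball w e \<subseteq> G" using G(1) p by (metis openE)
          then show thesis using that[of "e / 3"] by simp
        qed
        obtain g where g: "\<forall>z\<in>ball w r. f (g z) = z"
          using br[OF r, of p] p r(1) by auto
        have "z \<in> f ` (f -` G)" if "z \<in> ball w r" for z
        proof (rule image_eqI[of _ _ "g z"])
          show "z = f (g z)" using g that by auto
          have "z \<in> ball w (3 * r)" using that r(1) by auto
          then show "g z \<in> f -` G" using g that r(2) by auto
        qed
        then show "\<exists>T. open T \<and> w \<in> T \<and> T \<subseteq> f ` (f -` G)"
          using r(1) by (intro exI[of _ "ball w r"]) auto
      qed
      then show ?thesis by (intro openin_open_eq[THEN iffD2] G) auto
    qed
    moreover have "closedin (top_of_set G) (f ` (f -` G))"
    proof (subst closedin_limpt, intro conjI allI impI)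
      fix x assume x: "x islimpt f ` (f -` G) \<and> x \<in> G"
      obtain r where r: "r > 0" "ball x (3 * r) \<subseteq> G"
      proof -
        obtain e where "e > 0" "ball x e \<subseteq> G" using G(1) x by (metis openE)
        then show thesis using that[of "e / 3"] by simp
      qed
      obtain p where "f p \<in> ball x r"
        using x r(1) by (force simp: islimpt_approachable dist_commute)
      then obtain g where g: "\<forall>z\<in>ball x r. f (g z) = z" using br[OF r] by blast
      then show "x \<in> f ` (f -` G)"
        using r(1) x by (intro image_eqI[of _ _ "g x"]) auto
    qed auto
    moreover have "f ` (f -` G) \<noteq> {}" using ne by auto
    ultimately show ?thesis using G(2) connected_clopen by blast
  qed
  fix x assume x: "x \<in> G"
  obtain r where r: "r > 0" "ball x (3 * r) \<subseteq> G"
  proof -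
    obtain e where "e > 0" "ball x e \<subseteq> G" using G(1) x by (metis openE)
    then show thesis using that[of "e / 3"] by simp
  qed
  define T where "T = ball x r"
  have TG: "T \<subseteq> G" using r by (auto simp: T_def)
  obtain g where g: "\<And>p. f p \<in> T \<Longrightarrow> continuous_on T (g p) \<and> (\<forall>z\<in>T. f (g p z) = z) \<and> g p (f p) = p"
    using br[OF r] unfolding T_def by metis
  have inj: "inj_on (g p) T" if "f p \<in> T" for p
    using g[OF that] by (metis inj_onI)
  define v where "v = (\<lambda>p. g p ` T) ` (f -` T)"
  have opg: "open (g p ` T)" if "f p \<in> T" for p
    using g[OF that] inj[OF that] by (intro invariance_of_domain) (auto simp: T_def)
  show "\<exists>T. x \<in> T \<and> openin (top_of_set G) T \<and>
         (\<exists>v. \<Union> v = f -` G \<inter> f -` T \<and> (\<forall>u\<in>v. openin (top_of_set (f -` G)) u) \<and>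
              pairwise disjnt v \<and> (\<forall>u\<in>v. \<exists>q. homeomorphism u T f q))"
  proof (intro exI[of _ T] exI[of _ v] conjI ballI)
    show "x \<in> T" using r by (simp add: T_def)
    show "openin (top_of_set G) T" using TG by (simp add: T_def open_subset)
    show "\<Union> v = f -` G \<inter> f -` T"
    proof
      show "\<Union> v \<subseteq> f -` G \<inter> f -` T" using g TG by (auto simp: v_def)
      show "f -` G \<inter> f -` T \<subseteq> \<Union> v"
      proof
        fix p assume "p \<in> f -` G \<inter> f -` T"
        then have "f p \<in> T" "p = g p (f p)" using g by auto
        then show "p \<in> \<Union> v" unfolding v_def by blast
      qed
    qed
    fix u assume "u \<in> v"
    then obtain p where p: "f p \<in> T" "u = g p ` T" by (auto simp: v_def)
    show "openin (top_of_set (f -` G)) u"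
      using opg[OF p(1)] g[OF p(1)] TG p(2) by (intro open_subset) auto
    have "f ` u = T" using g[OF p(1)] p(2) by (force simp: image_iff)
    then show "\<exists>q. homeomorphism u T f q"
      using g[OF p(1)] p(2) by (intro exI[of _ "g p"]) (auto simp: homeomorphism_def contf)
  next
    show "pairwise disjnt v"
    proof (clarsimp simp: pairwise_def v_def)
      fix p p' assume p: "f p \<in> T" "f p' \<in> T" "g p ` T \<noteq> g p' ` T"
      show "disjnt (g p ` T) (g p' ` T)"
      proof (rule ccontr)
        assume "\<not> disjnt (g p ` T) (g p' ` T)"
        then obtain a a' where a: "a \<in> T" "a' \<in> T" "g p a = g p' a'" by (auto simp: disjnt_def)
        then have aa: "a = a'" using g p by metis
        have "g p z = g p' z" if "z \<in> T" for z
        proof (rule lifts_agree_on_connected[OF hol, of T "g p" "g p'" a])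
          show "connected T" by (simp add: T_def)
          show "deriv f (g p y) \<noteq> 0" if "y \<in> T" for y
            using that g[OF p(1)] TG by (intro reg) auto
        qed (use g[OF p(1)] g[OF p(2)] a aa that in auto)
        then have "g p ` T = g p' ` T" by (auto simp: image_iff)
        with p(3) show False by simp
      qed
    qed
  qed
qed

section \<open>Shrinking of inverse branches\<close>

lemma unbounded_nat_strict_mono:
  fixes P :: "nat \<Rightarrow> bool"
  assumes "\<And>n. \<exists>m\<ge>n. P m"
  obtains \<sigma> :: "nat \<Rightarrow> nat" where "strict_mono \<sigma>" "\<And>n. P (\<sigma> n)"
proof -
  have inf: "infinite {m. P m}"
    using assms by (auto simp: infinite_nat_iff_unbounded_le)
  show thesis
    using that[of "enumerate {m. P m}"] strict_mono_enumerate[OF inf] enumerate_in_set[OF inf] by auto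
qed

lemma not_LIMSEQ_subseq:
  fixes X :: "nat \<Rightarrow> 'a::metric_space"
  assumes "\<not> X \<longlonglongrightarrow> L"
  obtains e \<sigma> where "e > 0" "strict_mono (\<sigma> :: nat \<Rightarrow> nat)" "\<And>n. dist (X (\<sigma> n)) L \<ge> e"
proof -
  obtain e where e: "e > 0" "\<And>n. \<exists>m\<ge>n. dist (X m) L \<ge> e"
    using assms by (auto simp: lim_sequentially not_less)
  from unbounded_nat_strict_mono[of "\<lambda>m. dist (X m) L \<ge> e"] e(2) obtain \<sigma> :: "nat \<Rightarrow> nat"
    where "strict_mono \<sigma>" "\<And>n. dist (X (\<sigma> n)) L \<ge> e" by blast
  with e(1) that show thesis by blast
qed

text \<open>\<open>Schottky\<close> for functions omitting 0 and 1 on the unit disc, after affine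
  changes in domain and range. What matters is that \<open>B\<close> is chosen before the function
  and the disc.\<close>

lemma Schottky_two_values:
  fixes a b :: complex
  assumes ab: "a \<noteq> b" and t: "0 < t" "t < 1"
  obtains B where "\<And>h c r z. r > 0 \<Longrightarrow> h holomorphic_on cball c r \<Longrightarrow>
     (\<And>w. w \<in> cball c r \<Longrightarrow> h w \<noteq> a \<and> h w \<noteq> b) \<Longrightarrow> norm (h c) \<le> M \<Longrightarrow> z \<in> cball c (t * r) \<Longrightarrow> norm (h z) \<le> B"
proof -
  define M' where "M' = (M + norm a) / norm (b - a)"
  define B where "B = exp (pi * exp (pi * (2 + 2 * M' + 12 * t / (1 - t))))"
  have "norm (h z) \<le> norm a + norm (b - a) * B"
    if r: "r > 0" and h: "h holomorphic_on cball c r" and om: "\<And>w. w \<in> cball c r \<Longrightarrow> h w \<noteq> a \<and> h w \<noteq> b"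
      and hc: "norm (h c) \<le> M" and z: "z \<in> cball c (t * r)" for h c r z
  proof -
    define k where "k = (\<lambda>w. (h (c + of_real r * w) - a) / (b - a))"
    have inb: "c + of_real r * w \<in> cball c r" if "w \<in> cball 0 1" for w
      using that r by (simp add: dist_norm norm_mult)
    have kh: "k holomorphic_on cball 0 1"
    proof -
      have "(h \<circ> (\<lambda>w. c + of_real r * w)) holomorphic_on cball 0 1"
        by (rule holomorphic_on_compose_gen[OF _ h]) (use inb in \<open>auto intro!: holomorphic_intros\<close>)
      then show ?thesis
        unfolding k_def o_def using ab by (intro holomorphic_intros) auto
    qed
    define w where "w = (z - c) / of_real r"
    have w: "norm w \<le> t" "c + of_real r * w = z"
      using z r by (auto simp: w_def dist_norm norm_divide norm_minus_commute field_simps)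
    have "norm (k w) \<le> B"
      unfolding B_def
    proof (rule Schottky[OF kh _ _ t w(1)])
      have "norm (k 0) \<le> (norm (h c) + norm a) / norm (b - a)"
        unfolding k_def norm_divide by (intro divide_right_mono) (auto simp: norm_triangle_ineq4)
      also have "\<dots> \<le> M'"
        unfolding M'_def using hc by (intro divide_right_mono) auto
      finally show "norm (k 0) \<le> M'" .
      fix v :: complex assume "v \<in> cball 0 1"
      from om[OF inb[OF this]] show "\<not> (k v = 0 \<or> k v = 1)"
        using ab by (auto simp: k_def)
    qed
    moreover have "h z = a + (b - a) * k w"
      using ab w(2) by (simp add: k_def)
    ultimately have "norm (h z) \<le> norm a + norm (b - a) * norm (k w)"
      by (metis norm_mult norm_triangle_ineq)
    then show ?thesis
      using \<open>norm (k w) \<le> B\<close> by (smt (verit) mult_left_mono norm_ge_zero)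
  qed
  with that show thesis by blast
qed

text \<open>The bound is given at one point, which may vary with \<open>n\<close>. Schottky moves it
  to the centre and from there to every compact subset.\<close>

lemma Montel_two_values:
  fixes h :: "nat \<Rightarrow> complex \<Rightarrow> complex"
  assumes ab: "a \<noteq> b" and r: "r > 0"
    and hol: "\<And>n. h n holomorphic_on ball c r"
    and om: "\<And>n w. w \<in> ball c r \<Longrightarrow> h n w \<noteq> a \<and> h n w \<noteq> b"
    and bd: "\<And>n. \<exists>w\<in>cball c (r/4). norm (h n w) \<le> M"
  obtains g \<sigma> where "g holomorphic_on ball c r" "strict_mono (\<sigma> :: nat \<Rightarrow> nat)"
    "\<And>x. x \<in> ball c r \<Longrightarrow> (\<lambda>n. h (\<sigma> n) x) \<longlonglongrightarrow> g x"
    "\<And>K. compact K \<Longrightarrow> K \<subseteq> ball c r \<Longrightarrow> uniform_limit K (h \<circ> \<sigma>) g sequentially"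
proof (rule Montel[of "ball c r" "range h" h])
  obtain M' where M': "\<And>h c r z. r > 0 \<Longrightarrow> h holomorphic_on cball c r \<Longrightarrow>
     (\<And>w. w \<in> cball c r \<Longrightarrow> h w \<noteq> a \<and> h w \<noteq> b) \<Longrightarrow> norm (h c) \<le> M \<Longrightarrow> z \<in> cball c (1/2 * r) \<Longrightarrow> norm (h z) \<le> M'"
    by (rule Schottky_two_values[OF ab, of "1/2" M]) (simp, simp, blast)
  have hc: "norm (h n c) \<le> M'" for n
  proof -
    obtain w where w: "w \<in> cball c (r/4)" "norm (h n w) \<le> M" using bd by blast
    \<comment> \<open>Origin of the quarter: the disc of radius \<open>r / 2\<close> about
      \<open>w\<close> stays in \<open>ball c r\<close>, and its half already contains
      \<open>c\<close>.\<close>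
    have sub: "cball w (r/2) \<subseteq> ball c r"
      using w(1) r by (auto simp: cball_subset_ball_iff dist_commute)
    show ?thesis
    proof (rule M'[of "r/2" "h n" w])
      show "h n holomorphic_on cball w (r/2)"
        using holomorphic_on_subset[OF hol sub] .
      show "h n v \<noteq> a \<and> h n v \<noteq> b" if "v \<in> cball w (r/2)" for v
        using om sub that by blast
    qed (use w r in \<open>auto simp: dist_commute\<close>)
  qed
  show "\<exists>B. \<forall>g\<in>range h. \<forall>z\<in>K. norm (g z) \<le> B" if K: "compact K" "K \<subseteq> ball c r" for K
  proof -
    obtain s where s: "0 < s" "s < r" "K \<subseteq> cball c s"
    proof -
      obtain s where s: "s < r" "\<And>z. z \<in> K \<Longrightarrow> dist c z \<le> s"
      proof (cases "K = {}")
        case True then show thesis using that[of 0] r by auto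
      next
        case False
        have "continuous_on K (dist c)" by (intro continuous_intros)
        then obtain x where "x \<in> K" "\<forall>y\<in>K. dist c y \<le> dist c x"
          using continuous_attains_sup[OF K(1) False] by blast
        then show thesis using that[of "dist c x"] K(2) by auto
      qed
      then show thesis using that[of "max s (r/2)"] r by fastforce
    qed
    define \<rho> where "\<rho> = (s + r) / 2"
    have \<rho>: "s < \<rho>" "\<rho> < r" "\<rho> > 0" using s by (auto simp: \<rho>_def)
    obtain B where B: "\<And>h c r z. r > 0 \<Longrightarrow> h holomorphic_on cball c r \<Longrightarrow>
     (\<And>w. w \<in> cball c r \<Longrightarrow> h w \<noteq> a \<and> h w \<noteq> b) \<Longrightarrow> norm (h c) \<le> M' \<Longrightarrow> z \<in> cball c (s / \<rho> * r) \<Longrightarrow> norm (h z) \<le> B"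
      by (rule Schottky_two_values[OF ab, of "s/\<rho>" M']) (use \<rho> s in simp, use \<rho> s in simp, blast)
    have sub: "cball c \<rho> \<subseteq> ball c r" using \<rho> by (auto simp: cball_subset_ball_iff)
    have "norm (h n z) \<le> B" if "z \<in> K" for n z
    proof (rule B[of \<rho> "h n" c])
      show "h n holomorphic_on cball c \<rho>"
        using holomorphic_on_subset[OF hol sub] .
      show "h n v \<noteq> a \<and> h n v \<noteq> b" if "v \<in> cball c \<rho>" for v
        using om sub that by blast
      show "z \<in> cball c (s / \<rho> * \<rho>)"
        using that s(3) \<rho> by auto
    qed (use \<rho> hc in auto)
    then show ?thesis by auto
  qed
qed (use hol that in auto)

section \<open>Inverse branches of iterates over an expanding domain\<close>

locale expanding_domain =
  fixes f :: "complex \<Rightarrow> complex" and U :: "complex set" and z0 q0 :: complex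
  assumes hol: "f holomorphic_on UNIV"
    and U: "open U" "connected U"
    and ns: "U \<inter> (critical_values f \<union> asymptotic_values f) = {}"
    and preimage_sub: "f -` U \<subseteq> U"
    and preimage_ne: "f -` U \<noteq> {}"
    and z0: "f z0 = z0" "z0 \<notin> U"
    and q0: "q0 \<in> U" "f q0 \<notin> U"
begin

lemma cov: "covering_space (f -` U) f U"
  by (rule covering_space_of_no_singular_values[OF hol U ns preimage_ne])

lemma contf: "continuous_on A f"
  using hol holomorphic_on_imp_continuous_on holomorphic_on_subset by blast

lemma hol_iter: "(f ^^ n) holomorphic_on A"
proof (induction n arbitrary: A)
  case (Suc n)
  have "(f ^^ n) holomorphic_on f ` A" by (rule Suc)
  moreover have "f holomorphic_on A" using hol holomorphic_on_subset by blast
  ultimately show ?case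
    unfolding funpow_Suc_right by (intro holomorphic_on_compose)
qed (auto intro: holomorphic_intros)

lemma cont_iter: "continuous_on A (f ^^ n)"
  using hol_iter holomorphic_on_imp_continuous_on by blast

lemma isCont_iter: "isCont (f ^^ n) z"
  using cont_iter[of UNIV n] by (simp add: continuous_on_eq_continuous_at)

lemma deriv_nonzero: "f w \<in> U \<Longrightarrow> deriv f w \<noteq> 0"
  using ns by (force simp: critical_values_def)

lemma in_U_of_image: "f w \<in> U \<Longrightarrow> w \<in> U"
  using preimage_sub by auto

lemma in_U_of_iter: "(f ^^ n) w \<in> U \<Longrightarrow> w \<in> U"
  by (induction n arbitrary: w) (auto simp: funpow_swap1 dest: in_U_of_image)

lemma image_in_U_of_iter: "(f ^^ n) w \<in> U \<Longrightarrow> n \<ge> 1 \<Longrightarrow> f w \<in> U"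
  using in_U_of_iter[of "n - 1" "f w"] by (cases n) (auto simp: funpow_swap1)

lemma iter_fixed: "(f ^^ n) z0 = z0"
  by (induction n) (auto simp: z0)

definition branch :: "nat \<Rightarrow> complex set \<Rightarrow> (complex \<Rightarrow> complex) \<Rightarrow> bool" where
  "branch m X \<psi> \<longleftrightarrow> \<psi> holomorphic_on X \<and> (\<forall>z\<in>X. (f ^^ m) (\<psi> z) = z)"

lemma branch_subset: "branch m X \<psi> \<Longrightarrow> Y \<subseteq> X \<Longrightarrow> branch m Y \<psi>"
  by (auto simp: branch_def intro: holomorphic_on_subset)

lemma branch_in_U: "branch m X \<psi> \<Longrightarrow> X \<subseteq> U \<Longrightarrow> z \<in> X \<Longrightarrow> \<psi> z \<in> U"
  by (rule in_U_of_iter[of m]) (auto simp: branch_def)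

lemma iter_lifts_agree:
  fixes g k :: "'a::topological_space \<Rightarrow> complex"
  assumes X: "connected X" and g: "continuous_on X g" and k: "continuous_on X k"
    and eq: "\<And>x. x \<in> X \<Longrightarrow> (f ^^ m) (g x) = (f ^^ m) (k x)"
    and inU: "\<And>x. x \<in> X \<Longrightarrow> (f ^^ m) (g x) \<in> U"
    and a: "a \<in> X" "g a = k a" and x: "x \<in> X"
  shows "g x = k x"
  using g k eq inU a(2) x
proof (induction m arbitrary: g k x)
  case (Suc m)
  have fgk: "f (g x) = f (k x)" if "x \<in> X" for x
  proof -
    have "(f \<circ> g) x = (f \<circ> k) x"
    proof (rule Suc.IH)
      show "continuous_on X (f \<circ> g)" "continuous_on X (f \<circ> k)"
        by (intro continuous_on_compose Suc.prems(1,2) contf)+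
    qed (use Suc.prems that in \<open>auto simp: funpow_swap1\<close>)
    then show ?thesis by simp
  qed
  show ?case
  proof (rule lifts_agree_on_connected[OF hol X Suc.prems(1,2) fgk _ a(1) Suc.prems(5,6)])
    show "deriv f (g x) \<noteq> 0" if "x \<in> X" for x
      using Suc.prems(4)[OF that] by (intro deriv_nonzero image_in_U_of_iter[of "Suc m"]) auto
  qed
qed simp

text \<open>One lift through the covering per iterate; branches take values in \<open>U\<close>, so
  the next lift can be made.\<close>

lemma branch_exists:
  assumes X: "ball c r \<subseteq> U" and p: "p \<in> ball c r" "(f ^^ m) w = p"
  obtains \<psi> where "branch m (ball c r) \<psi>" "\<psi> p = w"
  using p
proof (induction m arbitrary: w thesis)
  case 0
  then show ?case
    by (intro "0.prems"(1)[of "\<lambda>z. z"]) (auto simp: branch_def intro: holomorphic_intros)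
next
  case (Suc m)
  obtain \<psi> where \<psi>: "branch m (ball c r) \<psi>" "\<psi> p = f w"
    using Suc.IH[of "f w"] Suc.prems by (auto simp: funpow_swap1)
  have \<psi>U: "\<psi> \<in> ball c r \<rightarrow> U"
    using branch_in_U[OF \<psi>(1) X] by auto
  have "f w \<in> U"
    using \<psi>(2) \<psi>U p(1) by (metis Pi_mem)
  obtain g where g: "continuous_on (ball c r) g" "g \<in> ball c r \<rightarrow> f -` U" "g p = w" "\<And>y. y \<in> ball c r \<Longrightarrow> f (g y) = \<psi> y"
  proof (rule covering_space_lift_strong[OF cov _ p(1) _ _ _ \<psi>U \<psi>(2)])
    show "w \<in> f -` U" using \<open>f w \<in> U\<close> by simp
    show "simply_connected (ball c r)" by (simp add: convex_imp_simply_connected)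
    show "locally path_connected (ball c r)" by (simp add: convex_imp_locally_path_connected)
    show "continuous_on (ball c r) \<psi>"
      using \<psi>(1) holomorphic_on_imp_continuous_on by (auto simp: branch_def)
  qed blast
  have "g holomorphic_on ball c r"
  proof (rule covering_space_lift_is_holomorphic[OF cov _ _ _ \<psi>U g(2,1,4)])
    show "open (f -` U)"
      using U(1) contf[of UNIV] by (simp add: continuous_open_vimage continuous_on_eq_continuous_at)
    show "f holomorphic_on f -` U" using hol holomorphic_on_subset by blast
    show "\<psi> holomorphic_on ball c r" using \<psi>(1) by (simp add: branch_def)
  qed
  then have "branch (Suc m) (ball c r) g"
    using \<psi>(1) g(4) by (auto simp: branch_def funpow_swap1)
  then show ?case using Suc.prems(1) g(3) by blast
qed

lemma branch_unique:
  assumes "connected X" "X \<subseteq> U" "branch m X \<psi>" "branch m X \<psi>'" "a \<in> X" "\<psi> a = \<psi>' a" "x \<in> X"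
  shows "\<psi> x = \<psi>' x"
  using assms holomorphic_on_imp_continuous_on
  by (intro iter_lifts_agree[of X \<psi> \<psi>' m a x]) (auto simp: branch_def)

text \<open>These are the two omitted values for Montel: \<open>z0\<close> is fixed and lies outside
  \<open>U\<close>, and \<open>q0\<close> leaves \<open>U\<close> after one iterate, for good. The
  second one is where the strict inclusion of the preimage of \<open>U\<close> in \<open>U\<close>
  enters.\<close>

lemma branch_omits:
  assumes "branch m X \<psi>" "m \<ge> 1" "X \<subseteq> U" "w \<in> X"
  shows "\<psi> w \<noteq> z0 \<and> \<psi> w \<noteq> q0"
proof -
  have "(f ^^ m) (\<psi> w) \<in> U" using assms by (auto simp: branch_def)
  then show ?thesis
    using image_in_U_of_iter[OF _ assms(2)] iter_fixed z0 q0 by metis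
qed

lemma z0_neq_q0: "z0 \<noteq> q0"
  using z0 q0 by auto

lemma branches_Montel:
  assumes r: "r > 0" "ball c r \<subseteq> U" and br: "\<And>n. branch (m n) (ball c r) (\<psi> n)" "\<And>n. m n \<ge> 1"
    and bd: "\<And>n::nat. \<exists>w\<in>cball c (r/4). norm (\<psi> n w) \<le> M"
  obtains g \<sigma> where "g holomorphic_on ball c r" "strict_mono (\<sigma> :: nat \<Rightarrow> nat)"
    "\<And>x. x \<in> ball c r \<Longrightarrow> (\<lambda>n. \<psi> (\<sigma> n) x) \<longlonglongrightarrow> g x"
    "\<And>K. compact K \<Longrightarrow> K \<subseteq> ball c r \<Longrightarrow> uniform_limit K (\<psi> \<circ> \<sigma>) g sequentially"
proof (rule Montel_two_values[OF z0_neq_q0 r(1), of \<psi> c M])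
  show "\<psi> n holomorphic_on ball c r" for n
    using br(1) by (simp add: branch_def)
  show "\<psi> n w \<noteq> z0 \<and> \<psi> n w \<noteq> q0" if "w \<in> ball c r" for n w
    using branch_omits[OF br r(2) that] .
qed (use bd that in blast)+

text \<open>The inverse branches near the identity spread along paths to all of \<^term>\<open>U\<close>; over
  \<^term>\<open>q0\<close> they would attain the value \<^term>\<open>q0\<close>, which is not in the range of any branch.\<close>

lemma branches_not_near_identity:
  assumes k: "\<And>l::nat. k l \<ge> 1" and r: "r > 0" "ball c r \<subseteq> U"
    and br: "\<And>l. branch (k l) (ball c r) (\<theta> l)"
    and lim: "\<And>z. z \<in> ball c r \<Longrightarrow> (\<lambda>l. \<theta> l z) \<longlonglongrightarrow> z"
  shows False
proof -
  define good where "good = (\<lambda>p \<rho>. \<rho> > 0 \<and> ball p \<rho> \<subseteq> U \<and> (\<exists>\<theta>. (\<forall>l. branch (k l) (ball p \<rho>) (\<theta> l)) \<and>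
      (\<forall>z\<in>ball p \<rho>. (\<lambda>l. \<theta> l z) \<longlonglongrightarrow> z)))"
  define \<G> where "\<G> = {p \<in> U. \<exists>\<rho>. good p \<rho>}"
  \<comment> \<open>The branches at \<open>p'\<close> extend to all of \<open>ball p s\<close>. They
    form a normal family because they are bounded at \<open>p'\<close>, a point of the quarter disc
    required by \<open>branches_Montel\<close>. Every limit is the identity near \<open>p'\<close>,
    hence on the whole ball.\<close>
  have ext: "good p s" if s: "s > 0" "ball p s \<subseteq> U" and p': "good p' \<rho>" "p' \<in> cball p (s/4)" for p p' s \<rho>
  proof -
    obtain \<theta> where \<theta>: "\<And>l. branch (k l) (ball p' \<rho>) (\<theta> l)" "\<And>z. z \<in> ball p' \<rho> \<Longrightarrow> (\<lambda>l. \<theta> l z) \<longlonglongrightarrow> z"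
      and \<rho>: "\<rho> > 0" using p'(1) unfolding good_def by blast
    have p's: "p' \<in> ball p s" using p'(2) s(1) by auto
    have "\<exists>\<psi>. branch (k l) (ball p s) \<psi> \<and> \<psi> p' = \<theta> l p'" for l
    proof -
      have "(f ^^ k l) (\<theta> l p') = p'" using \<theta>(1)[of l] \<rho> by (simp add: branch_def)
      then show ?thesis using branch_exists[OF s(2) p's] by metis
    qed
    then obtain \<psi> where \<psi>: "\<And>l. branch (k l) (ball p s) (\<psi> l)" "\<And>l. \<psi> l p' = \<theta> l p'" by metis
    define W where "W = ball p' \<rho> \<inter> ball p s"
    have W: "open W" "connected W" "p' \<in> W" "W \<subseteq> U"
      using \<rho> p's s(2) by (auto simp: W_def intro: convex_connected convex_Int)
    have agree: "\<psi> l z = \<theta> l z" if "z \<in> W" for l z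
      by (rule branch_unique[OF W(2,4) branch_subset[OF \<psi>(1)] branch_subset[OF \<theta>(1)] W(3) \<psi>(2) that])
         (auto simp: W_def)
    obtain M where M: "\<And>l. norm (\<psi> l p') \<le> M"
    proof -
      have "convergent (\<lambda>l. \<theta> l p')" using \<theta>(2)[of p'] \<rho> by (auto simp: convergent_def)
      then show thesis
        using that convergent_imp_Bseq \<psi>(2) by (metis BseqE)
    qed
    have "(\<lambda>l. \<psi> l z) \<longlonglongrightarrow> z" if z: "z \<in> ball p s" for z
    proof (rule ccontr)
      assume "\<not> (\<lambda>l. \<psi> l z) \<longlonglongrightarrow> z"
      then obtain e \<sigma> where e: "e > 0" "strict_mono (\<sigma> :: nat \<Rightarrow> nat)" "\<And>n. dist (\<psi> (\<sigma> n) z) z \<ge> e"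
        using not_LIMSEQ_subseq by blast
      obtain g \<tau> where g: "g holomorphic_on ball p s" "strict_mono (\<tau> :: nat \<Rightarrow> nat)"
         "\<And>x. x \<in> ball p s \<Longrightarrow> (\<lambda>n. \<psi> (\<sigma> (\<tau> n)) x) \<longlonglongrightarrow> g x"
      proof (rule branches_Montel[OF s, of "\<lambda>n. k (\<sigma> n)" "\<lambda>n. \<psi> (\<sigma> n)" M])
        show "branch (k (\<sigma> n)) (ball p s) (\<psi> (\<sigma> n))" "1 \<le> k (\<sigma> n)" for n
          by (rule \<psi> k)+
        show "\<exists>w\<in>cball p (s/4). norm (\<psi> (\<sigma> n) w) \<le> M" for n
          using M p'(2) by blast
      qed blast
      have gW: "g x = x" if "x \<in> W" for x
      proof (rule LIMSEQ_unique)
        show "(\<lambda>n. \<psi> (\<sigma> (\<tau> n)) x) \<longlonglongrightarrow> g x" using that by (intro g) (auto simp: W_def)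
        have "(\<lambda>l. \<psi> l x) \<longlonglongrightarrow> x" using \<theta>(2)[of x] that agree[OF that] by (simp add: W_def)
        from LIMSEQ_subseq_LIMSEQ[OF LIMSEQ_subseq_LIMSEQ[OF this e(2)] g(2)]
        show "(\<lambda>n. \<psi> (\<sigma> (\<tau> n)) x) \<longlonglongrightarrow> x" by (simp add: o_def)
      qed
      have "g z = z"
      proof (rule analytic_continuation_open[of W "ball p s" g "\<lambda>z. z"])
        show "g holomorphic_on ball p s" by (rule g)
        show "W \<noteq> {}" using W(3) by blast
        show "W \<subseteq> ball p s" by (simp add: W_def)
      qed (use W(1) gW z in \<open>auto intro: holomorphic_intros\<close>)
      then have "(\<lambda>n. dist (\<psi> (\<sigma> (\<tau> n)) z) z) \<longlonglongrightarrow> 0"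
        using tendsto_dist[OF g(3)[OF z] tendsto_const, of z] by simp
      moreover have "e \<le> 0" if "(\<lambda>n. dist (\<psi> (\<sigma> (\<tau> n)) z) z) \<longlonglongrightarrow> 0"
        by (rule LIMSEQ_le_const[OF that]) (use e(3) in auto)
      ultimately show False using e(1) by simp
    qed
    then show ?thesis unfolding good_def using s \<psi>(1) by (intro conjI exI[of _ \<psi>]) auto
  qed
  have "\<G> = U"
  proof -
    have "openin (top_of_set U) \<G>"
    proof -
      have "open \<G>"
      proof (subst open_subopen, intro ballI)
        fix p assume p: "p \<in> \<G>"
        then obtain \<rho> where \<rho>: "good p \<rho>" by (auto simp: \<G>_def)
        then have sub: "ball p \<rho> \<subseteq> U" "\<rho> > 0" by (auto simp: good_def)
        \<comment> \<open>\<open>ext\<close> is applied with radius \<open>\<rho> / 2\<close>, whose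
          quarter is this \<open>\<rho> / 8\<close>.\<close>
        have "p' \<in> \<G>" if "p' \<in> ball p (\<rho>/8)" for p'
        proof -
          have "ball p' (\<rho>/2) \<subseteq> ball p \<rho>"
            using that by (auto simp: ball_subset_ball_iff dist_commute)
          then have "good p' (\<rho>/2)"
            using that sub by (intro ext[OF _ _ \<rho>]) (auto simp: dist_commute)
          moreover have "p' \<in> ball p \<rho>" using that sub by auto
          ultimately show ?thesis using sub by (auto simp: \<G>_def)
        qed
        then show "\<exists>T. open T \<and> p \<in> T \<and> T \<subseteq> \<G>"
          using sub by (intro exI[of _ "ball p (\<rho>/8)"]) auto
      qed
      then show ?thesis by (auto simp: \<G>_def intro: open_subset)
    qed
    moreover have "closedin (top_of_set U) \<G>"
    proof (subst closedin_limpt, intro conjI allI impI)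
      fix p assume p: "p islimpt \<G> \<and> p \<in> U"
      then obtain s where s: "s > 0" "ball p s \<subseteq> U" using U(1) by (metis openE)
      obtain p' where "p' \<in> \<G>" "p' \<in> cball p (s/4)"
        using p s(1) unfolding islimpt_approachable
        by (metis dist_commute divide_pos_pos less_imp_le mem_cball zero_less_numeral)
      then show "p \<in> \<G>" using ext[OF s] p by (auto simp: \<G>_def)
    qed (auto simp: \<G>_def)
    moreover have "c \<in> \<G>"
    proof -
      have "good c r"
        unfolding good_def using r br lim by (intro conjI exI[of _ \<theta>]) auto
      then show ?thesis using r by (auto simp: \<G>_def)
    qed
    ultimately show ?thesis using U(2) connected_clopen by blast
  qed
  obtain \<rho> \<theta> where \<rho>: "\<rho> > 0" "ball q0 \<rho> \<subseteq> U" and \<theta>: "\<And>l. branch (k l) (ball q0 \<rho>) (\<theta> l)"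
      "\<And>z. z \<in> ball q0 \<rho> \<Longrightarrow> (\<lambda>l. \<theta> l z) \<longlonglongrightarrow> z"
  proof -
    have "q0 \<in> \<G>" using \<open>\<G> = U\<close> q0(1) by simp
    then show thesis using that unfolding \<G>_def good_def by blast
  qed
  obtain M where M: "\<And>l. norm (\<theta> l q0) \<le> M"
    using convergent_imp_Bseq[of "\<lambda>l. \<theta> l q0"] \<theta>(2)[of q0] \<rho>
    by (metis BseqE centre_in_ball convergent_def)
  obtain g \<tau> where g: "g holomorphic_on ball q0 \<rho>" "strict_mono (\<tau> :: nat \<Rightarrow> nat)"
     "\<And>x. x \<in> ball q0 \<rho> \<Longrightarrow> (\<lambda>n. \<theta> (\<tau> n) x) \<longlonglongrightarrow> g x"
     "\<And>K. compact K \<Longrightarrow> K \<subseteq> ball q0 \<rho> \<Longrightarrow> uniform_limit K (\<theta> \<circ> \<tau>) g sequentially"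
    by (rule branches_Montel[OF \<rho>, of k \<theta> M]) (use \<theta> k M \<rho> in \<open>auto intro!: bexI[of _ q0]\<close>)
  have gid: "g x = x" if "x \<in> ball q0 \<rho>" for x
    using LIMSEQ_unique[OF g(3)[OF that]] LIMSEQ_subseq_LIMSEQ[OF \<theta>(2)[OF that] g(2)] by (simp add: o_def)
  have "g q0 - q0 \<noteq> 0"
  proof (rule Hurwitz_no_zeros[of "ball q0 \<rho>" "\<lambda>n z. \<theta> (\<tau> n) z - q0" "\<lambda>z. g z - q0" q0])
    show "(\<lambda>z. \<theta> (\<tau> n) z - q0) holomorphic_on ball q0 \<rho>" for n
      using \<theta>(1) by (auto simp: branch_def intro: holomorphic_intros)
    show "(\<lambda>z. g z - q0) holomorphic_on ball q0 \<rho>"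
      by (intro holomorphic_intros g)
    show "uniform_limit K (\<lambda>n z. \<theta> (\<tau> n) z - q0) (\<lambda>z. g z - q0) sequentially"
      if "compact K" "K \<subseteq> ball q0 \<rho>" for K
      using g(4)[OF that] by (auto intro!: uniform_limit_intros simp: o_def)
    show "\<not> (\<lambda>z. g z - q0) constant_on ball q0 \<rho>"
    proof
      assume "(\<lambda>z. g z - q0) constant_on ball q0 \<rho>"
      then obtain y where "\<And>x. x \<in> ball q0 \<rho> \<Longrightarrow> x - q0 = y"
        using gid by (auto simp: constant_on_def)
      from this[of q0] this[of "q0 + of_real (\<rho>/2)"] show False
        using \<rho> by (auto simp: dist_norm)
    qed
    show "\<theta> (\<tau> n) z - q0 \<noteq> 0" if "z \<in> ball q0 \<rho>" for n z
      using branch_omits[OF \<theta>(1) k \<rho>(2) that] by simp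
  qed (use \<rho> in auto)
  then show False using gid[of q0] \<rho> by simp
qed

text \<open>If \<open>g\<close> is nonconstant, then by Hurwitz \<open>\<psi> l\<close> attains the
  value \<open>\<psi> l' x\<close> at a point close to \<open>x\<close> once \<open>l\<close> and
  \<open>l'\<close> are large, and that point is \<open>(f ^^ m l) (\<psi> l' x)\<close>. So these
  compositions tend to the identity, which \<open>branches_not_near_identity\<close>
  forbids.\<close>

lemma branches_limit_constant:
  assumes r: "r > 0" "ball c r \<subseteq> U" and m: "strict_mono m"
    and br: "\<And>n. branch (m n) (ball c r) (\<psi> n)"
    and g: "g holomorphic_on ball c r"
    and ul: "\<And>K. compact K \<Longrightarrow> K \<subseteq> ball c r \<Longrightarrow> uniform_limit K \<psi> g sequentially"
  shows "g constant_on ball c r"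
proof (rule ccontr)
  assume nc: "\<not> g constant_on ball c r"
  have near: "\<exists>N. \<forall>l\<ge>N. \<forall>l'\<ge>N. (f ^^ m l) (\<psi> l' x) \<in> ball x s"
    if x: "x \<in> ball c r" and s: "s > 0" for x s
  proof (rule ccontr)
    assume "\<not> ?thesis"
    then have "\<forall>N. \<exists>l l'. l \<ge> N \<and> l' \<ge> N \<and> (f ^^ m l) (\<psi> l' x) \<notin> ball x s" by blast
    then obtain l l' where ll: "\<And>N. l N \<ge> N" "\<And>N. l' N \<ge> N" "\<And>N. (f ^^ m (l N)) (\<psi> (l' N) x) \<notin> ball x s"
      by metis
    have ltop: "filterlim l sequentially sequentially" "filterlim l' sequentially sequentially"
      using ll(1,2) by (auto intro!: filterlim_at_top_mono[OF filterlim_ident] always_eventually)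
    define B where "B = ball x s \<inter> ball c r"
    have B: "open B" "connected B" "x \<in> B" "B \<subseteq> ball c r"
      using x s by (auto simp: B_def intro: convex_connected convex_Int)
    have "g x - g x \<noteq> 0"
    proof (rule Hurwitz_no_zeros[OF B(1,2), of "\<lambda>n z. \<psi> (l n) z - \<psi> (l' n) x" "\<lambda>z. g z - g x" x])
      show "(\<lambda>z. \<psi> (l n) z - \<psi> (l' n) x) holomorphic_on B" for n
        using br[of "l n"] B(4) by (auto simp: branch_def intro!: holomorphic_intros intro: holomorphic_on_subset)
      show "(\<lambda>z. g z - g x) holomorphic_on B"
        using g B(4) by (auto intro!: holomorphic_intros intro: holomorphic_on_subset)
      show "uniform_limit K (\<lambda>n z. \<psi> (l n) z - \<psi> (l' n) x) (\<lambda>z. g z - g x) sequentially"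
        if "compact K" "K \<subseteq> B" for K
      proof (rule uniform_limit_minus)
        have "uniform_limit K \<psi> g sequentially" using that B(4) by (intro ul) auto
        then show "uniform_limit K (\<lambda>n. \<psi> (l n)) g sequentially"
          using filterlim_compose[OF _ ltop(1)] by blast
        have "uniform_limit {x} \<psi> g sequentially" using x by (intro ul) auto
        then have "(\<lambda>n. \<psi> n x) \<longlonglongrightarrow> g x" by simp
        then have "(\<lambda>n. \<psi> (l' n) x) \<longlonglongrightarrow> g x"
          using filterlim_compose[OF _ ltop(2)] by blast
        then show "uniform_limit K (\<lambda>n z. \<psi> (l' n) x) (\<lambda>z. g x) sequentially"
          by (auto simp: uniform_limit_iff dest: tendstoD)
      qed
      show "\<not> (\<lambda>z. g z - g x) constant_on B"
      proof
        assume "(\<lambda>z. g z - g x) constant_on B"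
        then have eq: "g z = g x" if "z \<in> B" for z
          using that B(3) unfolding constant_on_def by (metis diff_add_cancel)
        have "g z = g x" if "z \<in> ball c r" for z
        proof (rule analytic_continuation_open[of B "ball c r" g "\<lambda>_. g x"])
          show "g v = g x" if "v \<in> B" for v by (rule eq[OF that])
        qed (use B g that in \<open>auto intro: holomorphic_intros\<close>)
        with nc show False by (auto simp: constant_on_def)
      qed
      show "\<psi> (l n) z - \<psi> (l' n) x \<noteq> 0" if "z \<in> B" for n z
      proof
        assume "\<psi> (l n) z - \<psi> (l' n) x = 0"
        then have "\<psi> (l' n) x = \<psi> (l n) z" by simp
        moreover have "(f ^^ m (l n)) (\<psi> (l n) z) = z"
          using br[of "l n"] that B(4) by (auto simp: branch_def)
        ultimately have "(f ^^ m (l n)) (\<psi> (l' n) x) = z" by simp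
        then show False using ll(3)[of n] that by (auto simp: B_def)
      qed
    qed (use B in auto)
    then show False by simp
  qed
  \<comment> \<open>Composing consecutive terms cancels \<open>m l\<close> of the
    \<open>m (Suc l)\<close> backward steps and leaves a branch of a positive iterate.\<close>
  define \<theta> where "\<theta> = (\<lambda>l. (f ^^ m l) \<circ> \<psi> (Suc l))"
  define k where "k = (\<lambda>l. m (Suc l) - m l)"
  have mS: "m l < m (Suc l)" for l using m by (simp add: strict_mono_Suc_iff)
  show False
  proof (rule branches_not_near_identity[OF _ r, of k \<theta>])
    show "k l \<ge> 1" for l using mS[of l] by (simp add: k_def)
    show "branch (k l) (ball c r) (\<theta> l)" for l
      unfolding branch_def
    proof (intro conjI ballI)
      show "\<theta> l holomorphic_on ball c r"
        unfolding \<theta>_def using br[of "Suc l"]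
        by (intro holomorphic_on_compose hol_iter) (auto simp: branch_def)
      fix z assume z: "z \<in> ball c r"
      have "m (Suc l) = k l + m l" using mS[of l] by (simp add: k_def)
      then have "(f ^^ k l) ((f ^^ m l) (\<psi> (Suc l) z)) = (f ^^ m (Suc l)) (\<psi> (Suc l) z)"
        by (simp add: funpow_add)
      then show "(f ^^ k l) (\<theta> l z) = z"
        using br[of "Suc l"] z by (simp add: \<theta>_def branch_def)
    qed
    fix x assume x: "x \<in> ball c r"
    show "(\<lambda>l. \<theta> l x) \<longlonglongrightarrow> x"
    proof (rule LIMSEQ_I)
      fix e :: real assume "e > 0"
      from near[OF x this] obtain N where N: "\<forall>l\<ge>N. \<forall>l'\<ge>N. (f ^^ m l) (\<psi> l' x) \<in> ball x e" by blast
      have "norm (\<theta> l x - x) < e" if "l \<ge> N" for l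
      proof -
        have "(f ^^ m l) (\<psi> (Suc l) x) \<in> ball x e" using N that le_SucI by blast
        then show ?thesis by (simp add: \<theta>_def dist_norm norm_minus_commute)
      qed
      then show "\<exists>N. \<forall>l\<ge>N. norm (\<theta> l x - x) < e" by blast
    qed
  qed
qed

text \<open>A failure would give branches of increasing order that form a normal family, with a
  limit that is constant and not constant. The estimate is uniform over all branches that are
  normalised by a norm bound at one point of the quarter disc.\<close>

lemma branches_shrink:
  assumes r: "r > 0" "ball c r \<subseteq> U" and e: "e > 0"
  obtains m0 where "\<And>m \<psi> w z z'. m \<ge> m0 \<Longrightarrow> branch m (ball c r) \<psi> \<Longrightarrow> w \<in> cball c (r/4) \<Longrightarrow> norm (\<psi> w) \<le> M \<Longrightarrow>
     z \<in> cball c (r/4) \<Longrightarrow> z' \<in> cball c (r/4) \<Longrightarrow> dist (\<psi> z) (\<psi> z') < e"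
proof (rule ccontr)
  assume contra: "\<not> thesis"
  \<comment> \<open>The conjunct \<open>m \<ge> 1\<close> keeps out the identity branch, which may
    take the value \<open>q0\<close>.\<close>
  define P where "P = (\<lambda>m. m \<ge> 1 \<and> (\<exists>\<psi> w z z'. branch m (ball c r) \<psi> \<and> w \<in> cball c (r/4) \<and> norm (\<psi> w) \<le> M \<and>
     z \<in> cball c (r/4) \<and> z' \<in> cball c (r/4) \<and> dist (\<psi> z) (\<psi> z') \<ge> e))"
  have "\<exists>m\<ge>n. P m" for n
  proof (rule ccontr)
    assume "\<not> ?thesis"
    then have "\<And>m. m \<ge> max n 1 \<Longrightarrow> \<not> P m" by auto
    then show False
      using that[of "max n 1"] contra unfolding P_def by (meson max.boundedE not_le)
  qed
  then obtain m :: "nat \<Rightarrow> nat" where m: "strict_mono m" "\<And>n. P (m n)"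
    using unbounded_nat_strict_mono[of P] by blast
  have "\<forall>n. \<exists>\<psi> w z z'. branch (m n) (ball c r) \<psi> \<and> w \<in> cball c (r/4) \<and> norm (\<psi> w) \<le> M \<and>
     z \<in> cball c (r/4) \<and> z' \<in> cball c (r/4) \<and> dist (\<psi> z) (\<psi> z') \<ge> e"
    using m(2) by (simp add: P_def)
  then have "\<exists>\<psi> w z z'. \<forall>n. branch (m n) (ball c r) (\<psi> n) \<and> w n \<in> cball c (r/4) \<and> norm (\<psi> n (w n)) \<le> M \<and>
     z n \<in> cball c (r/4) \<and> z' n \<in> cball c (r/4) \<and> dist (\<psi> n (z n)) (\<psi> n (z' n)) \<ge> e"
    unfolding choice_iff .
  then obtain \<psi> w z z' where \<psi>: "\<And>n. branch (m n) (ball c r) (\<psi> n)" "\<And>n. w n \<in> cball c (r/4)" "\<And>n. norm (\<psi> n (w n)) \<le> M"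
     and z: "\<And>n. z n \<in> cball c (r/4)" "\<And>n. z' n \<in> cball c (r/4)" "\<And>n. dist (\<psi> n (z n)) (\<psi> n (z' n)) \<ge> e"
    by blast
  obtain g \<sigma> where g: "g holomorphic_on ball c r" "strict_mono (\<sigma> :: nat \<Rightarrow> nat)"
    "\<And>K. compact K \<Longrightarrow> K \<subseteq> ball c r \<Longrightarrow> uniform_limit K (\<psi> \<circ> \<sigma>) g sequentially"
  proof (rule branches_Montel[OF r, of m \<psi> M])
    show "branch (m n) (ball c r) (\<psi> n)" for n by (rule \<psi>)
    show "1 \<le> m n" for n using m(2) by (simp add: P_def)
    show "\<exists>w\<in>cball c (r/4). norm (\<psi> n w) \<le> M" for n using \<psi> by blast
  qed blast
  have "g constant_on ball c r"
    by (rule branches_limit_constant[OF r, of "m \<circ> \<sigma>" "\<psi> \<circ> \<sigma>"])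
       (use g m \<psi> in \<open>auto simp: strict_mono_o\<close>)
  then obtain y where y: "\<And>x. x \<in> ball c r \<Longrightarrow> g x = y" by (auto simp: constant_on_def)
  have sub: "cball c (r/4) \<subseteq> ball c r" using r(1) by (auto simp: cball_subset_ball_iff)
  have "uniform_limit (cball c (r/4)) (\<psi> \<circ> \<sigma>) g sequentially"
    using sub by (intro g) auto
  then have "\<forall>\<^sub>F n in sequentially. \<forall>x\<in>cball c (r/4). dist ((\<psi> \<circ> \<sigma>) n x) (g x) < e/2"
    using half_gt_zero[OF e] unfolding uniform_limit_iff by blast
  then obtain n where n0: "\<forall>x\<in>cball c (r/4). dist ((\<psi> \<circ> \<sigma>) n x) (g x) < e/2"
    using eventually_happens'[OF sequentially_bot] by blast
  have n: "dist (\<psi> (\<sigma> n) x) y < e/2" if "x \<in> cball c (r/4)" for x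
    using bspec[OF n0 that] y[of x] sub that by (simp add: subset_iff)
  have "dist (\<psi> (\<sigma> n) (z (\<sigma> n))) (\<psi> (\<sigma> n) (z' (\<sigma> n))) < e"
    using n[OF z(1)] n[OF z(2)] by (rule dist_triangle_half_l[of _ y e])
  with z(3) show False by (metis not_le)
qed

end

section \<open>Local dynamics at the fixed point\<close>

text \<open>Modelled on \<open>log \<bar>z\<bar>\<close> at a repelling point and on the real part of the Fatou coordinate
  at a parabolic one, where it covers attracting and repelling petals at once.\<close>

definition escape_time_function :: "(complex \<Rightarrow> complex) \<Rightarrow> complex \<Rightarrow> real \<Rightarrow> (complex \<Rightarrow> real) \<Rightarrow> bool" where
  "escape_time_function F z0 \<rho> u \<longleftrightarrow> \<rho> > 0 \<and>
     (\<forall>z\<in>ball z0 \<rho> - {z0}. u z + 1 \<le> u (F z)) \<and>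
     (\<forall>r>0. \<exists>C. \<forall>z\<in>ball z0 \<rho> - {z0}. \<bar>u z\<bar> > C \<longrightarrow> z \<in> ball z0 r) \<and>
     (\<forall>C. \<exists>z\<in>ball z0 \<rho> - {z0}. u z < C)"

lemma escape_time_function_shrink:
  assumes "escape_time_function F z0 \<rho> u" "0 < s" "s \<le> \<rho>"
  shows "escape_time_function F z0 s u"
  unfolding escape_time_function_def
proof (intro conjI allI impI)
  have sub: "ball z0 s - {z0} \<subseteq> ball z0 \<rho> - {z0}" using assms(3) by auto
  show "\<forall>z\<in>ball z0 s - {z0}. u z + 1 \<le> u (F z)"
    using assms(1) sub unfolding escape_time_function_def by blast
  show "\<exists>C. \<forall>z\<in>ball z0 s - {z0}. \<bar>u z\<bar> > C \<longrightarrow> z \<in> ball z0 r" if "r > 0" for r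
    using assms(1) sub that unfolding escape_time_function_def by blast
  fix C
  obtain C' where C': "\<And>z. z \<in> ball z0 \<rho> - {z0} \<Longrightarrow> \<bar>u z\<bar> > C' \<Longrightarrow> z \<in> ball z0 s"
    using assms(1,2) unfolding escape_time_function_def by blast
  obtain z where z: "z \<in> ball z0 \<rho> - {z0}" "u z < min C (- \<bar>C'\<bar> - 1)"
    using assms(1) unfolding escape_time_function_def by blast
  then have "z \<in> ball z0 s" by (intro C') auto
  then show "\<exists>z\<in>ball z0 s - {z0}. u z < C" using z by (intro bexI[of _ z]) auto
qed (fact assms(2))

text \<open>With \<open>\<kappa>\<close> strictly between 1 and the modulus of the multiplier, each
  step multiplies the distance to \<open>z0\<close> by more than \<open>\<kappa>\<close>; dividing
  by \<open>ln \<kappa>\<close> turns this into an increment of at least 1. Keeping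
  \<open>\<rho> \<le> 1\<close> makes \<open>u\<close> nonpositive, so that large
  \<open>\<bar>u\<bar>\<close> means a small distance.\<close>

lemma escape_time_function_repelling:
  assumes hol: "F holomorphic_on UNIV" and fp: "F z0 = z0" and rep: "norm (deriv F z0) > 1"
  obtains \<rho> u where "escape_time_function F z0 \<rho> u"
proof -
  define \<kappa> where "\<kappa> = (1 + norm (deriv F z0)) / 2"
  have \<kappa>: "1 < \<kappa>" "\<kappa> < norm (deriv F z0)" using rep by (auto simp: \<kappa>_def)
  have "(F has_field_derivative deriv F z0) (at z0)"
    using hol holomorphic_derivI by blast
  then have "((\<lambda>z. norm ((F z - F z0) / (z - z0))) \<longlongrightarrow> norm (deriv F z0)) (at z0)"
    unfolding has_field_derivative_iff by (intro tendsto_norm)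
  from order_tendstoD(1)[OF this \<kappa>(2)] obtain d where d: "d > 0"
     "\<And>z. z \<noteq> z0 \<Longrightarrow> dist z z0 < d \<Longrightarrow> norm ((F z - F z0) / (z - z0)) > \<kappa>"
    unfolding eventually_at by blast
  define \<rho> where "\<rho> = min d 1"
  define u where "u = (\<lambda>z. ln (norm (z - z0)) / ln \<kappa>)"
  have lk: "ln \<kappa> > 0" using \<kappa> by simp
  have "escape_time_function F z0 \<rho> u"
    unfolding escape_time_function_def
  proof (intro conjI ballI allI impI)
    show "\<rho> > 0" using d by (simp add: \<rho>_def)
    fix z assume z: "z \<in> ball z0 \<rho> - {z0}"
    then have pos: "norm (z - z0) > 0" by simp
    have "norm (F z - z0) > \<kappa> * norm (z - z0)"
      using d(2)[of z] z fp pos by (simp add: \<rho>_def dist_commute norm_divide field_simps)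
    then have "ln (\<kappa> * norm (z - z0)) \<le> ln (norm (F z - z0))"
      using pos \<kappa>(1) by (intro ln_mono) (auto intro: less_trans mult_pos_pos)
    then have "ln \<kappa> + ln (norm (z - z0)) \<le> ln (norm (F z - z0))"
      using pos \<kappa>(1) by (simp add: ln_mult)
    then have "(ln \<kappa> + ln (norm (z - z0))) / ln \<kappa> \<le> u (F z)"
      unfolding u_def using lk by (intro divide_right_mono) auto
    then show "u z + 1 \<le> u (F z)"
      using lk by (simp add: u_def add_divide_distrib)
  next
    fix r :: real assume r: "r > 0"
    show "\<exists>C. \<forall>z\<in>ball z0 \<rho> - {z0}. \<bar>u z\<bar> > C \<longrightarrow> z \<in> ball z0 r"
    proof (intro exI ballI impI)
      fix z assume z: "z \<in> ball z0 \<rho> - {z0}" and C: "\<bar>u z\<bar> > - ln r / ln \<kappa>"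
      have n: "0 < norm (z - z0)" "norm (z - z0) \<le> 1"
        using z by (auto simp: \<rho>_def dist_norm norm_minus_commute)
      then have "ln (norm (z - z0)) \<le> 0" by simp
      then have "\<bar>u z\<bar> = - ln (norm (z - z0)) / ln \<kappa>"
        using lk by (simp add: u_def abs_if divide_less_0_iff)
      with C lk have "ln (norm (z - z0)) < ln r" by (simp add: divide_less_cancel)
      then show "z \<in> ball z0 r" using r n by (simp add: dist_norm norm_minus_commute)
    qed
  next
    fix C :: real
    define z where "z = z0 + of_real (min (\<rho> / 2) (exp (C * ln \<kappa> - 1)))"
    have "\<rho> > 0" using d by (simp add: \<rho>_def)
    then have n: "norm (z - z0) = min (\<rho> / 2) (exp (C * ln \<kappa> - 1))" "0 < norm (z - z0)"
      by (auto simp: z_def)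
    have "ln (norm (z - z0)) \<le> ln (exp (C * ln \<kappa> - 1))"
      using n by (intro ln_mono) auto
    then have "u z < C"
      using lk by (simp add: u_def field_simps)
    moreover have "z \<in> ball z0 \<rho> - {z0}"
    proof -
      have "z \<noteq> z0" using n(2) by auto
      moreover have "norm (z - z0) < \<rho>" using n(1) \<open>\<rho> > 0\<close> by simp
      ultimately show ?thesis by (simp add: dist_norm norm_minus_commute)
    qed
    ultimately show "\<exists>z\<in>ball z0 \<rho> - {z0}. u z < C" by blast
  qed
  then show thesis by (rule that)
qed

text \<open>With \<open>F z = z + (z - z0) ^ Suc p * g z\<close>, the change of
  \<open>c / (z - z0) ^ p\<close> under \<open>F\<close> tends to \<open>- c * p * g z0\<close> at
  \<open>z0\<close>. The choice of \<open>c\<close> makes the increment of \<open>u\<close> tend to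
  2, so 1 is a safe bound near \<open>z0\<close>. The hypothesis \<open>nid\<close> ensures that
  \<open>F z - z\<close> has a zero of finite order at \<open>z0\<close>.\<close>

lemma escape_time_function_multiplier_one:
  assumes hol: "F holomorphic_on UNIV" and fp: "F z0 = z0" and one: "deriv F z0 = 1"
    and nid: "F w \<noteq> w"
  obtains \<rho> u where "escape_time_function F z0 \<rho> u"
proof -
  define h where "h = (\<lambda>z. F z - z)"
  have hh: "h holomorphic_on UNIV" unfolding h_def by (intro holomorphic_intros hol)
  have h0: "h z0 = 0" by (simp add: h_def fp)
  have "\<not> h constant_on UNIV"
    using h0 nid unfolding constant_on_def h_def by (metis UNIV_I eq_iff_diff_eq_0)
  then obtain g r n where n: "0 < n" and r: "0 < r" and g: "g holomorphic_on ball z0 r"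
     "\<And>w. w \<in> ball z0 r \<Longrightarrow> h w = (w - z0) ^ n * g w" "\<And>w. w \<in> ball z0 r \<Longrightarrow> g w \<noteq> 0"
    using holomorphic_factor_zero_nonconstant[OF hh open_UNIV connected_UNIV UNIV_I h0] by metis
  have contg: "isCont g z0"
    using holomorphic_on_imp_continuous_on[OF g(1)] r by (simp add: continuous_on_eq_continuous_at)
  \<comment> \<open>A simple zero of \<open>F z - z\<close> would give the multiplier
    \<open>1 + g z0\<close>.\<close>
  have "n \<noteq> 1"
  proof
    assume "n = 1"
    have "(F has_field_derivative 1) (at z0)"
      using holomorphic_derivI[OF hol open_UNIV UNIV_I, of z0] one by simp
    then have "(h has_field_derivative 1 - 1) (at z0)"
      unfolding h_def by (intro derivative_intros)
    then have "((\<lambda>z. (h z - h z0) / (z - z0)) \<longlongrightarrow> 0) (at z0)"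
      by (simp add: has_field_derivative_iff)
    moreover have "((\<lambda>z. (h z - h z0) / (z - z0)) \<longlongrightarrow> g z0) (at z0)"
    proof (rule Lim_transform_within_open[OF _ open_ball[of z0 r]])
      show "(g \<longlongrightarrow> g z0) (at z0)" using contg by (simp add: isCont_def)
    qed (use r g(2) h0 \<open>n = 1\<close> in auto)
    ultimately have "g z0 = 0"
      by (metis tendsto_unique trivial_limit_at)
    with g(3)[of z0] r show False by simp
  qed
  define p where "p = n - 1"
  have p: "p \<ge> 1" "n = Suc p" using n \<open>n \<noteq> 1\<close> by (auto simp: p_def)
  define a where "a = g z0"
  have a: "a \<noteq> 0" using g(3)[of z0] r by (simp add: a_def)
  define c where "c = 2 / (of_nat p * a)"
  have c: "c \<noteq> 0" using a p by (simp add: c_def)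
  define u where "u = (\<lambda>z. - Re (c / (z - z0) ^ p))"
  define w where "w = (\<lambda>z. (z - z0) ^ p * g z)"
  \<comment> \<open>The difference quotient at 0 of the power of \<open>1 + v\<close> with exponent
    \<open>- p\<close>, so its limit is \<open>- p\<close>. It is evaluated at \<open>w z\<close>,
    which equals \<open>(F z - z0) / (z - z0) - 1\<close>.\<close>
  define k where "k = (\<lambda>v::complex. (inverse ((1 + v) ^ p) - 1) / v)"
  have Fw: "F z - z0 = (z - z0) * (1 + w z)" if "z \<in> ball z0 r" for z
    using g(2)[OF that] p(2) by (simp add: h_def w_def algebra_simps)
  have diff: "u (F z) - u z = - Re (c * g z * k (w z))"
    if "z \<in> ball z0 r" "z \<noteq> z0" for z
  proof -
    have w0: "w z \<noteq> 0" using that g(3) by (simp add: w_def)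
    have "u (F z) - u z = - Re (c / (F z - z0) ^ p - c / (z - z0) ^ p)"
      by (simp add: u_def)
    also have "c / (F z - z0) ^ p - c / (z - z0) ^ p = c * g z * k (w z)"
    proof -
      have "c / (F z - z0) ^ p = c / (z - z0) ^ p * inverse ((1 + w z) ^ p)"
        by (simp only: Fw[OF that(1)] power_mult_distrib divide_inverse inverse_mult_distrib mult.assoc)
      moreover have "k (w z) * w z = inverse ((1 + w z) ^ p) - 1"
        using w0 by (simp add: k_def)
      ultimately have "c / (F z - z0) ^ p - c / (z - z0) ^ p = c / (z - z0) ^ p * (k (w z) * w z)"
        by (simp add: right_diff_distrib)
      also have "\<dots> = c * g z * k (w z)"
        using that by (simp add: w_def)
      finally show ?thesis .
    qed
    finally show ?thesis .
  qed
  have "((\<lambda>z. - Re (c * g z * k (w z))) \<longlongrightarrow> 2) (at z0)"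
  proof -
    have "((\<lambda>v::complex. inverse ((1 + v) ^ p)) has_field_derivative - of_nat p) (at 0)"
      by (auto intro!: derivative_eq_intros)
    then have klim: "(k \<longlongrightarrow> - of_nat p) (at 0)"
      unfolding k_def has_field_derivative_iff by simp
    have wlim: "filterlim w (at 0) (at z0)"
    proof (rule filterlim_atI)
      have "((\<lambda>z. (z - z0) ^ p * g z) \<longlongrightarrow> (z0 - z0) ^ p * g z0) (at z0)"
        using contg by (intro tendsto_intros) (simp add: isCont_def)
      moreover have "(0::complex) ^ p = 0" using p(1) by simp
      ultimately show "(w \<longlongrightarrow> 0) (at z0)" unfolding w_def by simp
      show "\<forall>\<^sub>F z in at z0. w z \<noteq> 0"
        unfolding eventually_at using r g(3) by (intro exI[of _ r]) (auto simp: w_def dist_commute)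
    qed
    have "((\<lambda>z. - Re (c * g z * k (w z))) \<longlongrightarrow> - Re (c * g z0 * - of_nat p)) (at z0)"
      using contg by (intro tendsto_intros filterlim_compose[OF klim wlim]) (simp add: isCont_def)
    also have "- Re (c * g z0 * - of_nat p) = 2"
      using a p by (simp add: c_def a_def[symmetric])
    finally show ?thesis .
  qed
  from order_tendstoD(1)[OF this, of 1] obtain d where d: "d > 0"
    "\<And>z. z \<noteq> z0 \<Longrightarrow> dist z z0 < d \<Longrightarrow> - Re (c * g z * k (w z)) > 1"
    unfolding eventually_at by force
  define \<rho> where "\<rho> = min d r"
  have "escape_time_function F z0 \<rho> u"
    unfolding escape_time_function_def
  proof (intro conjI ballI allI impI)
    show \<rho>: "\<rho> > 0" using d r by (simp add: \<rho>_def)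
    show "u z + 1 \<le> u (F z)" if "z \<in> ball z0 \<rho> - {z0}" for z
      using that diff[of z] d(2)[of z] by (simp add: \<rho>_def dist_commute)
    fix s :: real assume s: "s > 0"
    show "\<exists>C. \<forall>z\<in>ball z0 \<rho> - {z0}. \<bar>u z\<bar> > C \<longrightarrow> z \<in> ball z0 s"
    proof (intro exI ballI impI)
      fix z assume z: "z \<in> ball z0 \<rho> - {z0}" and C: "\<bar>u z\<bar> > norm c / s ^ p"
      have pos: "0 < norm (z - z0)" using z by simp
      have "\<bar>u z\<bar> \<le> norm (c / (z - z0) ^ p)"
        using abs_Re_le_cmod[of "c / (z - z0) ^ p"] by (simp add: u_def)
      then have less: "norm c / s ^ p < norm c / norm (z - z0) ^ p"
        using C by (simp add: norm_divide norm_power)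
      have "norm (z - z0) ^ p < s ^ p"
      proof (rule ccontr)
        assume "\<not> norm (z - z0) ^ p < s ^ p"
        then have le: "s ^ p \<le> norm (z - z0) ^ p" by simp
        have ge: "norm c / norm (z - z0) ^ p \<le> norm c / s ^ p"
          by (intro divide_left_mono[OF le norm_ge_zero] mult_pos_pos zero_less_power s pos)
        from less ge show False by simp
      qed
      then have "norm (z - z0) < s"
        by (rule power_less_imp_less_base) (use s in simp)
      then show "z \<in> ball z0 s" by (simp add: dist_norm norm_minus_commute)
    qed
  next
    fix C :: real
    have \<rho>: "\<rho> > 0" using d r by (simp add: \<rho>_def)
    \<comment> \<open>A repelling direction: a \<open>p\<close>-th root \<open>\<zeta>\<close> of
      \<open>c * t\<close> gives \<open>u = - (1 / t)\<close> at \<open>z0 + \<zeta>\<close>. The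
      first entry of the minimum keeps the point in the ball, the second pushes the value below
      \<open>C\<close>.\<close>
    define t where "t = min ((\<rho> / 2) ^ p / norm c) (1 / (\<bar>C\<bar> + 1))"
    have t: "t > 0" using \<rho> c by (simp add: t_def)
    obtain \<zeta> where \<zeta>: "c * of_real t = \<zeta> ^ p"
      using exists_complex_root[of p "c * of_real t"] p by auto
    have "\<zeta> ^ p \<noteq> 0" using \<zeta>[symmetric] c t by simp
    then have "\<zeta> \<noteq> 0" using p by auto
    have "norm \<zeta> ^ p \<le> (\<rho> / 2) ^ p"
    proof -
      have "norm \<zeta> ^ p = norm c * t" using \<zeta> t by (metis abs_of_pos norm_mult norm_of_real norm_power)
      also have "\<dots> \<le> norm c * ((\<rho> / 2) ^ p / norm c)" by (intro mult_left_mono) (auto simp: t_def)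
      finally show ?thesis using c by simp
    qed
    then have "norm \<zeta> \<le> \<rho> / 2"
      using p \<rho> power_le_imp_le_base[of "norm \<zeta>" "p - 1" "\<rho> / 2"] by simp
    then have in_ball: "z0 + \<zeta> \<in> ball z0 \<rho> - {z0}"
      using \<rho> \<open>\<zeta> \<noteq> 0\<close> by (simp add: dist_norm)
    have "u (z0 + \<zeta>) = - (1 / t)"
      using c t by (simp add: u_def \<zeta>[symmetric])
    moreover have "\<bar>C\<bar> + 1 \<le> 1 / t"
    proof -
      have "t \<le> 1 / (\<bar>C\<bar> + 1)" by (simp add: t_def)
      then show ?thesis using t by (simp add: field_simps)
    qed
    ultimately have "u (z0 + \<zeta>) < C" by linarith
    with in_ball show "\<exists>z\<in>ball z0 \<rho> - {z0}. u z < C" by blast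
  qed
  then show thesis by (rule that)
qed

lemma iterates_stay_near_fixed_point:
  fixes h :: "'a::metric_space \<Rightarrow> 'a"
  assumes "isCont h p" "h p = p" "\<epsilon> > 0"
  obtains \<delta> where "\<delta> > 0" "\<And>i x. i \<le> k \<Longrightarrow> x \<in> ball p \<delta> \<Longrightarrow> (h ^^ i) x \<in> ball p \<epsilon>"
proof (induction k arbitrary: thesis)
  case 0
  show ?case by (rule 0[of \<epsilon>]) (use assms in auto)
next
  case (Suc k)
  obtain \<delta> where \<delta>: "\<delta> > 0" "\<And>i x. i \<le> k \<Longrightarrow> x \<in> ball p \<delta> \<Longrightarrow> (h ^^ i) x \<in> ball p \<epsilon>"
    using Suc.IH by blast
  obtain \<eta> where \<eta>: "\<eta> > 0" "\<And>x. dist x p < \<eta> \<Longrightarrow> dist (h x) p < \<delta>"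
    using assms(1,2) \<delta>(1) unfolding continuous_at_eps_delta by metis
  show ?case
  proof (rule Suc.prems[of "min (min \<delta> \<eta>) \<epsilon>"])
    fix i x assume i: "i \<le> Suc k" and x: "x \<in> ball p (min (min \<delta> \<eta>) \<epsilon>)"
    show "(h ^^ i) x \<in> ball p \<epsilon>"
    proof (cases i)
      case (Suc j)
      have "h x \<in> ball p \<delta>" using \<eta>(2)[of x] x by (simp add: dist_commute)
      then show ?thesis using \<delta>(2)[of j "h x"] i Suc by (simp add: funpow_swap1)
    qed (use x in simp)
  qed (use \<delta> \<eta> assms in auto)
qed

section \<open>Backward orbits near the fixed point\<close>

context expanding_domain
begin

definition orbit :: "(nat \<Rightarrow> complex) \<Rightarrow> bool" where
  "orbit z \<longleftrightarrow> (\<forall>n. f (z (Suc n)) = z n)"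

lemma orbit_iter: "orbit z \<Longrightarrow> (f ^^ n) (z (m + n)) = z m"
  by (induction n) (auto simp: orbit_def funpow_swap1)

lemma orbit_shift: "orbit z \<Longrightarrow> orbit (\<lambda>n. z (Suc n))"
  by (simp add: orbit_def)

lemma orbit_in_U: "orbit z \<Longrightarrow> z 0 \<in> U \<Longrightarrow> z n \<in> U"
  using orbit_iter[of z n 0] in_U_of_iter[of n "z n"] by simp

lemma orbit_neq_z0:
  assumes "orbit z" "z m \<noteq> z0" "m \<le> n" shows "z n \<noteq> z0"
  using orbit_iter[OF assms(1), of "n - m" m] assms(2,3) iter_fixed by auto

end

text \<open>\<open>Q\<close> will be 1 at a repelling point; at a parabolic point it makes the
  multiplier of \<open>f ^^ Q\<close> equal to 1. Injectivity of \<open>f\<close> near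
  \<open>z0\<close> determines the late entries of a backward orbit from earlier ones.\<close>

locale expanding_fixed_point = expanding_domain +
  fixes Q :: nat and \<rho> :: real and u :: "complex \<Rightarrow> real"
  assumes bdd: "bounded (- U)"
    and Q: "Q \<ge> 1"
    and tf: "escape_time_function (f ^^ Q) z0 \<rho> u"
    and inj: "inj_on f (ball z0 \<rho>)"
begin

lemma \<rho>_pos: "\<rho> > 0"
  using tf by (simp add: escape_time_function_def)

lemma u_step: "z \<in> ball z0 \<rho> - {z0} \<Longrightarrow> u z + 1 \<le> u ((f ^^ Q) z)"
  using tf by (simp add: escape_time_function_def)

lemma u_large_near:
  assumes "r > 0"
  obtains C where "\<And>z. z \<in> ball z0 \<rho> - {z0} \<Longrightarrow> \<bar>u z\<bar> > C \<Longrightarrow> z \<in> ball z0 r"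
  using tf assms unfolding escape_time_function_def by blast

lemma isCont_f: "isCont f z"
  using isCont_iter[of z 1] by simp

text \<open>Along blocks of \<open>Q\<close> steps \<open>u\<close> only grows. It stays large, and
  so the point stays so near \<open>z0\<close> that the iterates within the next block remain in the
  ball. Nothing is known about \<open>u\<close> at \<open>z0\<close> itself, hence the condition
  that the orbit avoids it.\<close>

lemma forward_trap:
  obtains C where "\<And>z i. z \<in> ball z0 \<rho> \<Longrightarrow> u z > C \<Longrightarrow> (\<And>j. j \<le> i \<Longrightarrow> (f ^^ j) z \<noteq> z0) \<Longrightarrow>
    (f ^^ i) z \<in> ball z0 \<rho>"
proof -
  obtain \<delta> where \<delta>: "\<delta> > 0" "\<And>i x. i \<le> Q \<Longrightarrow> x \<in> ball z0 \<delta> \<Longrightarrow> (f ^^ i) x \<in> ball z0 \<rho>"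
    using iterates_stay_near_fixed_point[OF isCont_f z0(1) \<rho>_pos] by metis
  obtain C where C: "\<And>z. z \<in> ball z0 \<rho> - {z0} \<Longrightarrow> \<bar>u z\<bar> > C \<Longrightarrow> z \<in> ball z0 \<delta>"
    using u_large_near[OF \<delta>(1)] by metis
  have "(f ^^ i) z \<in> ball z0 \<rho>"
    if "z \<in> ball z0 \<rho>" "u z > \<bar>C\<bar>" "\<And>j. j \<le> i \<Longrightarrow> (f ^^ j) z \<noteq> z0" for z i
    using that
  proof (induction i arbitrary: z rule: less_induct)
    case (less i)
    have "z \<noteq> z0" using less.prems(3)[of 0] by simp
    then have z: "z \<in> ball z0 \<rho> - {z0}" using less.prems(1) by simp
    have zd: "z \<in> ball z0 \<delta>" using C[OF z] less.prems(2) by simp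
    show ?case
    proof (cases "i \<le> Q")
      case True then show ?thesis using \<delta>(2) zd by blast
    next
      case False
      define z' where "z' = (f ^^ Q) z"
      have "(f ^^ (i - Q)) z' \<in> ball z0 \<rho>"
      proof (rule less.IH)
        show "i - Q < i" using False Q by simp
        show "z' \<in> ball z0 \<rho>" using \<delta>(2)[of Q z] zd by (simp add: z'_def)
        show "u z' > \<bar>C\<bar>" using u_step[OF z] less.prems(2) by (simp add: z'_def)
        show "(f ^^ j) z' \<noteq> z0" if "j \<le> i - Q" for j
          using less.prems(3)[of "j + Q"] that False by (simp add: z'_def funpow_add)
      qed
      also have "(f ^^ (i - Q)) z' = (f ^^ i) z"
        using False by (simp add: z'_def flip: funpow_add[THEN fun_cong, simplified])
      finally show ?thesis .
    qed
  qed
  then show thesis using that by blast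
qed

lemma u_along_orbit:
  assumes z: "orbit z" "\<And>m. m \<ge> n \<Longrightarrow> z m \<in> ball z0 \<rho> - {z0}" and m: "m \<ge> n"
  shows "u (z (m + Q * i)) + real i \<le> u (z m)"
proof (induction i)
  case (Suc i)
  have "(f ^^ Q) (z (m + Q * i + Q)) = z (m + Q * i)" using orbit_iter[OF z(1)] .
  moreover have "z (m + Q * i + Q) \<in> ball z0 \<rho> - {z0}" by (intro z(2)) (use m in simp)
  ultimately have "u (z (m + Q * i + Q)) + 1 \<le> u (z (m + Q * i))" using u_step by metis
  moreover have eq: "m + Q * Suc i = m + Q * i + Q" by simp
  ultimately show ?case using Suc unfolding eq by simp
qed simp

text \<open>Outside the smaller ball \<^term>\<open>u\<close> is bounded, while it grows with every application of
  \<open>f ^^ Q\<close>.\<close>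

lemma uniform_approach:
  assumes r: "r > 0"
  obtains J where "\<And>z n m. orbit z \<Longrightarrow> (\<And>m. m \<ge> n \<Longrightarrow> z m \<in> ball z0 \<rho>) \<Longrightarrow> z 0 \<notin> ball z0 \<rho> \<Longrightarrow>
     m \<ge> n + J \<Longrightarrow> z m \<in> ball z0 r"
proof -
  obtain C1 where C1: "\<And>z. z \<in> ball z0 \<rho> - {z0} \<Longrightarrow> \<bar>u z\<bar> > C1 \<Longrightarrow> z \<in> ball z0 r"
    using u_large_near[OF r] by metis
  obtain C2 where C2: "\<And>z i. z \<in> ball z0 \<rho> \<Longrightarrow> u z > C2 \<Longrightarrow> (\<And>j. j \<le> i \<Longrightarrow> (f ^^ j) z \<noteq> z0) \<Longrightarrow>
    (f ^^ i) z \<in> ball z0 \<rho>"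
    using forward_trap by metis
  \<comment> \<open>If \<open>z m\<close> is not yet in the smaller ball, then
    \<open>u (z m) \<ge> - C1\<close>, so \<open>u\<close> exceeds \<open>C2\<close> after
    \<open>j\<close> blocks forward, at an entry still in the ball. From there the forward orbit
    would be trapped in the ball, although it arrives at \<open>z 0\<close> outside.\<close>
  obtain j :: nat where j: "C1 + C2 < real j" using reals_Archimedean2 by blast
  show thesis
  proof (rule that[of "Q * j"], rule ccontr)
    fix z n m assume z: "orbit z" "\<And>m. m \<ge> n \<Longrightarrow> z m \<in> ball z0 \<rho>" "z 0 \<notin> ball z0 \<rho>"
      and m: "m \<ge> n + Q * j" and nin: "z m \<notin> ball z0 r"
    have "z 0 \<noteq> z0" using z(3) \<rho>_pos by auto
    then have zne: "z k \<noteq> z0" for k using orbit_neq_z0[OF z(1)] by blast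
    define k where "k = m - Q * j"
    have k: "m = k + Q * j" "k \<ge> n" using m by (auto simp: k_def)
    have "z m \<in> ball z0 \<rho> - {z0}" using z(2) m zne by simp
    then have "\<bar>u (z m)\<bar> \<le> C1" using C1 nin by (meson not_le)
    moreover have "u (z m) + real j \<le> u (z k)"
      unfolding k(1) by (rule u_along_orbit[of z n]) (use z zne k in auto)
    ultimately have "u (z k) > C2" using j by linarith
    moreover have "(f ^^ i) (z k) \<noteq> z0" if "i \<le> k" for i
      using orbit_iter[OF z(1), of i "k - i"] that zne by simp
    ultimately have "(f ^^ k) (z k) \<in> ball z0 \<rho>" using z(2) k by (intro C2) auto
    then show False using orbit_iter[OF z(1), of k 0] z(3) by simp
  qed
qed

text \<open>Backwards \<open>u\<close> drops by 1 with every block of \<open>Q\<close> steps, so it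
  tends to minus infinity along each residue class modulo \<open>Q\<close>; and large
  \<open>\<bar>u\<bar>\<close> forces closeness to \<open>z0\<close>.\<close>

lemma orbit_converges:
  assumes z: "orbit z" "\<And>m. m \<ge> n \<Longrightarrow> z m \<in> ball z0 \<rho> - {z0}"
  shows "z \<longlonglongrightarrow> z0"
proof (rule metric_LIMSEQ_I)
  fix e :: real assume "e > 0"
  then obtain C where C: "\<And>z. z \<in> ball z0 \<rho> - {z0} \<Longrightarrow> \<bar>u z\<bar> > C \<Longrightarrow> z \<in> ball z0 e"
    using u_large_near by metis
  define A where "A = Max ((\<lambda>b. u (z (n + b))) ` {..<Q})"
  have A: "u (z (n + b)) \<le> A" if "b < Q" for b
    unfolding A_def by (rule Max_ge) (use that in auto)
  obtain i0 :: nat where i0: "A + \<bar>C\<bar> < real i0" using reals_Archimedean2 by blast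
  have "dist (z m) z0 < e" if m: "m \<ge> n + Q * i0" for m
  proof -
    define b i where "b = (m - n) mod Q" and "i = (m - n) div Q"
    have "m - n = Q * i + b" by (simp add: b_def i_def)
    then have mm: "m = (n + b) + Q * i" using m by simp
    have "b < Q" using Q by (simp add: b_def)
    have "i0 \<le> i" unfolding i_def using m Q by (simp add: less_eq_div_iff_mult_less_eq mult.commute)
    have "u (z m) + real i \<le> u (z (n + b))"
      unfolding mm by (rule u_along_orbit[of z n]) (use z in auto)
    then have "u (z m) < - \<bar>C\<bar>" using A[OF \<open>b < Q\<close>] i0 \<open>i0 \<le> i\<close> by linarith
    then have "\<bar>u (z m)\<bar> > C" by linarith
    moreover have "m \<ge> n" using m by simp
    ultimately have "z m \<in> ball z0 e" using C z(2) by blast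
    then show ?thesis by (simp add: dist_commute)
  qed
  then show "\<exists>N. \<forall>m\<ge>N. dist (z m) z0 < e" by blast
qed

text \<open>Where \<open>u\<close> is very negative, every block of \<open>Q\<close> applications of
  the local inverse \<open>\<phi>\<close> lowers it further. So each block starts in the small ball
  from which \<open>Q\<close> applications of \<open>\<phi>\<close> are under control, and
  \<open>orbit_converges\<close> applies.\<close>

lemma backward_trap:
  obtains C where "\<And>x. x \<in> ball z0 \<rho> - {z0} \<Longrightarrow> u x < C \<Longrightarrow> \<exists>z. orbit z \<and> z 0 = x \<and> z \<longlonglongrightarrow> z0"
proof -
  have holb: "f holomorphic_on ball z0 \<rho>" using hol holomorphic_on_subset by blast
  obtain \<phi> where \<phi>: "\<phi> holomorphic_on (f ` ball z0 \<rho>)" "\<And>z. z \<in> ball z0 \<rho> \<Longrightarrow> \<phi> (f z) = z"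
    using holomorphic_has_inverse[OF holb open_ball inj] by metis
  have op: "open (f ` ball z0 \<rho>)"
    by (rule open_mapping_thm3[OF holb open_ball inj])
  have z0in: "z0 \<in> f ` ball z0 \<rho>" using z0(1) \<rho>_pos by (metis centre_in_ball image_eqI)
  have \<phi>z0: "\<phi> z0 = z0" using \<phi>(2)[of z0] z0(1) \<rho>_pos by simp
  have cont: "isCont \<phi> z0"
    using z0in holomorphic_on_imp_continuous_on[OF \<phi>(1)] continuous_on_eq_continuous_at[OF op] by blast
  obtain \<rho>' where \<rho>': "\<rho>' > 0" "ball z0 \<rho>' \<subseteq> f ` ball z0 \<rho>" using op z0in by (metis openE)
  have f\<phi>: "f (\<phi> x) = x" "\<phi> x \<in> ball z0 \<rho>" if "x \<in> ball z0 \<rho>'" for x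
    using that \<rho>'(2) \<phi>(2) by auto
  obtain \<delta> where \<delta>: "\<delta> > 0" "\<And>i x. i \<le> Q \<Longrightarrow> x \<in> ball z0 \<delta> \<Longrightarrow> (\<phi> ^^ i) x \<in> ball z0 (min \<rho> \<rho>')"
    using iterates_stay_near_fixed_point[OF cont \<phi>z0, of "min \<rho> \<rho>'" Q] \<rho>_pos \<rho>'(1) by auto
  obtain C where C: "\<And>z. z \<in> ball z0 \<rho> - {z0} \<Longrightarrow> \<bar>u z\<bar> > C \<Longrightarrow> z \<in> ball z0 \<delta>"
    using u_large_near[OF \<delta>(1)] by metis
  have "\<exists>z. orbit z \<and> z 0 = x \<and> z \<longlonglongrightarrow> z0" if x: "x \<in> ball z0 \<rho> - {z0}" "u x < - \<bar>C\<bar>" for x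
  proof -
    define z where "z = (\<lambda>n. (\<phi> ^^ n) x)"
    have blk: "z (Q * i) \<in> ball z0 \<rho> - {z0} \<and> u (z (Q * i)) < - \<bar>C\<bar>" for i
    proof (induction i)
      case 0 then show ?case using x by (simp add: z_def)
    next
      case (Suc i)
      have zi: "z (Q * i) \<in> ball z0 \<delta>" using C Suc by fastforce
      have zin: "z (Q * i + k) \<in> ball z0 (min \<rho> \<rho>')" if "k \<le> Q" for k
        using \<delta>(2)[OF that zi] by (simp add: z_def add.commute[of "Q * i"] funpow_add)
      have it: "(f ^^ k) (z (Q * i + k)) = z (Q * i)" if "k \<le> Q" for k
        using that
      proof (induction k)
        case (Suc k)
        have "f (z (Q * i + Suc k)) = z (Q * i + k)"
          using f\<phi>(1)[of "z (Q * i + k)"] zin[of k] Suc.prems by (simp add: z_def)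
        then show ?case using Suc by (simp add: funpow_swap1)
      qed simp
      define y where "y = z (Q * i + Q)"
      have fy: "(f ^^ Q) y = z (Q * i)" using it[of Q] by (simp add: y_def)
      have "y \<noteq> z0" using fy Suc iter_fixed by auto
      then have y: "y \<in> ball z0 \<rho> - {z0}" using zin[of Q] by (simp add: y_def)
      have "u y + 1 \<le> u (z (Q * i))" using u_step[OF y] fy by simp
      then show ?case using Suc y by (simp add: y_def add.commute)
    qed
    have zin: "z m \<in> ball z0 (min \<rho> \<rho>')" for m
    proof -
      have "z (Q * (m div Q)) \<in> ball z0 \<delta>" using C blk[of "m div Q"] by fastforce
      from \<delta>(2)[OF _ this, of "m mod Q"] have "(\<phi> ^^ (m mod Q)) (z (Q * (m div Q))) \<in> ball z0 (min \<rho> \<rho>')"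
        using Q by (simp add: less_imp_le)
      also have "(\<phi> ^^ (m mod Q)) (z (Q * (m div Q))) = z m"
        by (simp add: z_def flip: funpow_add[THEN fun_cong, simplified])
      finally show ?thesis .
    qed
    have orb: "orbit z"
      unfolding orbit_def using f\<phi>(1) zin by (auto simp: z_def)
    have "z 0 = x" by (simp add: z_def)
    then have "z m \<noteq> z0" for m using orbit_neq_z0[OF orb, of 0 m] x by simp
    then have "z \<longlonglongrightarrow> z0"
      using zin by (intro orbit_converges[OF orb, of 0]) auto
    with orb \<open>z 0 = x\<close> show ?thesis by blast
  qed
  then show thesis using that by blast
qed

text \<open>Otherwise the repelling directions at \<^term>\<open>z0\<close> would lie in the bounded invariant set
  \<^term>\<open>- U\<close>, making the iterates of \<open>f ^^ Q\<close> equicontinuous at \<^term>\<open>z0\<close>.\<close>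

lemma exists_backward_orbit:
  obtains z where "orbit z" "z 0 \<in> U" "z \<longlonglongrightarrow> z0"
proof -
  obtain C where C: "\<And>x. x \<in> ball z0 \<rho> - {z0} \<Longrightarrow> u x < C \<Longrightarrow> \<exists>z. orbit z \<and> z 0 = x \<and> z \<longlonglongrightarrow> z0"
    using backward_trap by metis
  have "\<exists>x. x \<in> ball z0 \<rho> - {z0} \<and> u x < C \<and> x \<in> U"
  proof (rule ccontr)
    assume nU: "\<not> ?thesis"
    obtain C2 where C2: "\<And>z i. z \<in> ball z0 \<rho> \<Longrightarrow> u z > C2 \<Longrightarrow> (\<And>j. j \<le> i \<Longrightarrow> (f ^^ j) z \<noteq> z0) \<Longrightarrow>
      (f ^^ i) z \<in> ball z0 \<rho>"
      using forward_trap by metis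
    \<comment> \<open>\<open>j\<close> blocks lift \<open>u\<close> from \<open>C\<close> above
      \<open>C2\<close>, and \<open>\<delta>\<close> leaves room for these \<open>Q * j\<close>
      iterates. Unless its orbit hits \<open>z0\<close>, a point of \<open>ball z0 \<delta>\<close>
      thus either stays outside \<open>U\<close> for ever or is trapped in the ball after the
      blocks; both cases give the bound \<open>B'\<close>.\<close>
    obtain j :: nat where j: "C2 - C < real j" using reals_Archimedean2 by blast
    obtain \<delta> where \<delta>: "\<delta> > 0" "\<And>i x. i \<le> Q * j \<Longrightarrow> x \<in> ball z0 \<delta> \<Longrightarrow> (f ^^ i) x \<in> ball z0 \<rho>"
      using iterates_stay_near_fixed_point[OF isCont_f z0(1) \<rho>_pos] by metis
    obtain B where B: "\<And>x. x \<notin> U \<Longrightarrow> norm x \<le> B"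
      using bdd by (auto simp: bounded_iff)
    define B' where "B' = max B (norm z0 + \<rho>)"
    have bnd: "norm ((f ^^ n) x) \<le> B'" if x: "x \<in> ball z0 \<delta>" for x n
    proof -
      have xr: "x \<in> ball z0 \<rho>" using \<delta>(2)[OF _ x, of 0] by simp
      have inB: "norm y \<le> B'" if "y \<in> ball z0 \<rho>" for y
      proof -
        have "norm y \<le> norm z0 + norm (y - z0)" by (metis add_diff_cancel_left' diff_add_cancel norm_triangle_sub)
        then show ?thesis using that by (simp add: B'_def dist_norm norm_minus_commute)
      qed
      show ?thesis
      proof (cases "(f ^^ n) x = z0 \<or> n \<le> Q * j \<or> x \<notin> U")
        case True
        then show ?thesis
        proof (elim disjE)
          assume "x \<notin> U"
          then have "(f ^^ n) x \<notin> U" using in_U_of_iter by blast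
          then show ?thesis using B[of "(f ^^ n) x"] by (simp add: B'_def)
        qed (use inB[of z0] inB \<delta>(2)[OF _ x, of n] \<rho>_pos in auto)
      next
        case False
        have ne: "(f ^^ i) x \<noteq> z0" if "i \<le> n" for i
        proof
          assume "(f ^^ i) x = z0"
          then have "(f ^^ (n - i)) ((f ^^ i) x) = z0" by (simp add: iter_fixed)
          then show False using False that by (simp flip: funpow_add[THEN fun_cong, simplified])
        qed
        have uC: "u x \<ge> C"
        proof (rule ccontr)
          assume "\<not> u x \<ge> C"
          then show False using nU xr False ne[of 0] by (simp add: not_le) blast
        qed
        have "u ((f ^^ (Q * i)) x) \<ge> C + real i" if "i \<le> j" for i
          using that
        proof (induction i)
          case (Suc i)
          have Qi: "Q * i \<le> Q * j" using Suc by simp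
          then have "Q * i \<le> n" using False by linarith
          then have "(f ^^ (Q * i)) x \<in> ball z0 \<rho> - {z0}"
            using \<delta>(2)[OF Qi x] ne[of "Q * i"] by simp
          from u_step[OF this] show ?case
            using Suc by (simp add: funpow_add)
        qed (use uC in simp)
        from this[of j] have uy: "u ((f ^^ (Q * j)) x) > C2" using j by simp
        have "(f ^^ (n - Q * j)) ((f ^^ (Q * j)) x) \<in> ball z0 \<rho>"
        proof (rule C2[OF _ uy])
          show "(f ^^ (Q * j)) x \<in> ball z0 \<rho>" using \<delta>(2)[OF _ x] by simp
          show "(f ^^ i) ((f ^^ (Q * j)) x) \<noteq> z0" if "i \<le> n - Q * j" for i
          proof -
            have "i + Q * j \<le> n" using that False by linarith
            from ne[OF this] show ?thesis by (simp add: funpow_add)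
          qed
        qed
        then have "(f ^^ n) x \<in> ball z0 \<rho>"
          using False by (simp flip: funpow_add[THEN fun_cong, simplified])
        then show ?thesis by (rule inB)
      qed
    qed
    define L where "L = B' + norm z0 + 1"
    have B'0: "0 \<le> B'" using bnd[of z0 0] \<delta>(1) norm_ge_zero[of z0] by (simp del: norm_ge_zero)
    then have L: "L > 0" using norm_ge_zero[of z0] unfolding L_def by linarith
    \<comment> \<open>Schwarz's lemma turns the uniform bound into an estimate that does not depend
      on \<open>n\<close>. A backward orbit tending to \<open>z0\<close> contradicts it, since the
      \<open>n\<close>-th iterate of its \<open>n\<close>-th entry is always its starting point
      \<open>x\<close>.\<close>
    have lip: "norm ((f ^^ n) x - z0) \<le> L * (norm (x - z0) / \<delta>)" if x: "x \<in> ball z0 \<delta>" for x n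
    proof -
      define k where "k = (\<lambda>w. ((f ^^ n) (z0 + of_real \<delta> * w) - z0) / of_real L)"
      define \<xi> where "\<xi> = (x - z0) / of_real \<delta>"
      have \<xi>: "norm \<xi> < 1" "z0 + of_real \<delta> * \<xi> = x"
        using x \<delta>(1) by (auto simp: \<xi>_def norm_divide dist_norm norm_minus_commute)
      have "norm (k \<xi>) \<le> norm \<xi>"
      proof (rule Schwarz_Lemma)
        have "((f ^^ n) \<circ> (\<lambda>w. z0 + of_real \<delta> * w)) holomorphic_on ball 0 1"
          by (intro holomorphic_on_compose hol_iter holomorphic_intros)
        then show "k holomorphic_on ball 0 1"
          unfolding k_def o_def using L by (intro holomorphic_intros) auto
        show "k 0 = 0" by (simp add: k_def iter_fixed)
        fix w :: complex assume w: "norm w < 1"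
        have "z0 + of_real \<delta> * w \<in> ball z0 \<delta>"
          using w \<delta>(1) by (simp add: dist_norm norm_mult)
        then have "norm ((f ^^ n) (z0 + of_real \<delta> * w) - z0) < L"
          using bnd[of _ n] norm_triangle_ineq4[of "(f ^^ n) (z0 + of_real \<delta> * w)" z0]
          unfolding L_def by (smt (verit))
        then show "norm (k w) < 1" using L by (simp add: k_def norm_divide)
      qed (fact \<xi>)
      then have "norm ((f ^^ n) x - z0) / L \<le> norm (x - z0) / \<delta>"
        using L \<delta>(1) \<xi>(2) by (simp add: k_def norm_divide) (simp add: \<xi>_def norm_divide)
      then show ?thesis using L by (simp add: field_simps)
    qed
    obtain x where x: "x \<in> ball z0 \<rho> - {z0}" "u x < C"
      using tf unfolding escape_time_function_def by blast
    obtain z where z: "orbit z" "z 0 = x" "z \<longlonglongrightarrow> z0" using C[OF x] by blast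
    have "norm (x - z0) \<le> 0"
    proof (rule LIMSEQ_le_const)
      have "(\<lambda>n. L * (norm (z n - z0) / \<delta>)) \<longlonglongrightarrow> L * (norm (z0 - z0) / \<delta>)"
        using \<delta>(1) by (intro tendsto_intros z) auto
      then show "(\<lambda>n. L * (norm (z n - z0) / \<delta>)) \<longlonglongrightarrow> 0" by simp
      have "eventually (\<lambda>n. dist (z n) z0 < \<delta>) sequentially" using tendstoD[OF z(3) \<delta>(1)] .
      then obtain N where N: "\<And>n. n \<ge> N \<Longrightarrow> dist (z n) z0 < \<delta>" by (auto simp: eventually_sequentially)
      have "norm (x - z0) \<le> L * (norm (z n - z0) / \<delta>)" if "n \<ge> N" for n
        using lip[of "z n" n] N[OF that] orbit_iter[OF z(1), of n 0] z(2) by (simp add: dist_commute)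
      then show "\<exists>N. \<forall>n\<ge>N. norm (x - z0) \<le> L * (norm (z n - z0) / \<delta>)" by blast
    qed
    then show False using x by simp
  qed
  then show thesis using C that by metis
qed

end

section \<open>Continuation of backward orbits\<close>

context expanding_domain
begin

text \<open>A path in the space of backward orbits, which is an inverse limit: the parameter
  \<open>t\<close> runs through backward orbits, and \<open>q n\<close> lifts \<open>q 0\<close>
  through \<open>f ^^ n\<close>.\<close>

definition tower :: "(nat \<Rightarrow> real \<Rightarrow> complex) \<Rightarrow> bool" where
  "tower q \<longleftrightarrow> (\<forall>n. path (q n) \<and> path_image (q n) \<subseteq> U \<and> (\<forall>t\<in>{0..1}. f (q (Suc n) t) = q n t))"

text \<open>\<open>joined X z z'\<close>: the backward orbit \<open>z'\<close> arises from \<open>z\<close> by continuation along a path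
  in \<open>X\<close>. This replaces the universal cover of \<^term>\<open>U\<close>.\<close>

definition joined :: "complex set \<Rightarrow> (nat \<Rightarrow> complex) \<Rightarrow> (nat \<Rightarrow> complex) \<Rightarrow> bool" where
  "joined X z z' \<longleftrightarrow> (\<exists>q. tower q \<and> path_image (q 0) \<subseteq> X \<and> (\<forall>n. q n 0 = z n \<and> q n 1 = z' n))"

lemma tower_iter: "tower q \<Longrightarrow> t \<in> {0..1} \<Longrightarrow> (f ^^ n) (q n t) = q 0 t"
  by (induction n) (auto simp: tower_def funpow_swap1)

lemma tower_cont: "tower q \<Longrightarrow> continuous_on {0..1} (q n)"
  by (simp add: tower_def path_def)

lemma tower_in_U: "tower q \<Longrightarrow> t \<in> {0..1} \<Longrightarrow> q n t \<in> U"
  unfolding tower_def path_image_def by blast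

lemma tower_orbit: "tower q \<Longrightarrow> t \<in> {0..1} \<Longrightarrow> orbit (\<lambda>n. q n t)"
  by (simp add: tower_def orbit_def)

lemma tower_eq:
  assumes q: "tower q" and k: "continuous_on {0..1} k" "\<And>t. t \<in> {0..1} \<Longrightarrow> (f ^^ n) (k t) = q 0 t"
    and a: "a \<in> {0..1}" "k a = q n a" and t: "t \<in> {0..1}"
  shows "k t = q n t"
proof (rule iter_lifts_agree[of "{0..1}" k "q n" n a])
  show "(f ^^ n) (k x) = (f ^^ n) (q n x)" if "x \<in> {0..1}" for x
    using k(2)[OF that] tower_iter[OF q that] by simp
  show "(f ^^ n) (k x) \<in> U" if "x \<in> {0..1}" for x
    using k(2)[OF that] tower_in_U[OF q that] by simp
qed (use k a t tower_cont[OF q] in auto)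

lemma tower_lift:
  assumes p: "path p" "path_image p \<subseteq> U" and z: "orbit z" "z 0 = p 0"
  obtains q where "tower q" "q 0 = p" "\<And>n. q n 0 = z n"
proof -
  define P where "P = (\<lambda>n r. path r \<and> path_image r \<subseteq> U \<and> r 0 = z n \<and> (n = 0 \<longrightarrow> r = p))"
  have "\<exists>q. \<forall>n. P n (q n) \<and> (\<forall>t\<in>{0..1}. f (q (Suc n) t) = q n t)"
  proof (rule dependent_nat_choice)
    show "\<exists>r. P 0 r" using p z by (auto simp: P_def)
    fix r n assume r: "P n r"
    then have zU: "z n \<in> U"
      using pathstart_in_path_image[of r] by (auto simp: P_def pathstart_def)
    have fz: "f (z (Suc n)) = z n" using z by (simp add: orbit_def)
    obtain r' where r': "path r'" "path_image r' \<subseteq> f -` U" "pathstart r' = z (Suc n)"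
       "\<And>t. t \<in> {0..1} \<Longrightarrow> f (r' t) = r t"
    proof (rule covering_space_lift_path_strong[OF cov, of "z (Suc n)" r])
      show "z (Suc n) \<in> f -` U" using fz zU by simp
      show "path r" "path_image r \<subseteq> U" "pathstart r = f (z (Suc n))"
        using r fz by (auto simp: P_def pathstart_def)
    qed blast
    then show "\<exists>r'. P (Suc n) r' \<and> (\<forall>t\<in>{0..1}. f (r' t) = r t)"
      using preimage_sub by (intro exI[of _ r']) (auto simp: P_def pathstart_def)
  qed
  then obtain q where q: "\<And>n. P n (q n)" "\<And>n. \<forall>t\<in>{0..1}. f (q (Suc n) t) = q n t" by blast
  show thesis
    by (rule that[of q]) (use q in \<open>auto simp: P_def tower_def\<close>)
qed

text \<open>Monodromy at every level at once: lifts of homotopic paths have the same endpoints, so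
  the continued backward orbit depends only on the homotopy class of the base path in
  \<open>U\<close>.\<close>

lemma tower_homotopic:
  assumes q: "tower q" and hom: "homotopic_paths U (q 0) p"
  obtains q' where "tower q'" "q' 0 = p" "\<And>n. q' n 0 = q n 0" "\<And>n. q' n 1 = q n 1"
proof -
  define P where "P = (\<lambda>n r. homotopic_paths U (q n) r \<and> (n = 0 \<longrightarrow> r = p))"
  have "\<exists>q'. \<forall>n. P n (q' n) \<and> (\<forall>t\<in>{0..1}. f (q' (Suc n) t) = q' n t)"
  proof (rule dependent_nat_choice)
    show "\<exists>r. P 0 r" using hom by (auto simp: P_def)
    fix r n assume "P n r"
    then have r: "homotopic_paths U (q n) r" by (simp add: P_def)
    have qn: "path (q (Suc n))" "path_image (q (Suc n)) \<subseteq> f -` U" "\<And>t. t \<in> {0..1} \<Longrightarrow> f (q (Suc n) t) = q n t"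
      using q unfolding tower_def path_image_def by (auto intro!: tower_in_U[OF q])
    obtain r' where r': "path r'" "path_image r' \<subseteq> f -` U" "pathstart r' = pathstart (q (Suc n))"
      "pathfinish r' = pathfinish (q (Suc n))" "\<And>t. t \<in> {0..1} \<Longrightarrow> f (r' t) = r t"
      using covering_space_lift_homotopic_path[OF cov r qn(1,2) refl refl qn(3)] by metis
    have "homotopic_paths (f -` U) (q (Suc n)) r'"
    proof (rule covering_space_lift_homotopic_paths[OF cov _ _ _ _ r qn r'(1,2,5)])
      show "path (q n)" "path_image (q n) \<subseteq> U" "path r" "path_image r \<subseteq> U"
        using r homotopic_paths_imp_path homotopic_paths_imp_subset by blast+
    qed (use r' in auto)
    then have "homotopic_paths U (q (Suc n)) r'"
      using preimage_sub homotopic_paths_subset by blast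
    then show "\<exists>r'. P (Suc n) r' \<and> (\<forall>t\<in>{0..1}. f (r' t) = r t)"
      using r'(5) by (auto simp: P_def)
  qed
  then obtain q' where q': "\<And>n. P n (q' n)" "\<And>n. \<forall>t\<in>{0..1}. f (q' (Suc n) t) = q' n t" by blast
  have hom': "homotopic_paths U (q n) (q' n)" for n
    using q'(1) by (simp add: P_def)
  show thesis
  proof (rule that[of q'])
    show "tower q'"
      unfolding tower_def
      using hom' homotopic_paths_imp_path homotopic_paths_imp_subset q'(2) by blast
    show "q' n 0 = q n 0" "q' n 1 = q n 1" for n
      using homotopic_paths_imp_pathstart[OF hom'] homotopic_paths_imp_pathfinish[OF hom']
      by (auto simp: pathstart_def pathfinish_def)
    show "q' 0 = p" using q'(1)[of 0] by (simp add: P_def)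
  qed
qed

lemma joined_refl:
  assumes "orbit z" "z 0 \<in> X" "X \<subseteq> U"
  shows "joined X z z"
  unfolding joined_def
proof (intro exI conjI allI)
  have "z n \<in> U" for n
    using orbit_in_U assms by blast
  then show "tower (\<lambda>n t. z n)"
    using assms(1) by (auto simp: tower_def path_def path_image_def orbit_def)
qed (use assms in \<open>auto simp: path_image_def\<close>)

lemma joined_sym: "joined X z z' \<Longrightarrow> joined X z' z"
  unfolding joined_def
proof (elim exE conjE)
  fix q assume q: "tower q" "path_image (q 0) \<subseteq> X" "\<forall>n. q n 0 = z n \<and> q n 1 = z' n"
  have "tower (\<lambda>n. reversepath (q n))"
    unfolding tower_def
  proof (intro allI conjI ballI)
    fix n
    show "path (reversepath (q n))" "path_image (reversepath (q n)) \<subseteq> U"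
      using q(1) by (simp_all add: tower_def)
    show "f (reversepath (q (Suc n)) t) = reversepath (q n) t" if "t \<in> {0..1}" for t
      using q(1) that by (simp add: tower_def reversepath_def)
  qed
  then show "\<exists>q. tower q \<and> path_image (q 0) \<subseteq> X \<and> (\<forall>n. q n 0 = z' n \<and> q n 1 = z n)"
    using q by (intro exI[of _ "\<lambda>n. reversepath (q n)"] conjI) (simp_all, simp add: reversepath_def)
qed

lemma joined_trans:
  assumes "joined X z z'" "joined X z' z''"
  shows "joined X z z''"
proof -
  obtain q where q: "tower q" "path_image (q 0) \<subseteq> X" "\<And>n. q n 0 = z n" "\<And>n. q n 1 = z' n"
    using assms(1) by (auto simp: joined_def)
  obtain r where r: "tower r" "path_image (r 0) \<subseteq> X" "\<And>n. r n 0 = z' n" "\<And>n. r n 1 = z'' n"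
    using assms(2) by (auto simp: joined_def)
  have j: "pathfinish (q n) = pathstart (r n)" for n
    using q r by (simp add: pathfinish_def pathstart_def)
  have "tower (\<lambda>n. q n +++ r n)"
    unfolding tower_def
  proof (intro allI conjI ballI)
    fix n
    show "path (q n +++ r n)" using q(1) r(1) j by (auto simp: tower_def)
    show "path_image (q n +++ r n) \<subseteq> U"
      using q(1) r(1) j by (auto simp: tower_def path_image_join)
    show "f ((q (Suc n) +++ r (Suc n)) t) = (q n +++ r n) t" if "t \<in> {0..1}" for t
      using q(1) r(1) that by (auto simp: tower_def joinpaths_def)
  qed
  moreover have "path_image (q 0 +++ r 0) \<subseteq> X"
    using q(2) r(2) j by (simp add: path_image_join)
  ultimately show ?thesis
    unfolding joined_def using q(3) r(4)
    by (intro exI[of _ "\<lambda>n. q n +++ r n"]) (simp add: joinpaths_def)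
qed

lemma joined_mono: "joined X z z' \<Longrightarrow> X \<subseteq> Y \<Longrightarrow> joined Y z z'"
  unfolding joined_def by blast

text \<open>Dropping the lowest level of a tower leaves a tower whose base path lies over the old
  one.\<close>

lemma joined_shift:
  assumes "joined X z z'"
  shows "joined (f -` X) (\<lambda>n. z (Suc n)) (\<lambda>n. z' (Suc n))"
proof -
  obtain q where q: "tower q" "path_image (q 0) \<subseteq> X" "\<forall>n. q n 0 = z n \<and> q n 1 = z' n"
    using assms by (auto simp: joined_def)
  have "tower (\<lambda>n. q (Suc n))" using q(1) by (simp add: tower_def)
  moreover have "path_image (q (Suc 0)) \<subseteq> f -` X"
    using q(1,2) by (force simp: tower_def path_image_def)
  ultimately show ?thesis
    unfolding joined_def using q(3) by (intro exI[of _ "\<lambda>n. q (Suc n)"]) auto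
qed

lemma joined_along:
  assumes "path p" "path_image p \<subseteq> X" "X \<subseteq> U" "orbit z" "z 0 = p 0"
  obtains z' where "joined X z z'" "z' 0 = p 1"
proof -
  obtain q where q: "tower q" "q 0 = p" "\<And>n. q n 0 = z n"
    using tower_lift[OF assms(1) _ assms(4,5)] assms(2,3) by (metis order_trans)
  have "joined X z (\<lambda>n. q n 1)"
    unfolding joined_def using q assms(2) by blast
  then show thesis using that q(2) by auto
qed

lemma joined_orbit:
  assumes "joined X z z'" shows "orbit z" "orbit z'" "z n \<in> U" "z' n \<in> U" "z 0 \<in> X" "z' 0 \<in> X"
proof -
  obtain q where q: "tower q" "path_image (q 0) \<subseteq> X" "\<And>n. q n 0 = z n" "\<And>n. q n 1 = z' n"
    using assms by (auto simp: joined_def)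
  show "orbit z" "orbit z'"
    using tower_orbit[OF q(1), of 0] tower_orbit[OF q(1), of 1] q(3,4) by auto
  show "z n \<in> U" "z' n \<in> U"
    using tower_in_U[OF q(1), of 0 n] tower_in_U[OF q(1), of 1 n] q(3,4) by auto
  show "z 0 \<in> X" "z' 0 \<in> X"
    using q(2) q(3)[of 0] q(4)[of 0] pathstart_in_path_image[of "q 0"] pathfinish_in_path_image[of "q 0"]
    by (auto simp: pathstart_def pathfinish_def)
qed

text \<open>A Lebesgue number argument: \<open>\<delta>\<close> is so small that a curve in
  \<open>X\<close> staying within \<open>\<delta>\<close> of its start lies in the quarter disc of
  one of finitely many discs. Its lift is then given by a single branch, and
  \<open>branches_shrink\<close> applies. Only the depth depends on \<open>M\<close> and
  \<open>\<epsilon>\<close>, not \<open>\<delta>\<close>.\<close>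

lemma short_lifts_shrink:
  assumes X: "compact X" "X \<subseteq> U"
  obtains \<delta> where "\<delta> > 0"
    "\<And>M \<epsilon>. \<epsilon> > 0 \<Longrightarrow> \<exists>m0. \<forall>m\<ge>m0. \<forall>k a b. continuous_on {a..b::real} k \<longrightarrow>
       (\<forall>t\<in>{a..b}. (f ^^ m) (k t) \<in> X \<and> dist ((f ^^ m) (k a)) ((f ^^ m) (k t)) < \<delta>) \<longrightarrow> norm (k a) \<le> M \<longrightarrow>
       (\<forall>t\<in>{a..b}. dist (k t) (k a) < \<epsilon>)"
proof -
  have "\<forall>x. \<exists>r. x \<in> X \<longrightarrow> r > 0 \<and> ball x r \<subseteq> U"
    using U(1) X(2) by (meson openE subsetD)
  then obtain r where r: "\<And>x. x \<in> X \<Longrightarrow> r x > 0 \<and> ball x (r x) \<subseteq> U" by metis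
  obtain C where C: "C \<subseteq> X" "finite C" "X \<subseteq> (\<Union>c\<in>C. ball c (r c / 8))"
    by (rule compactE_image[OF X(1), of X "\<lambda>c. ball c (r c / 8)"]) (use r in force)+
  define \<delta> where "\<delta> = Min (insert 1 ((\<lambda>c. r c / 8) ` C))"
  have fin: "finite (insert 1 ((\<lambda>c. r c / 8) ` C))" using C(2) by simp
  have "\<delta> > 0"
    unfolding \<delta>_def using fin C(1) r by (subst Min_gr_iff) auto
  moreover have "\<delta> \<le> r c / 8" if "c \<in> C" for c
    unfolding \<delta>_def by (rule Min_le[OF fin]) (use that in simp)
  ultimately have \<delta>: "\<delta> > 0" "\<And>c. c \<in> C \<Longrightarrow> \<delta> \<le> r c / 8" .
  show thesis
  proof (rule that[OF \<delta>(1)])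
    fix M \<epsilon> :: real assume "\<epsilon> > 0"
    have "\<exists>m0. \<forall>m \<psi> w z z'. m \<ge> m0 \<longrightarrow> branch m (ball c (r c)) \<psi> \<longrightarrow> w \<in> cball c (r c/4) \<longrightarrow> norm (\<psi> w) \<le> M \<longrightarrow>
       z \<in> cball c (r c/4) \<longrightarrow> z' \<in> cball c (r c/4) \<longrightarrow> dist (\<psi> z) (\<psi> z') < \<epsilon>" if "c \<in> C" for c
    proof -
      have "r c > 0" "ball c (r c) \<subseteq> U" using r that C(1) by auto
      from branches_shrink[OF this \<open>\<epsilon> > 0\<close>] show ?thesis by metis
    qed
    then obtain m0 where m0: "\<And>c m \<psi> w z z'. c \<in> C \<Longrightarrow> m \<ge> m0 c \<Longrightarrow> branch m (ball c (r c)) \<psi> \<Longrightarrow> w \<in> cball c (r c/4) \<Longrightarrow> norm (\<psi> w) \<le> M \<Longrightarrow>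
       z \<in> cball c (r c/4) \<Longrightarrow> z' \<in> cball c (r c/4) \<Longrightarrow> dist (\<psi> z) (\<psi> z') < \<epsilon>"
      by metis
    show "\<exists>m0. \<forall>m\<ge>m0. \<forall>k a b. continuous_on {a..b::real} k \<longrightarrow>
       (\<forall>t\<in>{a..b}. (f ^^ m) (k t) \<in> X \<and> dist ((f ^^ m) (k a)) ((f ^^ m) (k t)) < \<delta>) \<longrightarrow> norm (k a) \<le> M \<longrightarrow>
       (\<forall>t\<in>{a..b}. dist (k t) (k a) < \<epsilon>)"
    proof (intro exI[of _ "Max (insert 0 (m0 ` C))"] allI impI ballI)
      fix m k a b t
      assume m: "m \<ge> Max (insert 0 (m0 ` C))" and k: "continuous_on {a..b::real} k"
        and fk: "\<forall>t\<in>{a..b}. (f ^^ m) (k t) \<in> X \<and> dist ((f ^^ m) (k a)) ((f ^^ m) (k t)) < \<delta>"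
        and M: "norm (k a) \<le> M" and t: "t \<in> {a..b}"
      have a: "a \<in> {a..b}" using t by simp
      define x where "x = (f ^^ m) (k a)"
      obtain c where c: "c \<in> C" "x \<in> ball c (r c / 8)"
      proof -
        have "x \<in> X" using fk a by (simp add: x_def)
        then show thesis using C(3) that by blast
      qed
      have rc: "r c > 0" "ball c (r c) \<subseteq> U" using r c(1) C(1) by auto
      have inc: "(f ^^ m) (k s) \<in> cball c (r c / 4)" if "s \<in> {a..b}" for s
      proof -
        have "dist c ((f ^^ m) (k s)) \<le> dist c x + dist x ((f ^^ m) (k s))" by (rule dist_triangle)
        also have "\<dots> \<le> r c / 8 + r c / 8"
        proof (rule add_mono)
          show "dist c x \<le> r c / 8" using c(2) by simp
          have "dist x ((f ^^ m) (k s)) < \<delta>" using fk that by (simp add: x_def)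
          then show "dist x ((f ^^ m) (k s)) \<le> r c / 8" using \<delta>(2)[OF c(1)] by linarith
        qed
        finally show ?thesis by simp
      qed
      have sub: "cball c (r c / 4) \<subseteq> ball c (r c)" using rc(1) by (auto simp: cball_subset_ball_iff)
      obtain \<psi> where \<psi>: "branch m (ball c (r c)) \<psi>" "\<psi> x = k a"
      proof (rule branch_exists[OF rc(2)])
        show "x \<in> ball c (r c)" using inc[OF a] sub by (simp only: x_def) blast
      qed (simp_all add: x_def)
      have eq: "k s = \<psi> ((f ^^ m) (k s))" if "s \<in> {a..b}" for s
      proof (rule iter_lifts_agree[of "{a..b}" k "\<lambda>s. \<psi> ((f ^^ m) (k s))" m a])
        have "continuous_on {a..b} ((f ^^ m) \<circ> k)" by (intro continuous_on_compose k cont_iter)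
        moreover have "continuous_on (ball c (r c)) \<psi>"
          using \<psi>(1) unfolding branch_def by (blast intro: holomorphic_on_imp_continuous_on)
        moreover have "((f ^^ m) \<circ> k) ` {a..b} \<subseteq> ball c (r c)"
          using inc sub by (simp only: image_subset_iff o_apply) blast
        ultimately have "continuous_on {a..b} (\<psi> \<circ> ((f ^^ m) \<circ> k))"
          by (rule continuous_on_compose[OF _ continuous_on_subset])
        then show "continuous_on {a..b} (\<lambda>s. \<psi> ((f ^^ m) (k s)))" by (simp add: o_def)
        show "(f ^^ m) (k s) = (f ^^ m) (\<psi> ((f ^^ m) (k s)))" if "s \<in> {a..b}" for s
          using \<psi>(1) inc[OF that] sub by (auto simp: branch_def)
        show "(f ^^ m) (k s) \<in> U" if "s \<in> {a..b}" for s using fk that X(2) by blast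
      qed (use k a \<psi>(2) that in \<open>auto simp: x_def\<close>)
      have "m \<ge> m0 c" using m c(1) C(2) by simp
      then have "dist (\<psi> ((f ^^ m) (k t))) (\<psi> x) < \<epsilon>"
        using inc[OF a] inc[OF t] M \<psi> by (intro m0[OF c(1), of m \<psi> x]) (auto simp: x_def)
      then show "dist (k t) (k a) < \<epsilon>" using eq[OF t] \<psi>(2) by simp
    qed
  qed
qed

text \<open>The parameter interval is cut into \<open>Suc N\<close> pieces, each allowed a share
  \<open>\<epsilon> / Suc N\<close>; the bound \<open>M + \<epsilon>\<close> in the proof absorbs
  the drift of their starting points. Prescribing only a common oscillation bound makes the depth
  uniform over a family of curves, as the radial segments require.\<close>

lemma lifts_shrink:
  assumes X: "compact X" "X \<subseteq> U"
  obtains \<delta> where "\<delta> > 0"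
    "\<And>M \<epsilon> N. \<epsilon> > 0 \<Longrightarrow> \<exists>m0. \<forall>m\<ge>m0. \<forall>k. continuous_on {0..1} k \<longrightarrow>
       (\<forall>t\<in>{0..1}. (f ^^ m) (k t) \<in> X) \<longrightarrow>
       (\<forall>s\<in>{0..1}. \<forall>t\<in>{0..1}. \<bar>s - t\<bar> \<le> 1 / real (Suc N) \<longrightarrow> dist ((f ^^ m) (k s)) ((f ^^ m) (k t)) < \<delta>) \<longrightarrow>
       norm (k 0) \<le> M \<longrightarrow> (\<forall>t\<in>{0..1}. dist (k t) (k 0) < \<epsilon>)"
proof -
  obtain \<delta> where \<delta>: "\<delta> > 0"
    "\<And>M \<epsilon>. \<epsilon> > 0 \<Longrightarrow> \<exists>m0. \<forall>m\<ge>m0. \<forall>k a b. continuous_on {a..b::real} k \<longrightarrow>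
       (\<forall>t\<in>{a..b}. (f ^^ m) (k t) \<in> X \<and> dist ((f ^^ m) (k a)) ((f ^^ m) (k t)) < \<delta>) \<longrightarrow> norm (k a) \<le> M \<longrightarrow>
       (\<forall>t\<in>{a..b}. dist (k t) (k a) < \<epsilon>)"
    using short_lifts_shrink[OF X] by metis
  show thesis
  proof (rule that[OF \<delta>(1)])
    fix M \<epsilon> :: real and N :: nat assume e: "\<epsilon> > 0"
    define \<eta> where "\<eta> = \<epsilon> / real (Suc N)"
    have \<eta>: "\<eta> > 0" using e by (simp add: \<eta>_def)
    obtain m0 where m0: "\<And>m k a b. m \<ge> m0 \<Longrightarrow> continuous_on {a..b::real} k \<Longrightarrow>
       (\<forall>t\<in>{a..b}. (f ^^ m) (k t) \<in> X \<and> dist ((f ^^ m) (k a)) ((f ^^ m) (k t)) < \<delta>) \<Longrightarrow> norm (k a) \<le> M + \<epsilon> \<Longrightarrow>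
       (\<forall>t\<in>{a..b}. dist (k t) (k a) < \<eta>)"
      using \<delta>(2)[OF \<eta>, of "M + \<epsilon>"] by blast
    show "\<exists>m0. \<forall>m\<ge>m0. \<forall>k. continuous_on {0..1} k \<longrightarrow>
       (\<forall>t\<in>{0..1}. (f ^^ m) (k t) \<in> X) \<longrightarrow>
       (\<forall>s\<in>{0..1}. \<forall>t\<in>{0..1}. \<bar>s - t\<bar> \<le> 1 / real (Suc N) \<longrightarrow> dist ((f ^^ m) (k s)) ((f ^^ m) (k t)) < \<delta>) \<longrightarrow>
       norm (k 0) \<le> M \<longrightarrow> (\<forall>t\<in>{0..1}. dist (k t) (k 0) < \<epsilon>)"
    proof (intro exI[of _ m0] allI impI)
      fix m k
      assume m: "m \<ge> m0" and k: "continuous_on {0..1} k" and X: "\<forall>t\<in>{0..1}. (f ^^ m) (k t) \<in> X"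
        and osc: "\<forall>s\<in>{0..1}. \<forall>t\<in>{0..1}. \<bar>s - t\<bar> \<le> 1 / real (Suc N) \<longrightarrow> dist ((f ^^ m) (k s)) ((f ^^ m) (k t)) < \<delta>"
        and M: "norm (k 0) \<le> M"
      have ind: "\<forall>t\<in>{0..real (Suc j) / real (Suc N)}. dist (k t) (k 0) < real (Suc j) * \<eta>" if "j \<le> N" for j
        using that
      proof (induction j)
        case 0
        have "\<forall>t\<in>{0..1 / real (Suc N)}. dist (k t) (k 0) < \<eta>"
        proof (rule m0[OF m])
          show "continuous_on {0..1 / real (Suc N)} k"
            by (rule continuous_on_subset[OF k]) (auto simp: field_simps)
          have "t \<in> {0..1}" if "t \<in> {0..1 / real (Suc N)}" for t
          proof -
            have "1 / real (Suc N) \<le> 1" by simp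
            then show ?thesis using that unfolding atLeastAtMost_iff by linarith
          qed
          then show "\<forall>t\<in>{0..1 / real (Suc N)}. (f ^^ m) (k t) \<in> X \<and> dist ((f ^^ m) (k 0)) ((f ^^ m) (k t)) < \<delta>"
            using X osc by auto
        qed (use M e in simp)
        then show ?case by simp
      next
        case (Suc j)
        define a b where "a = real (Suc j) / real (Suc N)" and "b = real (Suc (Suc j)) / real (Suc N)"
        have ab: "0 \<le> a" "a \<le> b" "b \<le> 1" "b - a = 1 / real (Suc N)"
          using Suc.prems by (auto simp: a_def b_def divide_right_mono simp flip: diff_divide_distrib)
        have IH: "\<forall>t\<in>{0..a}. dist (k t) (k 0) < real (Suc j) * \<eta>" using Suc by (simp add: a_def)
        have j\<eta>: "real (Suc j) * \<eta> \<le> \<epsilon>"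
          using Suc.prems e by (simp add: \<eta>_def field_simps)
        have ka: "norm (k a) \<le> M + \<epsilon>"
        proof -
          have "norm (k a) \<le> norm (k 0) + dist (k a) (k 0)"
            by (metis dist_norm norm_triangle_sub)
          then show ?thesis using IH ab M j\<eta> by (smt (verit) atLeastAtMost_iff)
        qed
        have "\<forall>t\<in>{a..b}. dist (k t) (k a) < \<eta>"
        proof (rule m0[OF m])
          show "norm (k a) \<le> M + \<epsilon>" by (rule ka)
          show "continuous_on {a..b} k"
            by (rule continuous_on_subset[OF k]) (use ab in auto)
          show "\<forall>t\<in>{a..b}. (f ^^ m) (k t) \<in> X \<and> dist ((f ^^ m) (k a)) ((f ^^ m) (k t)) < \<delta>"
          proof
            fix t assume t: "t \<in> {a..b}"
            then have "t \<in> {0..1}" "a \<in> {0..1}" "\<bar>a - t\<bar> \<le> 1 / real (Suc N)" using ab by auto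
            then show "(f ^^ m) (k t) \<in> X \<and> dist ((f ^^ m) (k a)) ((f ^^ m) (k t)) < \<delta>"
              using X osc by blast
          qed
        qed
        moreover have "dist (k a) (k 0) < real (Suc j) * \<eta>" using IH ab by auto
        ultimately have "dist (k t) (k 0) < real (Suc (Suc j)) * \<eta>" if "t \<in> {0..b}" for t
        proof (cases "t \<le> a")
          case True
          then have "dist (k t) (k 0) < real (Suc j) * \<eta>" using IH that by auto
          then show ?thesis using \<eta> by (simp add: algebra_simps)
        next
          case False
          then have "dist (k t) (k a) < \<eta>" using that \<open>\<forall>t\<in>{a..b}. dist (k t) (k a) < \<eta>\<close> by auto
          then have "dist (k t) (k 0) < \<eta> + real (Suc j) * \<eta>"
            using dist_triangle[of "k t" "k 0" "k a"] \<open>dist (k a) (k 0) < real (Suc j) * \<eta>\<close> by linarith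
          then show ?thesis by (simp add: algebra_simps)
        qed
        then show ?case by (simp add: b_def)
      qed
      show "\<forall>t\<in>{0..1}. dist (k t) (k 0) < \<epsilon>"
        using ind[of N] by (simp add: \<eta>_def)
    qed
  qed
qed

lemma tower_shrinks:
  assumes q: "tower q" and M: "\<And>m. norm (q m 0) \<le> M" and e: "\<epsilon> > 0"
  shows "\<exists>m0. \<forall>m\<ge>m0. \<forall>t\<in>{0..1}. dist (q m t) (q m 0) < \<epsilon>"
proof -
  have X: "compact (path_image (q 0))" "path_image (q 0) \<subseteq> U"
    using q by (auto simp: tower_def compact_path_image)
  obtain \<delta> where \<delta>: "\<delta> > 0"
    "\<And>M \<epsilon> N. \<epsilon> > 0 \<Longrightarrow> \<exists>m0. \<forall>m\<ge>m0. \<forall>k. continuous_on {0..1} k \<longrightarrow>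
       (\<forall>t\<in>{0..1}. (f ^^ m) (k t) \<in> path_image (q 0)) \<longrightarrow>
       (\<forall>s\<in>{0..1}. \<forall>t\<in>{0..1}. \<bar>s - t\<bar> \<le> 1 / real (Suc N) \<longrightarrow> dist ((f ^^ m) (k s)) ((f ^^ m) (k t)) < \<delta>) \<longrightarrow>
       norm (k 0) \<le> M \<longrightarrow> (\<forall>t\<in>{0..1}. dist (k t) (k 0) < \<epsilon>)"
    using lifts_shrink[OF X] by metis
  have "uniformly_continuous_on {0..1} (q 0)"
    using tower_cont[OF q] by (intro compact_uniformly_continuous) auto
  then obtain d where d: "d > 0" "\<And>s t. s \<in> {0..1} \<Longrightarrow> t \<in> {0..1} \<Longrightarrow> dist s t < d \<Longrightarrow> dist (q 0 s) (q 0 t) < \<delta>"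
    using \<delta>(1) unfolding uniformly_continuous_on_def by metis
  obtain N :: nat where N: "1 / real (Suc N) < d"
    using nat_approx_posE[OF d(1)] by metis
  obtain m0 where m0: "\<And>m k. m \<ge> m0 \<Longrightarrow> continuous_on {0..1} k \<Longrightarrow>
       (\<forall>t\<in>{0..1}. (f ^^ m) (k t) \<in> path_image (q 0)) \<Longrightarrow>
       (\<forall>s\<in>{0..1}. \<forall>t\<in>{0..1}. \<bar>s - t\<bar> \<le> 1 / real (Suc N) \<longrightarrow> dist ((f ^^ m) (k s)) ((f ^^ m) (k t)) < \<delta>) \<Longrightarrow>
       norm (k 0) \<le> M \<Longrightarrow> (\<forall>t\<in>{0..1}. dist (k t) (k 0) < \<epsilon>)"
    using \<delta>(2)[OF e, of N M] by blast
  show ?thesis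
  proof (intro exI allI impI)
    fix m assume m: "m \<ge> m0"
    show "\<forall>t\<in>{0..1}. dist (q m t) (q m 0) < \<epsilon>"
      using N tower_iter[OF q] d(2)
      by (intro m0[OF m tower_cont[OF q] _ _ M]) (auto simp: path_image_def dist_real_def)
  qed
qed

lemma joined_tendsto:
  assumes j: "joined X z z'" and z: "z \<longlonglongrightarrow> L"
  shows "z' \<longlonglongrightarrow> L"
proof -
  obtain q where q: "tower q" "\<And>n. q n 0 = z n" "\<And>n. q n 1 = z' n"
    using j by (auto simp: joined_def)
  obtain M where M: "\<And>n. norm (z n) \<le> M"
    using z convergentI convergent_imp_Bseq by (metis BseqE)
  have "(\<lambda>n. dist (z' n) (z n)) \<longlonglongrightarrow> 0"
  proof (rule metric_LIMSEQ_I)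
    fix e :: real assume "e > 0"
    from tower_shrinks[OF q(1) _ this, of M] obtain m0
      where "\<And>m. m \<ge> m0 \<Longrightarrow> \<forall>t\<in>{0..1}. dist (q m t) (q m 0) < e"
      using M q(2) by auto
    then show "\<exists>no. \<forall>n\<ge>no. dist (dist (z' n) (z n)) 0 < e"
    proof (intro exI[of _ m0] allI impI)
      fix n assume "n \<ge> m0"
      from bspec[OF \<open>\<And>m. m \<ge> m0 \<Longrightarrow> \<forall>t\<in>{0..1}. dist (q m t) (q m 0) < e\<close>[OF this], of 1]
      show "dist (dist (z' n) (z n)) 0 < e" by (simp add: q(2,3))
    qed
  qed
  then have "(\<lambda>n. z' n - z n) \<longlonglongrightarrow> 0"
    by (simp add: dist_norm tendsto_norm_zero_iff)
  from tendsto_add[OF this z] show ?thesis by simp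
qed

end

section \<open>A cycle of classes of backward orbits\<close>

text \<open>The complement of \<open>U\<close> and the ball at \<open>z0\<close> lie inside radius
  \<open>R0\<close>, and \<open>S\<close> is so large that \<open>f\<close> maps
  \<open>cball d R\<close> into \<open>cball d S\<close>. An orbit based beyond \<open>S\<close> is
  therefore, after a shift, still based beyond \<open>R\<close>.\<close>

locale expanding_far_annulus = expanding_fixed_point +
  fixes d :: complex and R0 R S :: real
  assumes radii: "0 < R0" "R0 < R" "R < S"
    and far_in_U: "- ball d R0 \<subseteq> U"
    and preimage_far: "f -` (- cball d S) \<subseteq> - cball d R"
    and near_ball: "ball z0 \<rho> \<subseteq> ball d R0"
begin

text \<open>The move stays in one compact annulus, so that \<open>lifts_shrink\<close> gives
  constants common to all steps. The alternative \<open>z' = z\<close> serves orbits that are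
  already based at radius \<open>S + 1\<close> or more.\<close>

definition radial_step :: "(nat \<Rightarrow> complex) \<Rightarrow> (nat \<Rightarrow> complex) \<Rightarrow> bool" where
  "radial_step z z' \<longleftrightarrow> z' = z \<or> (\<exists>q. tower q \<and> q 0 = linepath (z 0) (z' 0) \<and>
      path_image (q 0) \<subseteq> cball d (S + 1) - ball d R \<and> (\<forall>n. q n 0 = z n \<and> q n 1 = z' n))"

lemma far_subset_U: "- cball d R \<subseteq> U" "- cball d S \<subseteq> U" "cball d (S + 1) - ball d R \<subseteq> U"
  using radii far_in_U by (auto simp: subset_iff)

lemma radial_step_exists:
  assumes z: "orbit z" "z 0 \<in> - cball d R"
  obtains z' where "radial_step z z'" "dist d (z' 0) \<ge> S + 1" "joined (- cball d R) z z'"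
proof (cases "dist d (z 0) \<ge> S + 1")
  case True
  show thesis
    by (rule that[of z])
       (use True joined_refl[OF z far_subset_U(1)] in \<open>auto simp: radial_step_def\<close>)
next
  case False
  define x s where "x = z 0" and "s = (S + 1) / dist d (z 0)"
  have x: "R < dist d x" "dist d x < S + 1" using z(2) False by (auto simp: x_def)
  have s: "s > 1" "s * dist d x = S + 1"
    using x radii unfolding s_def x_def[symmetric] by (auto simp: less_divide_eq)
  define y where "y = d + of_real s * (x - d)"
  have img: "path_image (linepath x y) \<subseteq> cball d (S + 1) - cball d R"
  proof
    fix v assume "v \<in> path_image (linepath x y)"
    then obtain t where t: "0 \<le> t" "t \<le> 1" "v = (1 - t) *\<^sub>R x + t *\<^sub>R y"
      by (auto simp: closed_segment_def)
    have "v - d = of_real (1 - t + t * s) * (x - d)"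
      by (simp add: t(3) y_def scaleR_conv_of_real algebra_simps)
    moreover have ts: "1 \<le> 1 - t + t * s" "1 - t + t * s \<le> s"
      using t s mult_left_mono[of 1 s t] mult_left_mono[of 0 "s - 1" "1 - t"] by (auto simp: algebra_simps)
    ultimately have "dist d v = (1 - t + t * s) * dist d x"
      by (metis abs_of_pos dist_commute dist_norm less_le_trans norm_mult norm_of_real zero_less_one)
    moreover have "dist d x \<le> (1 - t + t * s) * dist d x" "(1 - t + t * s) * dist d x \<le> s * dist d x"
      using ts mult_right_mono[of 1 "1 - t + t * s" "dist d x"] mult_right_mono[of "1 - t + t * s" s "dist d x"]
      by auto
    ultimately show "v \<in> cball d (S + 1) - cball d R"
      using x(1) s(2) by simp
  qed
  have imgU: "path_image (linepath x y) \<subseteq> U"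
    using img far_subset_U(1) by blast
  obtain q where q: "tower q" "q 0 = linepath x y" "\<And>n. q n 0 = z n"
    using tower_lift[OF path_linepath imgU z(1)] by (auto simp: x_def linepath_0')
  have q01: "q 0 1 = y" using q(2) by (simp add: linepath_1')
  show thesis
  proof (rule that[of "\<lambda>n. q n 1"])
    show "radial_step z (\<lambda>n. q n 1)"
      unfolding radial_step_def
    proof (intro disjI2 exI[of _ q] conjI)
      show "q 0 = linepath (z 0) (q 0 1)" unfolding q01 by (simp add: q(2) x_def)
      show "path_image (q 0) \<subseteq> cball d (S + 1) - ball d R"
        unfolding q(2) using img by (auto simp: subset_iff)
    qed (use q in auto)
    have "dist y d = s * dist x d"
      using s(1) by (simp add: y_def dist_norm norm_mult)
    then show "dist d (q 0 1) \<ge> S + 1" unfolding q01 using s(2) by (simp add: dist_commute)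
    show "joined (- cball d R) z (\<lambda>n. q n 1)"
      unfolding joined_def
    proof (intro exI[of _ q] conjI)
      show "path_image (q 0) \<subseteq> - cball d R" unfolding q(2) using img by blast
    qed (use q in auto)
  qed
qed

lemma radial_step_close:
  assumes e: "\<epsilon> > 0"
  shows "\<exists>m0. \<forall>z z' m. radial_step z z' \<longrightarrow> m \<ge> m0 \<longrightarrow> norm (z m) \<le> M \<longrightarrow> dist (z' m) (z m) < \<epsilon>"
proof -
  define X where "X = cball d (S + 1) - ball d R"
  have X: "compact X" "X \<subseteq> U"
    using far_subset_U(3) by (auto simp: X_def intro: compact_diff)
  obtain \<delta> where \<delta>: "\<delta> > 0"
    "\<And>M \<epsilon> N. \<epsilon> > 0 \<Longrightarrow> \<exists>m0. \<forall>m\<ge>m0. \<forall>k. continuous_on {0..1} k \<longrightarrow>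
       (\<forall>t\<in>{0..1}. (f ^^ m) (k t) \<in> X) \<longrightarrow>
       (\<forall>s\<in>{0..1}. \<forall>t\<in>{0..1}. \<bar>s - t\<bar> \<le> 1 / real (Suc N) \<longrightarrow> dist ((f ^^ m) (k s)) ((f ^^ m) (k t)) < \<delta>) \<longrightarrow>
       norm (k 0) \<le> M \<longrightarrow> (\<forall>t\<in>{0..1}. dist (k t) (k 0) < \<epsilon>)"
    using lifts_shrink[OF X] by metis
  \<comment> \<open>The diameter of the annulus bounds the length of every radial segment;
    \<open>N\<close> then makes its pieces shorter than \<open>\<delta>\<close>.\<close>
  define D where "D = 2 * (S + 1)"
  have D: "D > 0" using radii by (simp add: D_def)
  obtain N :: nat where N: "1 / real (Suc N) < \<delta> / D"
    using nat_approx_posE[of "\<delta> / D"] \<delta>(1) D by (metis divide_pos_pos)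
  obtain m0 where m0: "\<And>m k. m \<ge> m0 \<Longrightarrow> continuous_on {0..1} k \<Longrightarrow>
       (\<forall>t\<in>{0..1}. (f ^^ m) (k t) \<in> X) \<Longrightarrow>
       (\<forall>s\<in>{0..1}. \<forall>t\<in>{0..1}. \<bar>s - t\<bar> \<le> 1 / real (Suc N) \<longrightarrow> dist ((f ^^ m) (k s)) ((f ^^ m) (k t)) < \<delta>) \<Longrightarrow>
       norm (k 0) \<le> M \<Longrightarrow> (\<forall>t\<in>{0..1}. dist (k t) (k 0) < \<epsilon>)"
    using \<delta>(2)[OF e, of N M] by blast
  have "dist (z' m) (z m) < \<epsilon>" if rs: "radial_step z z'" and m: "m \<ge> m0" and M: "norm (z m) \<le> M" for z z' m
  proof (cases "z' = z")
    case False
    then obtain q where q: "tower q" "q 0 = linepath (z 0) (z' 0)" "path_image (q 0) \<subseteq> X"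
        "\<And>n. q n 0 = z n" "\<And>n. q n 1 = z' n"
      using rs unfolding radial_step_def X_def by blast
    have "\<forall>t\<in>{0..1}. dist (q m t) (q m 0) < \<epsilon>"
    proof (rule m0[OF m tower_cont[OF q(1)]])
      show "\<forall>t\<in>{0..1}. (f ^^ m) (q m t) \<in> X"
        using q(3) by (auto simp: tower_iter[OF q(1)] path_image_def)
      show "norm (q m 0) \<le> M" using M q(4) by simp
      show "\<forall>s\<in>{0..1}. \<forall>t\<in>{0..1}. \<bar>s - t\<bar> \<le> 1 / real (Suc N) \<longrightarrow> dist ((f ^^ m) (q m s)) ((f ^^ m) (q m t)) < \<delta>"
      proof (intro ballI impI)
        fix s t :: real assume st: "s \<in> {0..1}" "t \<in> {0..1}" "\<bar>s - t\<bar> \<le> 1 / real (Suc N)"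
        have "z 0 \<in> X" "z' 0 \<in> X"
          using q(2,3) by auto
        then have "dist (z 0) d \<le> S + 1" "dist d (z' 0) \<le> S + 1" by (auto simp: X_def dist_commute)
        then have zz: "norm (z 0 - z' 0) \<le> D"
          using order_trans[OF dist_triangle add_mono, of "z 0" d "S + 1" "z' 0" "S + 1"]
          by (simp add: D_def dist_norm)
        have "q 0 s - q 0 t = (t - s) *\<^sub>R (z 0 - z' 0)"
          by (simp add: q(2) linepath_def algebra_simps)
        then have "dist (q 0 s) (q 0 t) = \<bar>s - t\<bar> * norm (z 0 - z' 0)"
          by (simp add: dist_norm abs_minus_commute)
        also have "\<dots> \<le> 1 / real (Suc N) * D"
          using st(3) zz by (intro mult_mono) auto
        also have "\<dots> < \<delta>" using N D by (simp add: less_divide_eq)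
        finally show "dist ((f ^^ m) (q m s)) ((f ^^ m) (q m t)) < \<delta>"
          using st by (simp add: tower_iter[OF q(1)])
      qed
    qed
    from bspec[OF this, of 1] show ?thesis by (simp add: q(4,5))
  qed (use e in simp)
  then show ?thesis by blast
qed

text \<open>A path in \<open>U\<close> from the start of the orbit of
  \<open>exists_backward_orbit\<close> to radius \<open>S + 1\<close> provides \<open>W 0\<close>.
  Each shift leaves the base beyond \<open>R\<close>, and the radial move restores radius at least
  \<open>S + 1\<close>.\<close>

lemma radial_sequence:
  obtains W where "\<And>k. orbit (W k)" "\<And>k. W k \<longlonglongrightarrow> z0" "\<And>k. dist d (W k 0) \<ge> S + 1"
    "\<And>k. radial_step (\<lambda>n. W k (Suc n)) (W (Suc k))"
    "\<And>k. joined (- cball d R) (\<lambda>n. W k (Suc n)) (W (Suc k))"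
proof -
  define P where "P = (\<lambda>(k::nat) w. orbit w \<and> w \<longlonglongrightarrow> z0 \<and> dist d (w 0) \<ge> S + 1)"
  have "\<exists>W. \<forall>k. P k (W k) \<and> (radial_step (\<lambda>n. W k (Suc n)) (W (Suc k)) \<and>
      joined (- cball d R) (\<lambda>n. W k (Suc n)) (W (Suc k)))"
  proof (rule dependent_nat_choice)
    obtain z where z: "orbit z" "z 0 \<in> U" "z \<longlonglongrightarrow> z0" using exists_backward_orbit .
    define p where "p = d + of_real (S + 1)"
    have dp: "dist d p = S + 1" using radii by (simp add: p_def dist_norm del: of_real_add)
    have "p \<in> U" using far_in_U dp radii by auto
    then obtain g where g: "path g" "path_image g \<subseteq> U" "pathstart g = z 0" "pathfinish g = p"
      using U z(2) connected_open_path_connected unfolding path_connected_def by metis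
    obtain z' where "joined U z z'" "z' 0 = g 1"
      using joined_along[OF g(1,2) order_refl z(1)] g(3) by (auto simp: pathstart_def)
    then show "\<exists>w. P 0 w"
      using joined_orbit joined_tendsto z(3) g(4) dp by (auto simp: P_def pathfinish_def intro!: exI[of _ z'])
  next
    fix w k assume w: "P k w"
    have ow: "orbit (\<lambda>n. w (Suc n))" using w orbit_shift by (simp add: P_def)
    have "f (w (Suc 0)) = w 0" using w by (simp add: P_def orbit_def)
    then have "w (Suc 0) \<in> - cball d R"
      using preimage_far w by (force simp: P_def)
    then obtain w' where w': "radial_step (\<lambda>n. w (Suc n)) w'" "dist d (w' 0) \<ge> S + 1" "joined (- cball d R) (\<lambda>n. w (Suc n)) w'"
      using radial_step_exists[OF ow] by auto
    have "(\<lambda>n. w (Suc n)) \<longlonglongrightarrow> z0" using w by (simp add: P_def LIMSEQ_Suc)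
    then have "w' \<longlonglongrightarrow> z0" using joined_tendsto[OF w'(3)] by blast
    then show "\<exists>w'. P (Suc k) w' \<and> (radial_step (\<lambda>n. w (Suc n)) w' \<and> joined (- cball d R) (\<lambda>n. w (Suc n)) w')"
      using w' joined_orbit(2)[OF w'(3)] by (auto simp: P_def)
  qed
  then show thesis using that unfolding P_def by metis
qed

text \<open>Shifting lowers the time at which a backward orbit settles near \<^term>\<open>z0\<close> by one, whereas a
  radial step changes its late points very little; after \<open>J + 1\<close> rounds the first effect
  dominates, so the settling times are bounded.\<close>

lemma bounded_settling_time:
  assumes W: "\<And>k. orbit (W k)" "\<And>k. W k \<longlonglongrightarrow> z0" "\<And>k. dist d (W k 0) \<ge> S + 1"
    "\<And>k. radial_step (\<lambda>n. W k (Suc n)) (W (Suc k))"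
  obtains H where "\<And>k m. m \<ge> H \<Longrightarrow> W k m \<in> cball z0 (\<rho> / 2)"
proof -
  have \<rho>4: "\<rho> / 4 > 0" using \<rho>_pos by simp
  obtain J where J: "\<And>z n m. orbit z \<Longrightarrow> (\<And>m. m \<ge> n \<Longrightarrow> z m \<in> ball z0 \<rho>) \<Longrightarrow> z 0 \<notin> ball z0 \<rho> \<Longrightarrow>
     m \<ge> n + J \<Longrightarrow> z m \<in> ball z0 (\<rho> / 4)"
    using uniform_approach[OF \<rho>4] by metis
  \<comment> \<open>\<open>Suc J\<close> radial moves together displace a late point by at most
    \<open>\<rho> / 4\<close>. As \<open>J\<close> brings such points within
    \<open>\<rho> / 4\<close> of \<open>z0\<close>, they end within \<open>\<rho> / 2\<close>, the
    radius of \<open>stays\<close>.\<close>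
  define \<epsilon> where "\<epsilon> = \<rho> / 4 / real (Suc J)"
  have \<epsilon>: "\<epsilon> > 0" using \<rho>_pos by (simp add: \<epsilon>_def)
  have J\<epsilon>: "real (Suc J) * \<epsilon> = \<rho> / 4" by (simp add: \<epsilon>_def del: of_nat_Suc)
  obtain m0 where m0: "\<And>z z' m. radial_step z z' \<Longrightarrow> m \<ge> m0 \<Longrightarrow> norm (z m) \<le> norm z0 + \<rho> \<Longrightarrow> dist (z' m) (z m) < \<epsilon>"
    using radial_step_close[OF \<epsilon>] by metis
  define stays where "stays = (\<lambda>k n. \<forall>m\<ge>n. W k m \<in> cball z0 (\<rho> / 2))"
  \<comment> \<open>Entry \<open>m\<close> after \<open>Suc J\<close> rounds stems from entry
    \<open>m + Suc J\<close> before them, where \<open>uniform_approach\<close> has taken effect.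
    The settling time does not grow, except up to \<open>m0\<close>, below which radial moves are
    not controlled.\<close>
  have step: "stays (k + Suc J) (max m0 n)" if st: "stays k n" for k n
    unfolding stays_def
  proof (intro allI impI)
    fix m assume m: "m \<ge> max m0 n"
    have "W k (m + Suc J) \<in> ball z0 (\<rho> / 4)"
    proof (rule J[OF W(1), of n])
      show "W k m \<in> ball z0 \<rho>" if "m \<ge> n" for m
        using st that \<rho>_pos by (force simp: stays_def)
      show "W k 0 \<notin> ball z0 \<rho>" using W(3)[of k] near_ball radii by force
    qed (use m in simp)
    then have d0: "dist (W k (m + Suc J)) z0 \<le> \<rho> / 4" by (simp add: dist_commute)
    have "dist (W (k + i) (m + Suc J - i)) z0 \<le> \<rho> / 4 + real i * \<epsilon>" if "i \<le> Suc J" for i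
      using that
    proof (induction i)
      case (Suc i)
      define a where "a = m + Suc J - Suc i"
      have a: "m + Suc J - i = Suc a" "a \<ge> m0" using Suc.prems m by (auto simp: a_def)
      have IH: "dist (W (k + i) (Suc a)) z0 \<le> \<rho> / 4 + real i * \<epsilon>" using Suc a by simp
      have "real i * \<epsilon> \<le> real (Suc J) * \<epsilon>" using Suc.prems \<epsilon> by (intro mult_right_mono) auto
      also have "\<dots> = \<rho> / 4" by (rule J\<epsilon>)
      finally have "dist (W (k + i) (Suc a)) z0 \<le> \<rho>" using IH \<rho>_pos by linarith
      then have "norm (W (k + i) (Suc a)) \<le> norm z0 + \<rho>"
        using norm_triangle_ineq2[of "W (k + i) (Suc a)" z0] by (simp add: dist_norm)
      from m0[OF W(4) a(2), OF this] have "dist (W (Suc (k + i)) a) (W (k + i) (Suc a)) < \<epsilon>" .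
      then have "dist (W (Suc (k + i)) a) z0 \<le> \<epsilon> + (\<rho> / 4 + real i * \<epsilon>)"
        using IH dist_triangle[of "W (Suc (k + i)) a" z0 "W (k + i) (Suc a)"] by linarith
      then show ?case by (simp add: a_def algebra_simps)
    qed (use d0 in simp)
    from this[of "Suc J"] have "dist (W (k + Suc J) m) z0 \<le> \<rho> / 4 + \<rho> / 4"
      unfolding J\<epsilon> by simp
    then show "W (k + Suc J) m \<in> cball z0 (\<rho> / 2)" by (simp add: dist_commute)
  qed
  have "\<exists>n. stays k n" for k
  proof -
    have "\<rho> / 2 > 0" using \<rho>_pos by simp
    from metric_LIMSEQ_D[OF W(2)[of k] this] show ?thesis
      by (force simp: stays_def dist_commute intro: less_imp_le)
  qed
  then obtain n where n: "\<And>k. stays k (n k)" by metis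
  \<comment> \<open>The induction proceeds in steps of \<open>Suc J\<close>, so the first
    \<open>Suc J\<close> settling times have to be covered.\<close>
  define H where "H = Max (insert m0 (n ` {..J}))"
  have H: "m0 \<le> H" "\<And>k. k \<le> J \<Longrightarrow> n k \<le> H" unfolding H_def by (auto intro!: Max_ge simp del: Max_insert)
  have mono: "stays k b" if "stays k a" "a \<le> b" for k a b
    using that by (auto simp: stays_def)
  have "stays k H" for k
  proof (induction k rule: less_induct)
    case (less k)
    show ?case
    proof (cases "k \<le> J")
      case True then show ?thesis using mono[OF n H(2)] by blast
    next
      case False
      then have "k - Suc J < k" "k - Suc J + Suc J = k" by auto
      then have "stays k (max m0 H)" using step[of "k - Suc J" H] less by simp
      then show ?thesis using mono H(1) by simp
    qed
  qed
  then show thesis using that by (auto simp: stays_def)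
qed

text \<open>Convergence of the single entry \<open>H\<close> along a subsequence suffices: earlier
  entries are its forward images, and later ones arise from the continuous inverse of
  \<open>f\<close> on the compact ball where all orbits have settled.\<close>

lemma limit_orbit:
  assumes W: "\<And>k. orbit (W k)" "\<And>k. dist d (W k 0) \<ge> S + 1"
    and H: "\<And>k m. m \<ge> H \<Longrightarrow> W k m \<in> cball z0 (\<rho> / 2)"
  obtains \<sigma> z where "strict_mono (\<sigma> :: nat \<Rightarrow> nat)" "\<And>m. (\<lambda>k. W (\<sigma> k) m) \<longlonglongrightarrow> z m"
    "orbit z" "z \<longlonglongrightarrow> z0" "dist d (z 0) \<ge> S + 1" "\<And>m. m \<ge> H \<Longrightarrow> z m \<in> cball z0 (\<rho> / 2)"
proof -
  define B where "B = cball z0 (\<rho> / 2)"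
  have B: "compact B" "B \<subseteq> ball z0 \<rho>" using \<rho>_pos by (auto simp: B_def cball_subset_ball_iff)
  have injB: "inj_on f B" using inj B(2) inj_on_subset by blast
  obtain \<sigma> y where \<sigma>: "strict_mono (\<sigma> :: nat \<Rightarrow> nat)" "((\<lambda>k. W k H) \<circ> \<sigma>) \<longlonglongrightarrow> y"
  proof -
    have "\<forall>k. W k H \<in> B" using H by (simp add: B_def)
    then show thesis using B(1) that unfolding compact_def by metis
  qed
  have fW: "f (W k (Suc m)) = W k m" for k m using W(1) by (simp add: orbit_def)
  define \<phi> where "\<phi> = the_inv_into B f"
  have \<phi>: "\<phi> (f x) = x" if "x \<in> B" for x using the_inv_into_f_f[OF injB that] by (simp add: \<phi>_def)
  have cont\<phi>: "continuous_on (f ` B) \<phi>"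
    by (rule continuous_on_inv[OF contf B(1)]) (use \<phi> in auto)
  have conv: "convergent (\<lambda>k. W (\<sigma> k) m)" for m
  proof (cases "m \<le> H")
    case True
    have "W k m = (f ^^ (H - m)) (W k H)" for k
      using orbit_iter[OF W(1)[of k], of "H - m" m] True by simp
    moreover have "(\<lambda>k. (f ^^ (H - m)) (W (\<sigma> k) H)) \<longlonglongrightarrow> (f ^^ (H - m)) y"
      using isCont_tendsto_compose[OF isCont_iter \<sigma>(2)] by (simp add: o_def)
    ultimately show ?thesis by (auto simp: convergent_def)
  next
    case False
    then have "H \<le> m" by simp
    then show ?thesis
    proof (induction m rule: dec_induct)
      case base then show ?case using \<sigma>(2) by (auto simp: convergent_def o_def)
    next
      case (step m)
      then obtain l where l: "(\<lambda>k. W (\<sigma> k) m) \<longlonglongrightarrow> l" by (auto simp: convergent_def)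
      have inB: "W k (Suc m) \<in> B" for k using H step(1) by (simp add: B_def)
      then have im: "W k m \<in> f ` B" for k using fW by (metis image_eqI)
      have "closed (f ` B)"
        by (intro compact_imp_closed compact_continuous_image contf B)
      then have "l \<in> f ` B" using closed_sequentially[OF _ _ l] im by blast
      then have "(\<lambda>k. \<phi> (W (\<sigma> k) m)) \<longlonglongrightarrow> \<phi> l"
        using continuous_on_tendsto_compose[OF cont\<phi> l] im by simp
      moreover have "\<phi> (W (\<sigma> k) m) = W (\<sigma> k) (Suc m)" for k
        using \<phi>[OF inB] fW by metis
      ultimately show ?case by (auto simp: convergent_def)
    qed
  qed
  define z where "z = (\<lambda>m. lim (\<lambda>k. W (\<sigma> k) m))"
  have lim: "(\<lambda>k. W (\<sigma> k) m) \<longlonglongrightarrow> z m" for m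
    using conv[of m] by (simp add: z_def convergent_LIMSEQ_iff)
  have oz: "orbit z"
    unfolding orbit_def
  proof
    fix m
    have "(\<lambda>k. f (W (\<sigma> k) (Suc m))) \<longlonglongrightarrow> f (z (Suc m))"
      using isCont_tendsto_compose[OF isCont_f lim] .
    then show "f (z (Suc m)) = z m" using fW lim[of m] LIMSEQ_unique by simp
  qed
  have z0far: "dist d (z 0) \<ge> S + 1"
    by (rule LIMSEQ_le_const[OF tendsto_dist[OF tendsto_const lim]]) (use W(2) in auto)
  have zB: "z m \<in> cball z0 (\<rho> / 2)" if "m \<ge> H" for m
    by (rule closed_sequentially[OF closed_cball _ lim]) (use H that in blast)
  have "z 0 \<in> U" using z0far far_in_U radii by auto
  then have "z 0 \<noteq> z0" using z0(2) by auto
  then have "z m \<noteq> z0" for m using orbit_neq_z0[OF oz, of 0 m] by simp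
  then have "z \<longlonglongrightarrow> z0"
    using zB B(2) by (intro orbit_converges[OF oz, of H]) (auto simp: B_def subset_iff)
  with that \<sigma>(1) lim oz z0far zB show thesis by blast
qed

text \<open>Over the unit disc about \<open>z 0\<close>, the branches through the entries of
  \<open>z\<close> carry \<open>z\<close> to a backward orbit over each point. Over
  \<open>W k 0\<close> with \<open>k\<close> large this orbit is \<open>W k\<close>: they share the
  entry \<open>M\<close> because \<open>\<psi> M\<close> has open image, later entries by
  injectivity of \<open>f\<close> near \<open>z0\<close>, earlier ones by applying \<open>f\<close>.
  Base distance \<open>S + 1\<close> keeps the unit disc beyond \<open>S\<close>.\<close>

lemma near_limit_joined:
  assumes W: "\<And>k. orbit (W k)" "\<And>k m. m \<ge> H \<Longrightarrow> W k m \<in> cball z0 (\<rho> / 2)"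
    and lim: "\<And>m. (\<lambda>k. W k m) \<longlonglongrightarrow> z m"
    and z: "orbit z" "z \<longlonglongrightarrow> z0" "dist d (z 0) \<ge> S + 1"
  shows "eventually (\<lambda>k. joined (- cball d S) z (W k)) sequentially"
proof -
  define B where "B = ball (z 0) (1::real)"
  have BS: "B \<subseteq> - cball d S"
  proof
    fix x assume "x \<in> B"
    then show "x \<in> - cball d S"
      using z(3) dist_triangle[of d "z 0" x] by (auto simp: B_def dist_commute)
  qed
  then have BU: "B \<subseteq> U" using far_subset_U by blast
  have "\<exists>\<psi>. branch m B \<psi> \<and> \<psi> (z 0) = z m" for m
  proof -
    have "(f ^^ m) (z m) = z 0" using orbit_iter[OF z(1), of m 0] by simp
    then show ?thesis using branch_exists[of "z 0" 1 "z 0" m "z m"] BU by (auto simp: B_def)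
  qed
  then obtain \<psi> where \<psi>: "\<And>m. branch m B (\<psi> m)" "\<And>m. \<psi> m (z 0) = z m" by metis
  have z0B: "z 0 \<in> B" by (simp add: B_def)
  have contB: "continuous_on B (\<psi> m)" for m
    using \<psi>(1) unfolding branch_def by (blast intro: holomorphic_on_imp_continuous_on)
  have conB: "connected B" by (simp add: B_def)
  have f\<psi>: "f (\<psi> (Suc m) x) = \<psi> m x" if "x \<in> B" for m x
  proof (rule iter_lifts_agree[OF conB _ contB, of "\<lambda>x. f (\<psi> (Suc m) x)" m m "z 0"])
    show "continuous_on B (\<lambda>x. f (\<psi> (Suc m) x))"
      using continuous_on_compose[OF contB contf] by (simp add: o_def)
    show "(f ^^ m) (f (\<psi> (Suc m) x)) = (f ^^ m) (\<psi> m x)" "(f ^^ m) (f (\<psi> (Suc m) x)) \<in> U" if "x \<in> B" for x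
      using \<psi>(1)[of m] \<psi>(1)[of "Suc m"] that BU by (auto simp: branch_def funpow_swap1)
    show "f (\<psi> (Suc m) (z 0)) = \<psi> m (z 0)" using \<psi>(2) z(1) by (simp add: orbit_def)
  qed (use z0B that in auto)
  have join: "joined (- cball d S) z (\<lambda>m. \<psi> m x)" if x: "x \<in> B" for x
    unfolding joined_def
  proof (intro exI[of _ "\<lambda>m. \<psi> m \<circ> linepath (z 0) x"] conjI allI)
    have seg: "path_image (linepath (z 0) x) \<subseteq> B"
      using x z0B by (simp add: B_def closed_segment_subset)
    show "tower (\<lambda>m. \<psi> m \<circ> linepath (z 0) x)"
      unfolding tower_def
    proof (intro allI conjI ballI)
      fix m
      show "path (\<psi> m \<circ> linepath (z 0) x)"
        by (rule path_continuous_image[OF path_linepath continuous_on_subset[OF contB seg]])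
      show "path_image (\<psi> m \<circ> linepath (z 0) x) \<subseteq> U"
        using seg branch_in_U[OF \<psi>(1) BU] by (auto simp: path_image_compose)
      show "f ((\<psi> (Suc m) \<circ> linepath (z 0) x) t) = (\<psi> m \<circ> linepath (z 0) x) t" if "t \<in> {0..1}" for t
        unfolding o_def by (rule f\<psi>) (use seg that in \<open>auto simp: path_image_def\<close>)
    qed
    have "\<psi> 0 y = y" if "y \<in> B" for y using \<psi>(1)[of 0] that by (simp add: branch_def)
    then show "path_image (\<psi> 0 \<circ> linepath (z 0) x) \<subseteq> - cball d S"
      using seg BS unfolding path_image_compose by (simp add: subset_iff)
    show "(\<psi> m \<circ> linepath (z 0) x) 0 = z m" "(\<psi> m \<circ> linepath (z 0) x) 1 = \<psi> m x" for m
      using \<psi>(2) by (auto simp: linepath_0' linepath_1')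
  qed
  obtain m0 where m0: "\<And>m x. m \<ge> m0 \<Longrightarrow> norm (z m) \<le> norm z0 + \<rho> \<Longrightarrow> x \<in> cball (z 0) (1/4) \<Longrightarrow> dist (\<psi> m x) (z m) < \<rho> / 2"
  proof -
    have b: "ball (z 0) 1 \<subseteq> U" using BU by (simp add: B_def)
    obtain m0 where m0: "\<And>m \<psi> w x x'. m \<ge> m0 \<Longrightarrow> branch m (ball (z 0) 1) \<psi> \<Longrightarrow> w \<in> cball (z 0) (1/4) \<Longrightarrow> norm (\<psi> w) \<le> norm z0 + \<rho> \<Longrightarrow>
     x \<in> cball (z 0) (1/4) \<Longrightarrow> x' \<in> cball (z 0) (1/4) \<Longrightarrow> dist (\<psi> x) (\<psi> x') < \<rho> / 2"
      using branches_shrink[OF zero_less_one b, of "\<rho>/2" "norm z0 + \<rho>"] \<rho>_pos by auto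
    show thesis
      using m0[of _ "\<psi> _" "z 0" _ "z 0"] \<psi> by (intro that[of m0]) (auto simp: B_def)
  qed
  have "\<rho> / 2 > 0" using \<rho>_pos by simp
  from metric_LIMSEQ_D[OF z(2) this] obtain m1 where m1: "\<And>m. m \<ge> m1 \<Longrightarrow> dist (z m) z0 < \<rho> / 2" by blast
  define M where "M = max (max m0 m1) H"
  have opM: "open (\<psi> M ` B)"
  proof (rule open_mapping_thm3)
    show "\<psi> M holomorphic_on B" "open B" using \<psi>(1) by (auto simp: branch_def B_def)
    show "inj_on (\<psi> M) B" using \<psi>(1)[of M] unfolding branch_def by (metis inj_onI)
  qed
  have "z M \<in> \<psi> M ` B" using \<psi>(2) z0B by (metis image_eqI)
  then have "eventually (\<lambda>k. W k M \<in> \<psi> M ` B) sequentially"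
    using topological_tendstoD[OF lim opM] by blast
  moreover have "eventually (\<lambda>k. dist (W k 0) (z 0) < 1/4) sequentially"
    by (rule tendstoD[OF lim]) simp
  ultimately show ?thesis
  proof eventually_elim
    case (elim k)
    define x where "x = W k 0"
    have x: "x \<in> cball (z 0) (1/4)" "x \<in> B" using elim(2) by (auto simp: x_def B_def dist_commute)
    have fM: "(f ^^ m) (W k m) = x" for m using orbit_iter[OF W(1), of m k 0] by (simp add: x_def)
    have eqM: "W k M = \<psi> M x"
    proof -
      obtain x' where x': "x' \<in> B" "W k M = \<psi> M x'" using elim(1) by auto
      then have "x' = x" using \<psi>(1)[of M] fM[of M] by (auto simp: branch_def)
      then show ?thesis using x' by simp
    qed
    have inball: "\<psi> m x \<in> ball z0 \<rho>" if "m \<ge> M" for m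
    proof -
      have z1: "dist (z m) z0 < \<rho> / 2" using m1 that by (simp add: M_def)
      then have "norm (z m) \<le> norm z0 + \<rho>"
        using norm_triangle_ineq2[of "z m" z0] \<rho>_pos unfolding dist_norm by linarith
      then have "dist (\<psi> m x) (z m) < \<rho> / 2" using m0 x that by (simp add: M_def)
      then show ?thesis using z1 dist_triangle[of "\<psi> m x" z0 "z m"] by (simp add: dist_commute)
    qed
    have "W k m = \<psi> m x" if "m \<ge> M" for m
      using that
    proof (induction m rule: dec_induct)
      case (step m)
      have "f (W k (Suc m)) = f (\<psi> (Suc m) x)"
        using step W(1)[of k] f\<psi>[OF x(2)] by (simp add: orbit_def)
      moreover have "W k (Suc m) \<in> ball z0 \<rho>"
        using W(2)[of "Suc m" k] step(1) \<rho>_pos by (force simp: M_def)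
      ultimately show ?case using inj_onD[OF inj] inball[of "Suc m"] step(1) by simp
    qed (rule eqM)
    moreover have "W k m = \<psi> m x" if "m \<le> M" for m
    proof -
      have "(f ^^ (M - m)) (\<psi> M x) = \<psi> m x"
      proof -
        have "(f ^^ i) (\<psi> (m + i) x) = \<psi> m x" for i
          by (induction i) (auto simp: funpow_swap1 f\<psi>[OF x(2)])
        from this[of "M - m"] that show ?thesis by simp
      qed
      moreover have "(f ^^ (M - m)) (W k M) = W k m"
        using orbit_iter[OF W(1), of "M - m" k m] that by simp
      ultimately show ?thesis using eqM by simp
    qed
    ultimately have "W k = (\<lambda>m. \<psi> m x)" using linear by blast
    then show "joined (- cball d S) z (W k)" using join[OF x(2)] by simp
  qed
qed

theorem periodic_orbit_classes:
  obtains n w where "n \<ge> (1::nat)" "\<And>k. w (k + n) = w k" "\<And>k. orbit (w k)" "\<And>k. w k \<longlonglongrightarrow> z0"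
    "\<And>k. dist d (w k 0) > S" "\<And>k. joined (- cball d R) (\<lambda>j. w k (Suc j)) (w (Suc k))"
proof -
  obtain W where W: "\<And>k. orbit (W k)" "\<And>k. W k \<longlonglongrightarrow> z0" "\<And>k. dist d (W k 0) \<ge> S + 1"
    "\<And>k. radial_step (\<lambda>n. W k (Suc n)) (W (Suc k))"
    "\<And>k. joined (- cball d R) (\<lambda>n. W k (Suc n)) (W (Suc k))"
    using radial_sequence by metis
  obtain H where H: "\<And>k m. m \<ge> H \<Longrightarrow> W k m \<in> cball z0 (\<rho> / 2)"
  proof (rule bounded_settling_time)
    show "orbit (W k)" "W k \<longlonglongrightarrow> z0" "S + 1 \<le> dist d (W k 0)"
      "radial_step (\<lambda>n. W k (Suc n)) (W (Suc k))" for k by (fact W)+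
  qed blast
  obtain \<sigma> z where \<sigma>: "strict_mono (\<sigma> :: nat \<Rightarrow> nat)" "\<And>m. (\<lambda>k. W (\<sigma> k) m) \<longlonglongrightarrow> z m"
    "orbit z" "z \<longlonglongrightarrow> z0" "dist d (z 0) \<ge> S + 1"
  proof (rule limit_orbit[of W H])
    show "orbit (W k)" "S + 1 \<le> dist d (W k 0)" for k by (fact W)+
    show "W k m \<in> cball z0 (\<rho> / 2)" if "m \<ge> H" for k m by (rule H[OF that])
  qed blast
  have "eventually (\<lambda>k. joined (- cball d S) z (W (\<sigma> k))) sequentially"
    by (rule near_limit_joined[OF W(1) H \<sigma>(2-5)])
  then obtain k0 where k0: "\<And>k. k \<ge> k0 \<Longrightarrow> joined (- cball d S) z (W (\<sigma> k))"
    by (auto simp: eventually_sequentially)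
  define i n where "i = \<sigma> k0" and "n = \<sigma> (Suc k0) - \<sigma> k0"
  have n: "n \<ge> 1" "\<sigma> (Suc k0) = i + n"
    using strict_monoD[OF \<sigma>(1), of k0 "Suc k0"] by (auto simp: n_def i_def)
  have "joined (- cball d S) (W (i + n)) (W i)"
    using joined_trans[OF joined_sym[OF k0[of "Suc k0"]] k0[of k0]] by (simp add: n(2) i_def)
  then have close: "joined (- cball d R) (W (i + n)) (W i)"
    by (rule joined_mono) (use radii in auto)
  show thesis
  \<comment> \<open>Two consecutive terms of the subsequence close up the sequence, so indices are
    read modulo \<open>n\<close>. At the wrap-around the shift is joined to \<open>W (i + n)\<close>
    and hence to \<open>W i\<close>.\<close>
  proof (rule that[of n "\<lambda>k. W (i + k mod n)"])
    fix k
    show "joined (- cball d R) (\<lambda>j. W (i + k mod n) (Suc j)) (W (i + Suc k mod n))"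
    proof (cases "Suc (k mod n) = n")
      case True
      then have "Suc k mod n = 0" by (simp add: mod_Suc)
      then show ?thesis
        using joined_trans[OF W(5)[of "i + k mod n"]] close True by (simp flip: add_Suc_right)
    next
      case False
      then have "Suc k mod n = Suc (k mod n)" by (simp add: mod_Suc)
      then show ?thesis using W(5)[of "i + k mod n"] by simp
    qed
    show "dist d (W (i + k mod n) 0) > S" using W(3)[of "i + k mod n"] by linarith
  qed (use n W in auto)
qed

end

section \<open>Topology of exteriors and slit exteriors\<close>

text \<open>Every point of the preimage can be joined to \<open>H\<close>: a path in
  \<open>X\<close> to \<open>x1\<close> lifts through the exponential, and all logarithms of
  \<open>x1\<close> lie in the convex set \<open>H\<close>.\<close>

lemma connected_exp_vimage:
  fixes d :: complex
  assumes X: "open X" "connected X" "d \<notin> X" and H: "convex H" "(\<lambda>\<zeta>. d + exp \<zeta>) ` H \<subseteq> X"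
    and x1: "x1 \<in> X" "\<And>\<zeta>. d + exp \<zeta> = x1 \<Longrightarrow> \<zeta> \<in> H"
  shows "connected ((\<lambda>\<zeta>. d + exp \<zeta>) -` X)"
proof -
  define e where "e = (\<lambda>\<zeta>. d + exp \<zeta>)"
  have HY: "H \<subseteq> e -` X" using H(2) by (auto simp: e_def)
  have reach: "\<exists>\<zeta>'\<in>H. path_component (e -` X) \<zeta> \<zeta>'" if \<zeta>: "\<zeta> \<in> e -` X" for \<zeta>
  proof -
    have "path_connected X" using X(1,2) connected_open_path_connected by blast
    then obtain p where p: "path p" "path_image p \<subseteq> X" "pathstart p = e \<zeta>" "pathfinish p = x1"
      using \<zeta> x1(1) unfolding path_connected_def by (metis vimage_eq)
    define g where "g = (\<lambda>t. p t - d)"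
    have "path g" unfolding g_def using p(1) by (auto simp: path_def intro: continuous_intros)
    moreover have "path_image g \<subseteq> - {0}" using p(2) X(3) by (auto simp: g_def path_image_def)
    moreover have "pathstart g = exp \<zeta>" using p(3) by (simp add: g_def pathstart_def e_def)
    ultimately obtain h where h: "path h" "pathstart h = \<zeta>" "\<And>t. t \<in> {0..1} \<Longrightarrow> exp (h t) = g t"
      using covering_space_lift_path_strong[OF covering_space_exp_punctured_plane UNIV_I] by metis
    have eh: "e (h t) = p t" if "t \<in> {0..1}" for t using h(3)[OF that] by (simp add: e_def g_def)
    have "pathfinish h \<in> H"
      using x1(2)[of "pathfinish h"] eh[of 1] p(4) by (simp add: pathfinish_def e_def)
    moreover have "path_component (e -` X) \<zeta> (pathfinish h)"
      unfolding path_component_def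
      using h(1,2) eh p(2) by (intro exI[of _ h]) (auto simp: path_image_def)
    ultimately show ?thesis by blast
  qed
  have "path_component (e -` X) a b" if ab: "a \<in> e -` X" "b \<in> e -` X" for a b
  proof -
    obtain a' b' where a': "a' \<in> H" "path_component (e -` X) a a'" and b': "b' \<in> H" "path_component (e -` X) b b'"
      using reach ab by metis
    have "path_component H a' b'"
      using a' b' H(1) convex_imp_path_connected path_connected_component by blast
    then have "path_component (e -` X) a' b'" using HY path_component_of_subset by blast
    then show ?thesis using a' b' path_component_trans path_component_sym by metis
  qed
  then have "path_connected (e -` X)" using path_connected_component by blast
  then show ?thesis unfolding e_def by (rule path_connected_imp_connected)
qed

text \<open>The universal cover of the exterior, in logarithmic coordinates. Its complement is the
  preimage of \<open>closure D\<close>, which contains a left half-plane and is connected and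
  unbounded; an open connected set with such a complement is simply connected.\<close>

lemma simply_connected_exp_vimage_exterior:
  fixes d :: complex
  assumes D: "open D" "connected D" "d \<in> D" and A: "connected (- closure D)" and r: "closure D \<subseteq> ball d r"
  shows "simply_connected ((\<lambda>\<zeta>. d + exp \<zeta>) -` (- closure D))"
proof -
  define e where "e = (\<lambda>\<zeta>. d + exp \<zeta>)"
  have conte: "isCont e \<zeta>" for \<zeta> unfolding e_def by (intro continuous_intros)
  have r0: "r > 0" using r D(3) closure_subset by fastforce
  have de: "dist d (e \<zeta>) = exp (Re \<zeta>)" for \<zeta> by (simp add: e_def dist_norm)
  have "connected (e -` (- closure D))"
    unfolding e_def
  proof (rule connected_exp_vimage[where H = "{\<zeta>. Re \<zeta> > ln r}" and ?x1.0 = "d + of_real (r + 1)"])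
    show "open (- closure D)" by (simp add: open_Compl)
    show "convex {\<zeta>. Re \<zeta> > ln r}" by (rule convex_halfspace_Re_gt)
    have far: "x \<in> - closure D" if "dist d x > r" for x using r that by force
    show "(\<lambda>\<zeta>. d + exp \<zeta>) ` {\<zeta>. Re \<zeta> > ln r} \<subseteq> - closure D"
    proof safe
      fix \<zeta> assume "ln r < Re \<zeta>" "d + exp \<zeta> \<in> closure D"
      moreover from this(1) have "r < exp (Re \<zeta>)" using r0 by (metis exp_less_mono exp_ln)
      ultimately show False using far[of "e \<zeta>"] de[of \<zeta>] by (simp add: e_def)
    qed
    show "d + of_real (r + 1) \<in> - closure D"
      using r0 by (intro far) (simp add: dist_norm del: of_real_add)
    show "\<zeta> \<in> {\<zeta>. Re \<zeta> > ln r}" if "d + exp \<zeta> = d + of_real (r + 1)" for \<zeta>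
    proof -
      have "exp (Re \<zeta>) = r + 1" using that r0 by (metis abs_of_pos add_left_cancel norm_exp_eq_Re norm_of_real add_pos_pos zero_less_one)
      then have "r < exp (Re \<zeta>)" by simp
      then show ?thesis using r0 by (metis exp_less_cancel_iff exp_ln mem_Collect_eq)
    qed
  qed (use A D(3) closure_subset in auto)
  moreover have "connected (e -` closure D)" "\<not> bounded (e -` closure D)"
  proof -
    obtain s where s: "s > 0" "ball d s \<subseteq> D" using D by (metis openE)
    have near: "e \<zeta> \<in> D - {d}" if "Re \<zeta> < ln s" for \<zeta>
    proof -
      have "exp (Re \<zeta>) < s" using that s(1) by (metis exp_less_mono exp_ln)
      then show ?thesis using s(2) de[of \<zeta>] by (auto simp: e_def)
    qed
    have c0: "connected (e -` (D - {d}))"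
      unfolding e_def
    proof (rule connected_exp_vimage[where H = "{\<zeta>. Re \<zeta> < ln s}" and ?x1.0 = "d + of_real (s / 2)"])
      show "open (D - {d})" using D by auto
      show "connected (D - {d})" using D by (simp add: connected_open_delete)
      show "convex {\<zeta>. Re \<zeta> < ln s}" by (rule convex_halfspace_Re_lt)
      show "(\<lambda>\<zeta>. d + exp \<zeta>) ` {\<zeta>. Re \<zeta> < ln s} \<subseteq> D - {d}" using near by (auto simp: e_def)
      show "d + of_real (s / 2) \<in> D - {d}" using s by (auto simp: subset_iff dist_norm)
      show "\<zeta> \<in> {\<zeta>. Re \<zeta> < ln s}" if "d + exp \<zeta> = d + of_real (s / 2)" for \<zeta>
      proof -
        have "exp (Re \<zeta>) = s / 2" using that s(1) by (metis abs_of_pos add_left_cancel norm_exp_eq_Re norm_of_real half_gt_zero)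
        then have "exp (Re \<zeta>) < s" using s(1) by simp
        then show ?thesis using s(1) by (metis exp_less_cancel_iff exp_ln mem_Collect_eq)
      qed
    qed simp
    \<comment> \<open>\<open>e\<close> is an open map, so the preimage of a closure lies in the
      closure of the preimage; connectedness passes from \<open>D - {d}\<close> to
      \<open>closure D\<close>.\<close>
    have "e -` closure D \<subseteq> closure (e -` (D - {d}))"
    proof
      fix \<zeta> assume \<zeta>: "\<zeta> \<in> e -` closure D"
      show "\<zeta> \<in> closure (e -` (D - {d}))"
        unfolding closure_approachable
      proof (intro allI impI)
        fix \<epsilon> :: real assume \<epsilon>: "\<epsilon> > 0"
        have "open (e ` ball \<zeta> \<epsilon>)"
        proof (rule open_mapping_thm[of e UNIV])
          show "e holomorphic_on UNIV" unfolding e_def by (intro holomorphic_intros)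
          show "\<not> e constant_on UNIV"
          proof
            assume "e constant_on UNIV"
            then have "e 0 = e 1" by (auto simp: constant_on_def)
            then have "exp (1::real) = 1" by (metis de exp_zero one_complex.sel(1) zero_complex.sel(1))
            then show False by simp
          qed
        qed auto
        moreover have "e \<zeta> \<in> e ` ball \<zeta> \<epsilon> \<inter> closure D" using \<zeta> \<epsilon> by simp
        ultimately have "e ` ball \<zeta> \<epsilon> \<inter> D \<noteq> {}"
          using open_Int_closure_eq_empty by blast
        then obtain \<xi> where \<xi>: "\<xi> \<in> ball \<zeta> \<epsilon>" "e \<xi> \<in> D" by auto
        moreover have "e \<xi> \<noteq> d" by (simp add: e_def)
        ultimately show "\<exists>y\<in>e -` (D - {d}). dist y \<zeta> < \<epsilon>" by (auto simp: dist_commute)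
      qed
    qed
    then show "connected (e -` closure D)"
      using connected_intermediate_closure[OF c0, of "e -` closure D"] closure_subset[of D] by blast
    show "\<not> bounded (e -` closure D)"
    proof
      assume "bounded (e -` closure D)"
      then obtain M where M: "\<And>\<zeta>. \<zeta> \<in> e -` closure D \<Longrightarrow> norm \<zeta> \<le> M" by (auto simp: bounded_iff)
      define \<zeta> where "\<zeta> = complex_of_real (min (ln s - 1) (- \<bar>M\<bar> - 1))"
      have "Re \<zeta> < ln s" by (simp add: \<zeta>_def min_less_iff_disj)
      then have "e \<zeta> \<in> closure D" using near[of \<zeta>] closure_subset by blast
      then have "norm \<zeta> \<le> M" using M by simp
      then show False unfolding \<zeta>_def norm_of_real by linarith
    qed
  qed
  moreover have "- (e -` (- closure D)) = e -` closure D" by auto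
  moreover have "open (e -` (- closure D))"
    by (rule continuous_open_vimage) (use conte in auto)
  ultimately show ?thesis
    unfolding e_def[symmetric]
    using simply_connected_eq_unbounded_complement_components[of "e -` (- closure D)"]
      in_components_self[of "e -` closure D"] components_eq_sing_iff[of "e -` closure D"]
    by (metis bounded_empty singletonD)
qed

text \<open>In logarithmic coordinates the region beyond radius \<open>s\<close> is a half-plane,
  hence convex. The lift of \<open>p\<close> has both ends there and may be replaced by the segment
  between them, because the exterior has become simply connected.\<close>

lemma push_path_outwards:
  fixes d :: complex
  assumes D: "open D" "connected D" "d \<in> D" "connected (- closure D)" "closure D \<subseteq> ball d r"
    and s: "r \<le> s" and p: "path p" "path_image p \<subseteq> - closure D"
    and ends: "dist d (p 0) > s" "dist d (p 1) > s"
  obtains p' where "homotopic_paths (- closure D) p p'" "path_image p' \<subseteq> - cball d s"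
proof -
  define e where "e = (\<lambda>\<zeta>. d + exp \<zeta>)"
  have r0: "r > 0" using D(3,5) closure_subset by fastforce
  then have s0: "s > 0" using s by simp
  have de: "dist d (e \<zeta>) = exp (Re \<zeta>)" for \<zeta> by (simp add: e_def dist_norm)
  have conte: "continuous_on Y e" for Y unfolding e_def by (intro continuous_intros)
  have sc: "simply_connected (e -` (- closure D))"
    unfolding e_def by (rule simply_connected_exp_vimage_exterior[OF D])
  define g where "g = (\<lambda>t. p t - d)"
  have g: "path g" unfolding g_def using p(1) by (auto simp: path_def intro: continuous_intros)
  have "path_image g \<subseteq> - {0}"
  proof -
    have "p t \<noteq> d" if "t \<in> {0..1}" for t
      using that p(2) D(3) closure_subset[of D] unfolding path_image_def by blast
    then show ?thesis by (auto simp: g_def path_image_def)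
  qed
  then obtain h where h: "path h" "\<And>t. t \<in> {0..1} \<Longrightarrow> exp (h t) = g t"
    using covering_space_lift_path[OF covering_space_exp_punctured_plane g] by metis
  have eh: "e (h t) = p t" if "t \<in> {0..1}" for t using h(2)[OF that] by (simp add: e_def g_def)
  define H where "H = {\<zeta>. Re \<zeta> > ln s}"
  have inH: "\<zeta> \<in> H \<longleftrightarrow> dist d (e \<zeta>) > s" for \<zeta>
    unfolding de H_def using s0 by (metis exp_less_cancel_iff exp_ln mem_Collect_eq)
  have "h 0 \<in> H" "h 1 \<in> H" using ends eh[of 0] eh[of 1] by (auto simp: inH)
  then have l: "path_image (linepath (h 0) (h 1)) \<subseteq> H"
    unfolding H_def by (simp add: closed_segment_subset convex_halfspace_Re_gt)
  have HE: "H \<subseteq> e -` (- closure D)"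
    using D(5) s by (auto simp: inH subset_iff)
  have "homotopic_paths (e -` (- closure D)) h (linepath (h 0) (h 1))"
  proof -
    have "path_image h \<subseteq> e -` (- closure D)" using eh p(2) by (auto simp: path_image_def)
    then show ?thesis
      using sc l HE h(1) unfolding simply_connected_eq_homotopic_paths
      by (auto simp: pathstart_def pathfinish_def linepath_0' linepath_1')
  qed
  then have "homotopic_paths (- closure D) (e \<circ> h) (e \<circ> linepath (h 0) (h 1))"
    by (rule homotopic_paths_continuous_image) (use conte in auto)
  moreover have "homotopic_paths (- closure D) p (e \<circ> h)"
    by (rule homotopic_paths_eq[OF p]) (simp add: eh)
  ultimately have "homotopic_paths (- closure D) p (e \<circ> linepath (h 0) (h 1))"
    using homotopic_paths_trans by blast
  moreover have "path_image (e \<circ> linepath (h 0) (h 1)) \<subseteq> - cball d s"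
    using l inH by (auto simp: path_image_compose)
  ultimately show thesis by (rule that)
qed

text \<open>The complement of \<open>W\<close> is connected and, as it contains \<open>X\<close>,
  unbounded.\<close>

lemma simply_connected_complement_component:
  fixes X :: "complex set"
  assumes "closed X" "connected X" "\<not> bounded X" "W \<in> components (- X)"
  shows "simply_connected W"
proof -
  have W: "open W" "connected W"
    using assms open_components in_components_connected by blast+
  have c: "connected (- W)" by (rule component_complement_connected[OF assms(2,4)])
  have "X \<subseteq> - W" using in_components_subset[OF assms(4)] by blast
  then have "\<not> bounded (- W)" using assms(3) bounded_subset by blast
  moreover have "components (- W) \<subseteq> {- W}"
    using c by (metis components_eq_sing_iff components_empty empty_subsetI order_refl)
  ultimately show ?thesis
    using W(2) by (auto simp: simply_connected_eq_unbounded_complement_components[OF W(1)])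
qed

text \<open>A path in \<open>F\<close> between two points of one fibre projects to a loop that is
  null-homotopic in \<open>W\<close>; by monodromy the path was itself closed.\<close>

lemma covering_space_inj_on_simply_connected:
  fixes p :: "'a::real_normed_vector \<Rightarrow> 'b::real_normed_vector"
  assumes cov: "covering_space C p S" and W: "simply_connected W" "W \<subseteq> S"
    and F: "path_connected F" "F \<subseteq> C" "p ` F \<subseteq> W"
  shows "inj_on p F"
proof (rule inj_onI)
  fix x y assume xy: "x \<in> F" "y \<in> F" "p x = p y"
  obtain g where g: "path g" "path_image g \<subseteq> F" "pathstart g = x" "pathfinish g = y"
    using F(1) xy unfolding path_connected_def by blast
  have contp: "continuous_on F p"
    using covering_space_imp_continuous[OF cov] F(2) continuous_on_subset by blast
  have pg: "path (p \<circ> g)" "path_image (p \<circ> g) \<subseteq> W" "pathstart (p \<circ> g) = p x" "pathfinish (p \<circ> g) = p x"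
    using g contp F(3) xy(3)
    by (auto simp: path_image_compose pathstart_compose pathfinish_compose
        intro: path_continuous_image continuous_on_subset)
  then have "homotopic_paths W (p \<circ> g) (linepath (p x) (p x))"
    using W(1) unfolding simply_connected_eq_contractible_path by metis
  then have hom: "homotopic_paths S (p \<circ> g) (linepath (p x) (p x))"
    using W(2) homotopic_paths_subset by blast
  have px: "p x \<in> S" using xy F(3) W(2) by blast
  have "pathfinish g = pathfinish (linepath x x)"
  proof (rule covering_space_monodromy[OF cov pg(1) _ _ _ hom g(1)])
    show "path_image (p \<circ> g) \<subseteq> S" using pg(2) W(2) by blast
    show "path_image g \<subseteq> C" using g(2) F(2) by blast
    show "path_image (linepath (p x) (p x)) \<subseteq> S" "path_image (linepath x x) \<subseteq> C"
      using px xy(1) F(2) by auto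
    show "p (linepath x x t) = linepath (p x) (p x) t" for t by (simp add: linepath_refl)
  qed (use g in auto)
  then show "x = y" using g(4) by simp
qed

section \<open>Fundamental domains\<close>

text \<open>Two coverings are in play: backward orbits are continued over \<open>U\<close>, whereas
  fundamental domains belong to the covering over the exterior of \<open>D\<close>. Both base sets
  contain everything beyond radius \<open>R0\<close>, and the two constructions meet there.\<close>

locale fundamental_domain_setting = expanding_far_annulus +
  fixes D :: "complex set" and \<alpha> :: "real \<Rightarrow> complex"
  assumes D: "open D" "connected D" "d \<in> D" "connected (- closure D)" "closure D \<subseteq> ball d R0"
    and nsD: "(- closure D) \<inter> (critical_values f \<union> asymptotic_values f) = {}"
    and va: "valid_alpha f D \<alpha>"
begin

abbreviation A :: "complex set" where "A \<equiv> - closure D"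
abbreviation Al :: "complex set" where "Al \<equiv> \<alpha> ` {0..}"

definition fund :: "complex \<Rightarrow> complex set" where
  "fund x = connected_component_set (connected_component_set (f -` A) x - f -` Al) x"

lemma far_sub_A: "s \<ge> R0 \<Longrightarrow> - cball d s \<subseteq> A"
  using D(5) by force

lemma open_A: "open A"
  by (simp add: open_Compl)

lemma open_vimage_f: "open X \<Longrightarrow> open (f -` X)"
  using isCont_f by (intro continuous_open_vimage) auto

lemma covA: "covering_space (f -` A) f A"
proof (rule covering_space_of_no_singular_values[OF hol open_A D(4) nsD])
  define y where "y = d + of_real (R0 + 1)"
  have dy: "dist d y = R0 + 1" using radii by (simp add: y_def dist_norm del: of_real_add)
  have "y \<in> U" using dy far_in_U by auto
  then obtain x where "f x = y" using covering_space_imp_surjective[OF cov] by (metis imageE)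
  moreover have "y \<in> A" using dy far_sub_A[of R0] by auto
  ultimately show "f -` A \<noteq> {}" by auto
qed

lemma \<alpha>_large:
  obtains T where "\<And>t. t \<ge> T \<Longrightarrow> c \<le> norm (\<alpha> t)"
proof -
  have "filterlim (\<lambda>t. norm (\<alpha> t)) at_top at_top"
    using va unfolding valid_alpha_def by (blast intro: filterlim_at_infinity_imp_norm_at_top)
  then have "\<forall>\<^sub>F t in at_top. c \<le> norm (\<alpha> t)" unfolding filterlim_at_top by blast
  then show thesis using that by (auto simp: eventually_at_top_linorder)
qed

lemma closed_Al: "closed Al"
proof -
  have "\<exists>e>0. ball y e \<subseteq> - Al" if y: "y \<notin> Al" for y
  proof -
    obtain T where T: "\<And>t. t \<ge> T \<Longrightarrow> norm y + 1 \<le> norm (\<alpha> t)" using \<alpha>_large by blast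
    have "compact (\<alpha> ` {0..T})"
      using va by (intro compact_continuous_image) (auto simp: valid_alpha_def intro: continuous_on_subset)
    then have "open (- \<alpha> ` {0..T})" by (simp add: compact_imp_closed open_Compl)
    moreover have "y \<in> - \<alpha> ` {0..T}" using y by auto
    ultimately obtain e where e: "e > 0" "ball y e \<subseteq> - \<alpha> ` {0..T}" by (metis openE)
    have "ball y (min e 1) \<subseteq> - Al"
    proof (rule subsetI, rule ComplI)
      fix x assume x: "x \<in> ball y (min e 1)" "x \<in> Al"
      then obtain t where t: "t \<in> {0..}" "\<alpha> t \<in> ball y (min e 1)" by auto
      show False
      proof (cases "t \<le> T")
        case True then show ?thesis using e t by auto
      next
        case False
        then have "norm y + 1 \<le> norm (\<alpha> t)" using T by simp
        then show ?thesis
          using t(2) norm_triangle_ineq2[of "\<alpha> t" y] by (simp add: dist_norm norm_minus_commute)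
      qed
    qed
    then show ?thesis using e(1) by (intro exI[of _ "min e 1"]) auto
  qed
  then have "open (- Al)" unfolding open_contains_ball by blast
  then show ?thesis by (simp add: closed_def)
qed

text \<open>With these properties every component of the slit exterior is simply connected, which
  makes \<open>f\<close> injective on fundamental domains.\<close>

lemma barrier: "closed (closure D \<union> Al)" "connected (closure D \<union> Al)" "\<not> bounded (closure D \<union> Al)"
proof -
  show "closed (closure D \<union> Al)" using closed_Al by blast
  have "connected Al"
    using va by (intro connected_continuous_image) (auto simp: valid_alpha_def)
  moreover have "\<alpha> 0 \<in> closure D \<inter> Al" using va by (auto simp: valid_alpha_def frontier_def)
  ultimately show "connected (closure D \<union> Al)"
    using connected_Un[of "closure D" Al] connected_imp_connected_closure[OF D(2)] by blast
  show "\<not> bounded (closure D \<union> Al)"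
  proof
    assume "bounded (closure D \<union> Al)"
    then obtain M where M: "\<And>x. x \<in> Al \<Longrightarrow> norm x \<le> M" by (auto simp: bounded_iff)
    obtain T where T: "\<And>t. t \<ge> T \<Longrightarrow> M + 1 \<le> norm (\<alpha> t)" using \<alpha>_large by blast
    have "norm (\<alpha> (max T 0)) \<le> M" by (intro M) auto
    then show False using T[of "max T 0"] by simp
  qed
qed

lemma preimage_A_notin_Al: "f x \<in> A \<Longrightarrow> x \<notin> Al"
proof -
  assume x: "f x \<in> A"
  then have "connected_component_set (f -` A) x \<in> tracts f D"
    unfolding tracts_def by (intro componentsI) simp
  moreover have "x \<in> connected_component_set (f -` A) x" using x by simp
  moreover have "\<forall>T\<in>tracts f D. T \<inter> Al = {}" using va by (simp add: valid_alpha_def)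
  ultimately show "x \<notin> Al" by (metis IntI empty_iff)
qed

text \<open>The slit meets no tract, so a point whose image lies beyond \<open>S\<close> avoids it
  automatically. Paths in this preimage are admissible for the classes \<open>cls\<close>
  below.\<close>

lemma preimage_far_subset: "f -` (- cball d S) \<subseteq> - cball d R - Al"
proof
  fix x assume x: "x \<in> f -` (- cball d S)"
  then have "f x \<in> A" using far_sub_A[of S] radii by auto
  then show "x \<in> - cball d R - Al" using x preimage_far preimage_A_notin_Al by blast
qed

lemma fund_mem:
  assumes "f x \<in> A" "f x \<notin> Al"
  shows "fund x \<in> fundamental_domains f D \<alpha>" "x \<in> fund x"
proof -
  have "connected_component_set (f -` A) x \<in> tracts f D"
    unfolding tracts_def using assms by (intro componentsI) simp
  moreover have x: "x \<in> connected_component_set (f -` A) x - f -` Al" using assms by simp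
  then have "fund x \<in> components (connected_component_set (f -` A) x - f -` Al)"
    unfolding fund_def by (rule componentsI)
  ultimately show "fund x \<in> fundamental_domains f D \<alpha>" unfolding fundamental_domains_def by blast
  show "x \<in> fund x" using x by (simp add: fund_def)
qed

lemma fund_sub: "fund x \<subseteq> f -` A" "fund x \<subseteq> - f -` Al"
  using connected_component_subset[of "connected_component_set (f -` A) x - f -` Al" x]
    connected_component_subset[of "f -` A" x]
  unfolding fund_def by blast+

lemma path_connected_fund: "path_connected (fund x)"
proof -
  have "open (connected_component_set (f -` A) x - f -` Al)"
    using open_vimage_f[OF open_A] open_vimage_f[of "- Al"] closed_Al
    by (simp add: Diff_eq open_Int open_connected_component open_Compl vimage_Compl)
  then have "open (fund x)" unfolding fund_def by (rule open_connected_component)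
  then show ?thesis
    by (intro connected_open_path_connected) (auto simp: fund_def)
qed

text \<open>\<open>f\<close> maps a fundamental domain into one component of the slit exterior,
  which is simply connected and lies in the base of the covering over \<open>A\<close>.\<close>

lemma inj_on_fund: "inj_on f (fund x)"
proof (cases "fund x = {}")
  case False
  then obtain y where y: "y \<in> fund x" by blast
  define W where "W = connected_component_set (- (closure D \<union> Al)) (f y)"
  have fy: "f y \<in> - (closure D \<union> Al)" using y fund_sub by blast
  have "W \<in> components (- (closure D \<union> Al))" unfolding W_def using fy by (rule componentsI)
  then have "simply_connected W" by (rule simply_connected_complement_component[OF barrier])
  moreover have "W \<subseteq> A" using connected_component_subset[of "- (closure D \<union> Al)"] by (auto simp: W_def)
  moreover have "f ` fund x \<subseteq> W"
    unfolding W_def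
  proof (rule connected_component_maximal)
    show "connected (f ` fund x)"
      by (rule connected_continuous_image[OF contf]) (auto simp: fund_def)
    show "f y \<in> f ` fund x" using y by blast
    show "f ` fund x \<subseteq> - (closure D \<union> Al)"
    proof (rule image_subsetI)
      fix v assume v: "v \<in> fund x"
      have "f v \<in> A" using subsetD[OF fund_sub(1) v] by simp
      moreover have "f v \<notin> Al" using subsetD[OF fund_sub(2) v] unfolding Compl_iff vimage_eq .
      ultimately show "f v \<in> - (closure D \<union> Al)" by simp
    qed
  qed
  ultimately show ?thesis
    using covering_space_inj_on_simply_connected[OF covA _ _ path_connected_fund fund_sub(1)] by blast
qed simp

lemma mem_fund_of_connected:
  assumes "connected Y" "x \<in> Y" "y \<in> Y" "Y \<subseteq> f -` (A - Al)"
  shows "y \<in> fund x"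
proof -
  have "Y \<subseteq> connected_component_set (f -` A) x"
    using assms by (intro connected_component_maximal) auto
  then have "Y \<subseteq> fund x"
    unfolding fund_def using assms by (intro connected_component_maximal) auto
  then show ?thesis using assms(3) by blast
qed

text \<open>The image of a path inside the fundamental domain need not stay far out. It is pushed
  outwards in \<open>A\<close> by a homotopy and lifted back; the lift may leave the domain but
  keeps its endpoints.\<close>

lemma far_path_in_fund:
  assumes y: "y \<in> fund x" "y' \<in> fund x" and far: "f y \<in> - cball d S" "f y' \<in> - cball d S"
  obtains p where "path p" "path_image p \<subseteq> f -` (- cball d S)" "p 0 = y" "p 1 = y'"
proof -
  obtain g where g: "path g" "path_image g \<subseteq> fund x" "pathstart g = y" "pathfinish g = y'"
    using path_connected_fund y unfolding path_connected_def by metis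
  have gA: "path_image g \<subseteq> f -` A" using g(2) fund_sub(1) by blast
  have fg: "path (f \<circ> g)" "path_image (f \<circ> g) \<subseteq> A"
    using g(1) gA by (auto simp: path_image_compose intro: path_continuous_image contf)
  have "dist d ((f \<circ> g) 0) > S" "dist d ((f \<circ> g) 1) > S"
    using far g(3,4) by (auto simp: pathstart_def pathfinish_def)
  then obtain h where h: "homotopic_paths A (f \<circ> g) h" "path_image h \<subseteq> - cball d S"
    using push_path_outwards[OF D, of S "f \<circ> g"] radii fg by auto
  obtain p where p: "path p" "pathstart p = y" "pathfinish p = y'" "\<And>t. t \<in> {0..1} \<Longrightarrow> f (p t) = h t"
    using covering_space_lift_homotopic_path[OF covA h(1) g(1) gA g(3,4)] by (metis o_apply)
  show thesis
    by (rule that[OF p(1)]) (use p h(2) in \<open>auto simp: path_image_def pathstart_def pathfinish_def\<close>)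
qed

text \<open>\<open>f\<close> is bounded on \<open>cball d S\<close>, so a path beyond
  \<open>S\<close> from \<open>f x\<close> to a point of sufficiently large modulus lifts to a path
  that ends beyond \<open>S\<close>.\<close>

lemma reach_far_preimage:
  assumes x: "f x \<in> - cball d S"
  obtains p where "path p" "path_image p \<subseteq> f -` (- cball d S)" "p 0 = x" "dist d (p 1) > S"
proof -
  have "compact (f ` cball d S)" by (intro compact_continuous_image contf compact_cball)
  then obtain M where M: "\<And>z. z \<in> cball d S \<Longrightarrow> dist d (f z) \<le> M"
  proof -
    obtain M where "\<forall>y\<in>f ` cball d S. dist d y \<le> M"
      using compact_imp_bounded[OF \<open>compact (f ` cball d S)\<close>] bounded_any_center[of _ d] by blast
    then show thesis using that[of M] by blast
  qed
  define y where "y = d + of_real (\<bar>M\<bar> + S + 1)"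
  have S: "S > 0" using radii by simp
  have dy: "dist d y = \<bar>M\<bar> + S + 1" using S by (simp add: y_def dist_norm del: of_real_add)
  have "path_connected (- cball d S)"
    by (intro path_connected_complement_bounded_convex) auto
  moreover have "y \<in> - cball d S" using dy by simp
  ultimately obtain g where g: "path g" "path_image g \<subseteq> - cball d S" "pathstart g = f x" "pathfinish g = y"
    using x unfolding path_connected_def by blast
  have gU: "path_image g \<subseteq> U" using g(2) far_subset_U by blast
  have xU: "x \<in> f -` U" using x far_subset_U by blast
  obtain p where p: "path p" "pathstart p = x" "\<And>t. t \<in> {0..1} \<Longrightarrow> f (p t) = g t"
    using covering_space_lift_path_strong[OF cov xU g(1) gU g(3)] by metis
  have "f (p 1) = y" using p(3)[of 1] g(4) by (simp add: pathfinish_def)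
  then have "p 1 \<notin> cball d S" using M[of "p 1"] dy S by auto
  then show thesis
    by (intro that[OF p(1)]) (use p g(2) in \<open>auto simp: path_image_def pathstart_def\<close>)
qed

text \<open>In the exterior of a disc, a path with ends beyond \<open>S\<close> is homotopic to one
  that stays beyond \<open>S\<close>, and homotopic base paths give the same continuation.\<close>

lemma joined_push:
  assumes j: "joined (- cball d R) z z'" and far: "dist d (z 0) > S" "dist d (z' 0) > S"
  shows "joined (- cball d S) z z'"
proof -
  obtain q where q: "tower q" "path_image (q 0) \<subseteq> - cball d R" "\<And>n. q n 0 = z n" "\<And>n. q n 1 = z' n"
    using j by (auto simp: joined_def)
  have Rpos: "R > 0" using radii by simp
  have cl: "closure (ball d R) = cball d R" using Rpos by simp
  obtain p where p: "homotopic_paths (- closure (ball d R)) (q 0) p" "path_image p \<subseteq> - cball d S"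
  proof (rule push_path_outwards[of "ball d R" d S S "q 0"])
    show "connected (- closure (ball d R))"
      unfolding cl by (intro connected_complement_bounded_convex) auto
    show "path (q 0)" using q(1) by (simp add: tower_def)
  qed (use q far radii cl in auto)
  have "homotopic_paths U (q 0) p"
    using p(1) far_subset_U(1) unfolding cl by (rule homotopic_paths_subset)
  then obtain q' where "tower q'" "q' 0 = p" "\<And>n. q' n 0 = q n 0" "\<And>n. q' n 1 = q n 1"
    using tower_homotopic[OF q(1)] by metis
  then show ?thesis
    unfolding joined_def using p(2) q(3,4) by (intro exI[of _ q']) simp
qed

end

section \<open>The periodic address of a cycle and the ray with that address\<close>

locale periodic_classes = fundamental_domain_setting +
  fixes n :: nat and w :: "nat \<Rightarrow> nat \<Rightarrow> complex"
  assumes n: "n \<ge> 1"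
    and w_periodic: "w (k + n) = w k"
    and w_orbit: "orbit (w k)"
    and w_lim: "w k \<longlonglongrightarrow> z0"
    and w_far: "dist d (w k 0) > S"
    and w_joined: "joined (- cball d R) (\<lambda>j. w k (Suc j)) (w (Suc k))"
begin

text \<open>The shift by one puts the base point into the preimage of the far region, where it
  avoids the slit, while \<open>w k 0\<close> might lie on it. From here on continuation must not
  cross the slit, since only then does the first preimage stay in one fundamental domain.\<close>

definition cls :: "nat \<Rightarrow> (nat \<Rightarrow> complex) set" where
  "cls k = {z. joined (- cball d R - Al) (\<lambda>j. w k (Suc j)) z}"

text \<open>The backward orbits in \<open>cls k\<close> all have their first preimage in one fundamental domain
  \<open>G k\<close>. As shifting moves \<open>cls k\<close> to \<open>cls (k + 1)\<close>, reading indices downwards gives the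
  address of a ray.\<close>

definition G :: "nat \<Rightarrow> complex set" where
  "G k = fund (w k (Suc (Suc 0)))"

lemma w_mod: "w (k mod n) = w k"
proof -
  have "w (k + j * n) = w k" for k j
  proof (induction j)
    case (Suc j)
    have "w (k + Suc j * n) = w ((k + j * n) + n)" by (simp add: algebra_simps)
    then show ?case using w_periodic Suc by metis
  qed simp
  from this[of "k mod n" "k div n"] show ?thesis by (metis mod_div_mult_eq)
qed

lemma cls_mod: "cls (k mod n) = cls k" and G_mod: "G (k mod n) = G k"
  by (simp_all add: cls_def G_def w_mod)

lemma annulus_sub: "- cball d R - Al \<subseteq> A - Al" "- cball d R - Al \<subseteq> U"
  using far_sub_A[of R] far_subset_U(1) radii by auto

lemma cls_self: "(\<lambda>j. w k (Suc j)) \<in> cls k"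
proof -
  have "f (w k (Suc 0)) \<in> - cball d S" using w_orbit[of k] w_far[of k] by (simp add: orbit_def)
  then have "w k (Suc 0) \<in> - cball d R - Al" using preimage_far_subset by blast
  then show ?thesis
    unfolding cls_def using joined_refl[OF orbit_shift[OF w_orbit]] annulus_sub by simp
qed

lemma cls_tendsto: "z \<in> cls k \<Longrightarrow> z \<longlonglongrightarrow> z0"
  unfolding cls_def using joined_tendsto LIMSEQ_Suc[OF w_lim] by blast

lemma cls_orbit: "z \<in> cls k \<Longrightarrow> orbit z"
  unfolding cls_def using joined_orbit by blast

lemma cls_base: "z \<in> cls k \<Longrightarrow> z 0 \<in> - cball d R - Al"
  unfolding cls_def using joined_orbit(6) by blast

lemma cls_trans: "z \<in> cls k \<Longrightarrow> joined (- cball d R - Al) z z' \<Longrightarrow> z' \<in> cls k"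
  unfolding cls_def using joined_trans by blast

lemma cls_in_G:
  assumes "z \<in> cls k" shows "z 1 \<in> G k"
proof -
  obtain q where q: "tower q" "path_image (q 0) \<subseteq> f -` (- cball d R - Al)"
    "\<And>j. q j 0 = w k (Suc (Suc j))" "\<And>j. q j 1 = z (Suc j)"
  proof -
    have "joined (f -` (- cball d R - Al)) (\<lambda>j. w k (Suc (Suc j))) (\<lambda>j. z (Suc j))"
      using joined_shift assms unfolding cls_def by blast
    then show thesis using that unfolding joined_def by blast
  qed
  show ?thesis
    unfolding G_def
  proof (rule mem_fund_of_connected[of "path_image (q 0)"])
    show "connected (path_image (q 0))" using q(1) by (auto simp: tower_def intro: connected_path_image)
    show "w k (Suc (Suc 0)) \<in> path_image (q 0)" "z 1 \<in> path_image (q 0)"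
      using q(3)[of 0] q(4)[of 0] pathstart_in_path_image[of "q 0"] pathfinish_in_path_image[of "q 0"]
      by (auto simp: pathstart_def pathfinish_def)
    show "path_image (q 0) \<subseteq> f -` (A - Al)" using q(2) annulus_sub by blast
  qed
qed

text \<open>Before the shift the slit may be ignored: \<open>z\<close> is joined to
  \<open>w (Suc k)\<close> beyond \<open>R\<close>, and beyond \<open>S\<close> because both base
  points are that far out. The pullback of this continuation lies in the preimage of the far region,
  which misses the slit.\<close>

lemma cls_shift:
  assumes z: "z \<in> cls k" "dist d (z 0) > S"
  shows "(\<lambda>j. z (Suc j)) \<in> cls (Suc k)"
proof -
  have "joined (- cball d R) (\<lambda>j. w k (Suc j)) z"
    using z(1) unfolding cls_def by (auto intro: joined_mono)
  then have "joined (- cball d R) (w (Suc k)) z"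
    using joined_trans[OF joined_sym[OF w_joined]] by blast
  then have "joined (- cball d S) (w (Suc k)) z"
    using w_far z(2) by (rule joined_push)
  from joined_shift[OF this] show ?thesis
    unfolding cls_def using joined_mono preimage_far_subset by blast
qed

lemma G_in_fundamental_domains: "G k \<in> fundamental_domains f D \<alpha>"
proof -
  have "f (w k (Suc (Suc 0))) = w k (Suc 0)" using w_orbit[of k] by (simp add: orbit_def)
  then show ?thesis
    unfolding G_def using cls_base[OF cls_self[of k]] annulus_sub(1) by (intro fund_mem) auto
qed

lemma inj_on_G: "inj_on f (G k)"
  unfolding G_def by (rule inj_on_fund)

lemma G_notin_Al: "x \<in> G k \<Longrightarrow> x \<notin> Al"
  using fund_sub(1) preimage_A_notin_Al unfolding G_def by blast

text \<open>The base of an orbit in \<open>cls k\<close> is first moved beyond \<open>S\<close>,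
  within the preimage of the far region. Its first preimage lies in \<open>G k\<close>, like
  \<open>x\<close>, so \<open>far_path_in_fund\<close> leads from there to \<open>x\<close>; passing
  to first preimages raises the class by one.\<close>

lemma cls_over_point:
  assumes x: "x \<in> G k" "f x \<in> - cball d S"
  obtains z where "z \<in> cls (Suc k)" "z 0 = x"
proof -
  have "f (w k (Suc 0)) \<in> - cball d S" using w_orbit[of k] w_far[of k] by (simp add: orbit_def)
  then obtain p where p: "path p" "path_image p \<subseteq> f -` (- cball d S)" "p 0 = w k (Suc 0)" "dist d (p 1) > S"
    using reach_far_preimage by metis
  obtain y where y: "joined (- cball d R - Al) (\<lambda>j. w k (Suc j)) y" "y 0 = p 1"
  proof (rule joined_along[OF p(1) _ annulus_sub(2) orbit_shift[OF w_orbit]])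
    show "path_image p \<subseteq> - cball d R - Al" using p(2) preimage_far_subset by blast
    show "w k (Suc 0) = p 0" using p(3) by simp
  qed blast
  have yk: "y \<in> cls k" "dist d (y 0) > S" using y p(4) by (auto simp: cls_def)
  have fy: "f (y 1) = y 0" using cls_orbit[OF yk(1)] by (simp add: orbit_def)
  have "f (y 1) \<in> - cball d S" using fy yk(2) by simp
  then obtain r where r: "path r" "path_image r \<subseteq> f -` (- cball d S)" "r 0 = y 1" "r 1 = x"
    using far_path_in_fund[of "y 1" "w k (Suc (Suc 0))" x] cls_in_G[OF yk(1)] x unfolding G_def by metis
  obtain z where z: "joined (- cball d R - Al) (\<lambda>j. y (Suc j)) z" "z 0 = r 1"
  proof (rule joined_along[OF r(1) _ annulus_sub(2) orbit_shift[OF cls_orbit[OF yk(1)]]])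
    show "path_image r \<subseteq> - cball d R - Al" using r(2) preimage_far_subset by blast
    show "y (Suc 0) = r 0" using r(3) by simp
  qed blast
  have "z \<in> cls (Suc k)" by (rule cls_trans[OF cls_shift[OF yk] z(1)])
  with z(2) r(4) that show thesis by blast
qed

text \<open>Index arithmetic for reading the address backwards: of the \<open>n * n'\<close> steps
  of a period, the one with \<open>Suc j\<close> steps left before the end belongs to the domain
  \<open>G j\<close>.\<close>

lemma address_index:
  assumes "j < n * n'"
  shows "n - Suc 0 - ((n * n' - Suc j) mod n) = j mod n"
proof -
  define a b where "a = j div n" and "b = j mod n"
  have b: "b < n" using n by (simp add: b_def)
  have j: "j = n * a + b" by (simp add: a_def b_def)
  have "a < n'" using assms n by (simp add: a_def less_mult_imp_div_less mult.commute)
  then obtain m where m: "n' = Suc a + m" by (metis Suc_leI le_Suc_ex)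
  have "n * n' - Suc j = n * m + (n - Suc b)"
    using b by (simp add: j m algebra_simps)
  moreover have "n - Suc b < n" using n by simp
  ultimately have "(n * n' - Suc j) mod n = n - Suc b" by (simp only: mod_mult_self4 mod_less)
  then show ?thesis using b by (simp add: b_def[symmetric])
qed

theorem ray_with_periodic_address_lands:
  assumes ray: "periodic_ray f g" and addr: "has_address f g (\<lambda>i. G (n - 1 - i mod n))"
  shows "lands_at g z0"
proof -
  obtain n' where n': "n' \<ge> 1" "\<And>t. t > 0 \<Longrightarrow> g (2 * t) = (f ^^ n') (g t)"
    and contg: "continuous_on {0<..} g" and ginf: "filterlim g at_infinity at_top"
    using ray unfolding periodic_ray_def by blast
  obtain t0 where t0: "t0 > 0" "\<And>m. (f ^^ m) ` g ` {t0..} \<subseteq> G (n - 1 - m mod n)"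
    using addr unfolding has_address_def by blast
  \<comment> \<open>A common period: \<open>n'\<close> belongs to the ray, \<open>n\<close> to the
    classes. A block of \<open>N\<close> iterates doubles the parameter \<open>n\<close> times,
    hence the factor \<open>c\<close>.\<close>
  define N where "N = n * n'"
  define c where "c = (2 :: real) ^ n"
  have N: "N \<ge> 1" using n n' by (simp add: N_def)
  have c: "c \<ge> 2"
    using power_increasing[of 1 n "2::real"] n by (simp add: c_def)
  have dbl: "g (2 ^ j * t) = (f ^^ (n' * j)) (g t)" if "t > 0" for j t
  proof (induction j)
    case (Suc j)
    have "g (2 ^ Suc j * t) = (f ^^ n') (g (2 ^ j * t))" using n'(2)[of "2 ^ j * t"] that by (simp add: mult.assoc)
    then show ?case by (simp add: Suc funpow_add)
  qed simp
  have ck: "g (c ^ k * t) = (f ^^ (N * k)) (g t)" if "t > 0" for k t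
    using dbl[OF that, of "n * k"] by (simp add: c_def N_def power_mult mult.assoc mult.left_commute)
  have c1: "g (c * t) = (f ^^ N) (g t)" if "t > 0" for t
    using ck[OF that, of 1] by simp
  \<comment> \<open>If \<open>f ^^ i\<close> with \<open>i \<le> N\<close> took \<open>g t\<close>
    into \<open>cball d S\<close>, the remaining \<open>N - i\<close> iterates would keep
    \<open>g (c * t)\<close> in a fixed bounded set; this fails for large \<open>t\<close>.\<close>
  obtain t1 where t1: "t1 \<ge> t0" "\<And>t i. t \<ge> t1 \<Longrightarrow> i \<le> N \<Longrightarrow> dist d ((f ^^ i) (g t)) > S"
  proof -
    have "\<exists>T. \<forall>t\<ge>T. t \<ge> t0 \<longrightarrow> dist d ((f ^^ i) (g t)) > S" if i: "i \<le> N" for i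
    proof -
      have "compact ((f ^^ (N - i)) ` cball d S)" by (intro compact_continuous_image cont_iter compact_cball)
      then obtain B where B: "\<And>x. x \<in> (f ^^ (N - i)) ` cball d S \<Longrightarrow> norm x \<le> B"
        using compact_imp_bounded bounded_iff by metis
      have "filterlim (\<lambda>t. norm (g t)) at_top at_top" using ginf by (rule filterlim_at_infinity_imp_norm_at_top)
      then have "\<forall>\<^sub>F t in at_top. B + 1 \<le> norm (g t)" unfolding filterlim_at_top by blast
      then obtain T where T: "\<And>t. t \<ge> T \<Longrightarrow> B + 1 \<le> norm (g t)" by (auto simp: eventually_at_top_linorder)
      have "dist d ((f ^^ i) (g t)) > S" if t: "t \<ge> T" "t \<ge> t0" for t
      proof (rule ccontr)
        assume "\<not> dist d ((f ^^ i) (g t)) > S"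
        then have "norm ((f ^^ (N - i)) ((f ^^ i) (g t))) \<le> B" by (intro B imageI) simp
        also have "(f ^^ (N - i)) ((f ^^ i) (g t)) = g (c * t)"
          using i c1[of t] t t0(1) by (simp flip: funpow_add[THEN fun_cong, simplified])
        finally have "norm (g (c * t)) \<le> B" .
        moreover have "1 * t \<le> c * t" using c t t0(1) by (intro mult_right_mono) auto
        then have "c * t \<ge> T" using t by linarith
        ultimately show False using T by force
      qed
      then show ?thesis by blast
    qed
    then obtain T where T: "\<And>i t. i \<le> N \<Longrightarrow> t \<ge> T i \<Longrightarrow> t \<ge> t0 \<Longrightarrow> dist d ((f ^^ i) (g t)) > S" by metis
    show thesis
    proof (rule that[of "Max (insert t0 (T ` {..N}))"])
      fix t i assume t: "Max (insert t0 (T ` {..N})) \<le> t" and i: "i \<le> N"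
      have "x \<le> t" if "x \<in> insert t0 (T ` {..N})" for x
        using Max_ge[of "insert t0 (T ` {..N})" x] that t by (meson finite_atMost finite_imageI finite_insert order_trans)
      then show "dist d ((f ^^ i) (g t)) > S" using T i by simp
    qed (rule Max_ge; simp)
  qed
  have t1pos: "t1 > 0" using t0 t1 by simp
  have gU: "g t \<in> U" if t: "t > 0" for t
  proof -
    obtain k where "t1 / t < c ^ k" using real_arch_pow[of c "t1 / t"] c by auto
    then have "t1 \<le> c ^ k * t" using t by (simp add: divide_less_eq)
    from t1(2)[OF this, of 0] have "g (c ^ k * t) \<in> U" using far_subset_U(2) by auto
    then show ?thesis using ck[OF t] in_U_of_iter by metis
  qed
  have gs: "(f ^^ m) (g t) \<in> G (n - 1 - m mod n)" if "t \<ge> t1" for m t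
    using t0(2)[of m] that t1(1) by auto
  have gann: "g t \<in> - cball d R - Al" if "t \<ge> t1" for t
    using t1(2)[OF that, of 0] gs[OF that, of 0] G_notin_Al radii by auto
  have cls0: "cls (n * k) = cls 0" for k
    using cls_mod[of "n * k"] by simp
  \<comment> \<open>Going back one period from \<open>g (c * t)\<close>, an orbit of class 0 has to
    follow the ray: \<open>z (Suc j)\<close> and the corresponding ray point lie in the same domain
    \<open>G j\<close> and have the same image.\<close>
  have L4: "(\<lambda>i. z (i + j)) \<in> cls j \<and> z j = (f ^^ (N - j)) (g t)"
    if t: "t \<ge> t1" and z: "z \<in> cls 0" "z 0 = g (c * t)" and j: "j \<le> N" for t z j
    using j
  proof (induction j)
    case 0 then show ?case using z c1[of t] t t1pos by simp
  next
    case (Suc j)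
    define y where "y = (\<lambda>i. z (i + j))"
    have y: "y \<in> cls j" "z j = (f ^^ (N - j)) (g t)" using Suc by (auto simp: y_def)
    have zG: "z (Suc j) \<in> G j" using cls_in_G[OF y(1)] by (simp add: y_def)
    have "(f ^^ (N - Suc j)) (g t) \<in> G (n - 1 - (N - Suc j) mod n)" by (rule gs[OF t])
    also have "n - 1 - (N - Suc j) mod n = j mod n"
      using address_index[of j n'] Suc.prems by (simp add: N_def)
    finally have gG: "(f ^^ (N - Suc j)) (g t) \<in> G j" by (simp add: G_mod)
    have "f (z (Suc j)) = z j" using cls_orbit[OF z(1)] by (simp add: orbit_def)
    also have "z j = f ((f ^^ (N - Suc j)) (g t))"
    proof -
      have "N - j = Suc (N - Suc j)" using Suc.prems by simp
      then show ?thesis using y(2) by simp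
    qed
    finally have "z (Suc j) = (f ^^ (N - Suc j)) (g t)" using inj_onD[OF inj_on_G _ zG gG] by blast
    moreover have "dist d (y 0) > S" using y(2) t1(2)[OF t, of "N - j"] by (simp add: y_def)
    from cls_shift[OF y(1) this] have "(\<lambda>i. z (i + Suc j)) \<in> cls (Suc j)" by (simp add: y_def)
    ultimately show ?case by simp
  qed
  have L5: "z (N * k) = g t" if "t \<ge> t1" "z \<in> cls 0" "z 0 = g (c ^ k * t)" for t z k
    using that
  proof (induction k arbitrary: z)
    case (Suc k)
    have "1 \<le> c ^ k" using c by (simp add: one_le_power)
    then have "1 * t \<le> c ^ k * t"
      using Suc.prems(1) t1pos by (intro mult_right_mono) auto
    then have le: "t1 \<le> c ^ k * t" using Suc.prems(1) by linarith
    have y: "(\<lambda>i. z (i + N)) \<in> cls N" "z N = g (c ^ k * t)"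
      using L4[OF le Suc.prems(2), of N] Suc.prems(3) by (auto simp: mult.assoc)
    have "(\<lambda>i. z (i + N)) \<in> cls 0" using y(1) cls0[of n'] by (simp add: N_def)
    from Suc.IH[OF Suc.prems(1) this] y(2) have "z (N * k + N) = g t" by simp
    then show ?case by (simp add: add.commute)
  qed simp
  \<comment> \<open>The address starts with \<open>G (n - 1)\<close>, so
    \<open>cls_over_point\<close> yields an orbit of class \<open>n\<close>, which is class
    0.\<close>
  obtain z where z: "z \<in> cls 0" "z 0 = g t1"
  proof -
    have "g t1 \<in> G (n - 1)" using gs[of t1 0] by simp
    moreover have "f (g t1) \<in> - cball d S" using t1(2)[of t1 1] N by simp
    ultimately obtain z where "z \<in> cls (Suc (n - 1))" "z 0 = g t1" using cls_over_point by blast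
    then show thesis using that[of z] cls0[of 1] n by simp
  qed
  have zorb: "orbit z" by (rule cls_orbit[OF z(1)])
  \<comment> \<open>Below \<open>t1\<close> the address no longer controls the ray. Instead
    \<open>z\<close> is continued outwards along the ray to \<open>g (c ^ k * t1)\<close>, where
    \<open>L5\<close> identifies entry \<open>N * k\<close> as \<open>g t1\<close>; uniqueness of
    lifts carries this back to \<open>g (t1 / c ^ k)\<close>.\<close>
  have L6: "z (N * k) = g (t1 / c ^ k)" for k
  proof -
    define a where "a = (\<lambda>s. t1 + (c ^ k * t1 - t1) * s)"
    have ck1: "c ^ k \<ge> 1" using c by (simp add: one_le_power)
    then have "c ^ k * t1 - t1 \<ge> 0" using t1pos mult_right_mono[of 1 "c ^ k" t1] by simp
    then have a: "a s \<ge> t1" if "s \<in> {0..1}" for s using that by (simp add: a_def)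
    define p where "p = (\<lambda>s. g (a s))"
    have p: "path p" "path_image p \<subseteq> - cball d R - Al"
    proof -
      have "continuous_on {0..1} a" unfolding a_def by (intro continuous_intros)
      moreover have "a ` {0..1} \<subseteq> {0<..}" using a t1pos by force
      ultimately show "path p"
        unfolding p_def path_def by (rule continuous_on_compose2[OF contg])
      show "path_image p \<subseteq> - cball d R - Al"
        unfolding p_def path_image_def by (intro image_subsetI gann a)
    qed
    obtain q where q: "tower q" "q 0 = p" "\<And>m. q m 0 = z m"
    proof (rule tower_lift[OF p(1) _ zorb])
      show "path_image p \<subseteq> U" using p(2) annulus_sub(2) by blast
      show "z 0 = p 0" using z(2) by (simp add: p_def a_def)
    qed blast
    have "joined (- cball d R - Al) z (\<lambda>m. q m 1)"
      unfolding joined_def using q p(2) by blast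
    then have "(\<lambda>m. q m 1) \<in> cls 0" by (rule cls_trans[OF z(1)])
    moreover have "q 0 1 = g (c ^ k * t1)" by (simp add: q(2) p_def a_def)
    ultimately have q1: "q (N * k) 1 = g t1" using L5[of t1] by simp
    have "(\<lambda>s. g (a s / c ^ k)) 0 = q (N * k) 0"
    proof (rule tower_eq[OF q(1)])
      have "continuous_on {0..1} (\<lambda>s. a s / c ^ k)" unfolding a_def using c by (intro continuous_intros) auto
      moreover have "(\<lambda>s. a s / c ^ k) ` {0..1} \<subseteq> {0<..}" using a t1pos c by fastforce
      ultimately show "continuous_on {0..1} (\<lambda>s. g (a s / c ^ k))"
        by (rule continuous_on_compose2[OF contg])
      fix s :: real assume s: "s \<in> {0..1}"
      have "a s / c ^ k > 0" using a[OF s] t1pos c by simp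
      from ck[OF this, of k] show "(f ^^ (N * k)) (g (a s / c ^ k)) = q 0 s" using c by (simp add: q(2) p_def)
    next
      show "g (a 1 / c ^ k) = q (N * k) 1" using c q1 by (simp add: a_def)
    qed auto
    then show ?thesis using q(3) by (simp add: a_def)
  qed
  \<comment> \<open>A fundamental segment of the ray, from parameter \<open>t1\<close> down to
    \<open>t1 / c\<close>. Its lifts through \<open>f ^^ (N * k)\<close> are the successive rescaled
    pieces, which fill the rest of the ray and shrink towards the entries
    \<open>z (N * k)\<close>.\<close>
  define a where "a = (\<lambda>s. t1 * (1 - s) + t1 / c * s)"
  have a: "a s > 0" if "s \<in> {0..1}" for s
  proof (cases "s = 0")
    case False
    then have "t1 / c * s > 0" "t1 * (1 - s) \<ge> 0" using that t1pos c by auto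
    then show ?thesis unfolding a_def by linarith
  qed (use t1pos in \<open>simp add: a_def\<close>)
  have ima: "a ` {0..1} \<subseteq> {0<..}" using a by force
  have conta: "continuous_on {0..1} a" unfolding a_def by (intro continuous_intros)
  obtain q where q: "tower q" "q 0 = (\<lambda>s. g (a s))" "\<And>m. q m 0 = z m"
  proof (rule tower_lift[OF _ _ zorb])
    show "path (\<lambda>s. g (a s))"
      unfolding path_def by (rule continuous_on_compose2[OF contg conta ima])
    show "path_image (\<lambda>s. g (a s)) \<subseteq> U" unfolding path_image_def by (intro image_subsetI gU a)
    show "z 0 = g (a 0)" using z(2) by (simp add: a_def)
  qed blast
  have qk: "g (a s / c ^ k) = q (N * k) s" if s: "s \<in> {0..1}" for s k
  proof (rule tower_eq[OF q(1), where k = "\<lambda>s. g (a s / c ^ k)" and a = 0])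
    have "continuous_on {0..1} (\<lambda>s. a s / c ^ k)" using c by (intro continuous_intros conta) auto
    moreover have "(\<lambda>s. a s / c ^ k) ` {0..1} \<subseteq> {0<..}" using a c by fastforce
    ultimately show "continuous_on {0..1} (\<lambda>s. g (a s / c ^ k))"
      by (rule continuous_on_compose2[OF contg])
    show "(f ^^ (N * k)) (g (a s / c ^ k)) = q 0 s" if "s \<in> {0..1}" for s
      using ck[of "a s / c ^ k" k] a[OF that] c by (simp add: q(2))
    show "g (a 0 / c ^ k) = q (N * k) 0" using L6 q(3) by (simp add: a_def)
  qed (use s in auto)
  have zlim: "z \<longlonglongrightarrow> z0" by (rule cls_tendsto[OF z(1)])
  then obtain M where M: "\<And>m. norm (q m 0) \<le> M"
    using convergentI convergent_imp_Bseq q(3) by (metis BseqE)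
  show ?thesis
    unfolding lands_at_def
  proof (rule tendstoI)
    fix \<epsilon> :: real assume "\<epsilon> > 0"
    then have e2: "\<epsilon> / 2 > 0" by simp
    obtain m0 where m0: "\<And>m. m \<ge> m0 \<Longrightarrow> \<forall>s\<in>{0..1}. dist (q m s) (q m 0) < \<epsilon> / 2"
      using tower_shrinks[OF q(1) M e2] by blast
    obtain m1 where m1: "\<And>m. m \<ge> m1 \<Longrightarrow> dist (z m) z0 < \<epsilon> / 2"
      using metric_LIMSEQ_D[OF zlim e2] by blast
    define K where "K = max m0 m1"
    have "dist (g t) z0 < \<epsilon>" if t: "0 < t" "t < t1 / c ^ K" for t
    proof -
      define x where "x = t1 / t"
      have xK: "c ^ K < x" using t c by (simp add: x_def field_simps)
      have "\<exists>k. x < c ^ Suc k"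
      proof -
        obtain k where "x < c ^ k" using real_arch_pow[of c x] c by auto
        also have "c ^ k \<le> c ^ Suc k" using c by (intro power_increasing) auto
        finally show ?thesis by blast
      qed
      \<comment> \<open>The piece containing \<open>t\<close>: \<open>t * c ^ k\<close> lies between
        \<open>t1 / c\<close> and \<open>t1\<close>, and \<open>s\<close> below is its position on
        the segment.\<close>
      define k where "k = (LEAST k. x < c ^ Suc k)"
      have k2: "x < c ^ Suc k" unfolding k_def by (rule LeastI_ex) fact
      have k1: "c ^ k \<le> x"
      proof (cases k)
        case 0
        have "1 \<le> c ^ K" using c by (simp add: one_le_power)
        then show ?thesis using 0 xK by simp
      next
        case (Suc i)
        then have "\<not> x < c ^ Suc i" using not_less_Least[of i "\<lambda>k. x < c ^ Suc k"] by (simp add: k_def)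
        then show ?thesis using Suc by simp
      qed
      have "c ^ K < c ^ Suc k" using xK k2 by linarith
      then have Kk: "K \<le> k" using power_less_imp_less_exp[of c K "Suc k"] c by simp
      define s where "s = (t1 - t * c ^ k) / (t1 - t1 / c)"
      have den: "t1 - t1 / c > 0" using t1pos c by (simp add: field_simps)
      have "t * c ^ k \<le> t1" using k1 t by (simp add: x_def field_simps)
      moreover have "t1 / c \<le> t * c ^ k"
      proof -
        have "t1 < c ^ Suc k * t" using k2 t by (simp add: x_def divide_less_eq)
        then show ?thesis using c by (simp add: field_simps)
      qed
      ultimately have s: "s \<in> {0..1}" using den by (simp add: s_def)
      have "a s = t1 - (t1 - t1 / c) * s" by (simp add: a_def algebra_simps)
      also have "(t1 - t1 / c) * s = t1 - t * c ^ k" using den unfolding s_def by simp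
      finally have "a s = t * c ^ k" by simp
      then have "g t = q (N * k) s" using qk[OF s, of k] c by simp
      moreover have Nk: "K \<le> N * k" using Kk N by (metis le_trans mult_le_mono1 mult_1)
      ultimately have "dist (g t) (z (N * k)) < \<epsilon> / 2"
        using m0[of "N * k"] s q(3) by (simp add: K_def)
      moreover have "dist (z (N * k)) z0 < \<epsilon> / 2" using m1 Nk by (simp add: K_def)
      ultimately show ?thesis using dist_triangle[of "g t" z0 "z (N * k)"] by linarith
    qed
    moreover have "t1 / c ^ K > 0" using t1pos c by simp
    ultimately show "\<forall>\<^sub>F t in at_right 0. dist (g t) z0 < \<epsilon>"
      unfolding eventually_at_right_field by blast
  qed
qed

end

section \<open>Verification of the standing assumptions and conclusion\<close>

lemma jordan_domain_properties:
  assumes "jordan_domain D"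
  shows "open D" "connected D" "D \<noteq> {}" "bounded D" "connected (- closure D)"
proof -
  obtain c where c: "simple_path c" "pathfinish c = pathstart c" "D = inside (path_image c)"
    using assms by (auto simp: jordan_domain_def)
  note J = Jordan_inside_outside[OF c(1,2)]
  show "open D" "connected D" "D \<noteq> {}" "bounded D" using J c(3) by auto
  have "frontier D = path_image c" using J c(3) by blast
  then have "closure D = D \<union> path_image c" by (simp only: closure_Un_frontier)
  then have "- closure D = outside (path_image c)" using J c(3) by blast
  then show "connected (- closure D)" using J by simp
qed

lemma deriv_funpow_fixed_point:
  fixes f :: "complex \<Rightarrow> complex"
  assumes hol: "f holomorphic_on UNIV" and fp: "f z = z"
  shows "deriv (f ^^ q) z = deriv f z ^ q"
proof -
  have "((f ^^ q) has_field_derivative deriv f z ^ q) (at z) \<and> (f ^^ q) z = z"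
  proof (induction q)
    case 0 then show ?case by (auto simp: id_def)
  next
    case (Suc q)
    have "(f has_field_derivative deriv f z) (at ((f ^^ q) z))"
      using Suc hol holomorphic_derivI by fastforce
    then have "(f \<circ> (f ^^ q) has_field_derivative deriv f z * deriv f z ^ q) (at z)"
      using Suc by (intro DERIV_chain) auto
    then have "(f ^^ Suc q has_field_derivative deriv f z ^ Suc q) (at z)" by (simp only: funpow.simps power.simps)
    moreover have "(f ^^ Suc q) z = z" using Suc fp by simp
    ultimately show ?case by blast
  qed
  then show ?thesis by (simp add: DERIV_imp_deriv)
qed

lemma critical_asymptotic_subset_postsing:
  "critical_values f \<union> asymptotic_values f \<subseteq> postsing_set f"
proof -
  have "critical_values f \<union> asymptotic_values f \<subseteq> sing_set f"
    unfolding sing_set_def by (rule closure_subset)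
  also have "\<dots> \<subseteq> (\<Union>n. (f ^^ n) ` sing_set f)"
    using UN_upper[of 0 UNIV "\<lambda>n. (f ^^ n) ` sing_set f"] by simp
  also have "\<dots> \<subseteq> postsing_set f" unfolding postsing_set_def by (rule closure_subset)
  finally show ?thesis .
qed

lemma expanding_domain_of_admissible:
  assumes f: "transcendental_entire f" and adm: "admissible_expansion_domain f z0 U" and fp: "f z0 = z0"
  obtains q0 where "expanding_domain f U z0 q0"
proof -
  have hol: "f holomorphic_on UNIV" using f by (simp add: transcendental_entire_def)
  obtain q0 where q0: "q0 \<in> U" "f q0 \<notin> U" and sub: "f -` U \<subseteq> U"
    using adm unfolding admissible_expansion_domain_def by blast
  obtain R where R: "\<And>z. norm z > R \<Longrightarrow> z \<in> U"
    using adm unfolding admissible_expansion_domain_def by blast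
  \<comment> \<open>An entire function that omits a neighbourhood of infinity is bounded, hence
    constant, hence a polynomial.\<close>
  have ne: "f -` U \<noteq> {}"
  proof
    assume "f -` U = {}"
    then have "f z \<notin> U" for z by blast
    then have "norm (f z) \<le> R" for z using R by (meson not_le)
    then have "bounded (range f)" by (auto simp: bounded_iff)
    then have "f constant_on UNIV" using Liouville_theorem[OF hol] by blast
    then obtain c where "\<And>z. f z = c" by (auto simp: constant_on_def)
    then have "\<forall>z. f z = poly [:c:] z" by simp
    then show False using f unfolding transcendental_entire_def by blast
  qed
  have "expanding_domain f U z0 q0"
  proof
    show "U \<inter> (critical_values f \<union> asymptotic_values f) = {}"
      using adm critical_asymptotic_subset_postsing[of f] unfolding admissible_expansion_domain_def by blast
    show "z0 \<notin> U" using adm unfolding admissible_expansion_domain_def by blast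
    show "open U" "connected U" using adm by (auto simp: admissible_expansion_domain_def)
  qed (use hol sub ne fp q0 in auto)
  then show thesis by (rule that)
qed

lemma (in expanding_domain) exists_escape_time_function:
  assumes "repelling_fixed_point f z0 \<or> parabolic_fixed_point f z0"
  obtains Q \<rho> u where "Q \<ge> 1" "escape_time_function (f ^^ Q) z0 \<rho> u" "inj_on f (ball z0 \<rho>)"
proof -
  have "deriv f z0 \<noteq> 0"
    using assms by (auto simp: repelling_fixed_point_def parabolic_fixed_point_def power_0_left)
  then obtain r where r: "r > 0" "inj_on f (ball z0 r)"
    using has_complex_derivative_locally_injective[OF hol UNIV_I open_UNIV] by metis
  have "\<exists>Q \<rho> u. Q \<ge> 1 \<and> escape_time_function (f ^^ Q) z0 \<rho> u"
    using assms
  proof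
    assume "repelling_fixed_point f z0"
    then obtain \<rho> u where "escape_time_function f z0 \<rho> u"
      using escape_time_function_repelling[OF hol z0(1)] by (auto simp: repelling_fixed_point_def)
    then have "escape_time_function (f ^^ 1) z0 \<rho> u" by simp
    then show ?thesis by blast
  next
    assume "parabolic_fixed_point f z0"
    then obtain q where q: "q \<ge> 1" "deriv f z0 ^ q = 1" by (auto simp: parabolic_fixed_point_def)
    \<comment> \<open>\<open>f ^^ q\<close> is not the identity, because \<open>q0\<close> leaves
      \<open>U\<close> under \<open>f\<close> and never returns. This supplies \<open>nid\<close> of
      \<open>escape_time_function_multiplier_one\<close>.\<close>
    have "(f ^^ q) q0 \<noteq> q0"
      using image_in_U_of_iter[of q q0] q0 q(1) by auto
    then obtain \<rho> u where "escape_time_function (f ^^ q) z0 \<rho> u"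
      using escape_time_function_multiplier_one[OF hol_iter iter_fixed] deriv_funpow_fixed_point[OF hol z0(1)] q(2) by metis
    then show ?thesis using q(1) by blast
  qed
  then obtain Q \<rho> u where Q: "Q \<ge> 1" "escape_time_function (f ^^ Q) z0 \<rho> u" by blast
  have "\<rho> > 0" using Q(2) by (simp add: escape_time_function_def)
  then have "escape_time_function (f ^^ Q) z0 (min \<rho> r) u"
    using r(1) by (intro escape_time_function_shrink[OF Q(2)]) auto
  moreover have "inj_on f (ball z0 (min \<rho> r))" by (rule inj_on_subset[OF r(2)]) auto
  ultimately show thesis using that Q(1) by blast
qed

theorem exists_landing_periodic_ray:
  assumes f: "transcendental_entire f"
    and fxp: "repelling_fixed_point f z0 \<or> parabolic_fixed_point f z0"
    and adm: "admissible_expansion_domain f z0 U"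
    and D: "jordan_domain D" "postsing_set f \<subseteq> D"
    and alpha: "valid_alpha f D \<alpha>"
    and rays: "\<And>s. external_address f D \<alpha> s \<Longrightarrow> periodic_address s \<Longrightarrow> \<exists>g. periodic_ray f g \<and> has_address f g s"
  shows "\<exists>g. periodic_ray f g \<and> lands_at g z0"
proof -
  have "f z0 = z0" using fxp by (auto simp: repelling_fixed_point_def parabolic_fixed_point_def)
  then obtain q0 where "expanding_domain f U z0 q0"
    using expanding_domain_of_admissible[OF f adm] by blast
  then interpret expanding_domain f U z0 q0 .
  obtain Q \<rho> u where Q: "Q \<ge> 1" "escape_time_function (f ^^ Q) z0 \<rho> u" "inj_on f (ball z0 \<rho>)"
    using exists_escape_time_function[OF fxp] by metis
  note JD = jordan_domain_properties[OF D(1)]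
  have bU: "bounded (- U)"
  proof -
    obtain R where "\<And>z. norm z > R \<Longrightarrow> z \<in> U"
      using adm unfolding admissible_expansion_domain_def by blast
    then show ?thesis unfolding bounded_iff by (meson ComplD not_le)
  qed
  obtain d where d: "d \<in> D" using JD(3) by blast
  have "bounded (closure D \<union> - U \<union> ball z0 \<rho>)" using bounded_closure[OF JD(4)] bU by simp
  then obtain R0 where R0: "R0 > 0" "closure D \<union> - U \<union> ball z0 \<rho> \<subseteq> ball d R0"
    by (metis bounded_subset_ballD)
  define R where "R = R0 + 1"
  have "compact (f ` cball d R)" by (intro compact_continuous_image contf compact_cball)
  then obtain M where M: "f ` cball d R \<subseteq> ball d M" using bounded_subset_ballD compact_imp_bounded by metis
  \<comment> \<open>\<open>M\<close> bounds \<open>f\<close> on \<open>cball d R\<close>, which puts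
    preimages of the far region beyond \<open>R\<close>; the maximum secures
    \<open>R < S\<close>.\<close>
  define S where "S = max M (R + 1)"
  interpret fundamental_domain_setting f U z0 q0 Q \<rho> u d R0 R S D \<alpha>
  proof
    show "- closure D \<inter> (critical_values f \<union> asymptotic_values f) = {}"
      using critical_asymptotic_subset_postsing[of f] D(2) closure_subset[of D] by blast
    show "- ball d R0 \<subseteq> U" "closure D \<subseteq> ball d R0" "ball z0 \<rho> \<subseteq> ball d R0" using R0(2) by blast+
    show "R0 < R" "R < S" by (auto simp: R_def S_def)
    show "f -` (- cball d S) \<subseteq> - cball d R"
      using M by (fastforce simp: S_def)
  qed (use Q bU R0 JD d alpha in auto)
  obtain n w where n: "n \<ge> (1::nat)" "\<And>k. w (k + n) = w k" "\<And>k. orbit (w k)" "\<And>k. w k \<longlonglongrightarrow> z0"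
    "\<And>k. dist d (w k 0) > S" "\<And>k. joined (- cball d R) (\<lambda>j. w k (Suc j)) (w (Suc k))"
    using periodic_orbit_classes by metis
  interpret periodic_classes f U z0 q0 Q \<rho> u d R0 R S D \<alpha> n w
    by unfold_locales (fact n)+
  define s where "s = (\<lambda>i. G (n - 1 - i mod n))"
  have "external_address f D \<alpha> s"
    unfolding external_address_def s_def using G_in_fundamental_domains by blast
  moreover have "periodic_address s"
    unfolding periodic_address_def s_def using n(1) by (intro exI[of _ n]) simp
  ultimately obtain g where "periodic_ray f g" "has_address f g s" using rays by blast
  then show ?thesis
    using ray_with_periodic_address_lands unfolding s_def by blast
qed

theorem mainTheorem11:
  fixes f :: "complex \<Rightarrow> complex" and z0 :: complex and U D :: "complex set"
    and \<alpha> :: "real \<Rightarrow> complex"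
  assumes "transcendental_entire f"
    and "repelling_fixed_point f z0 \<or> parabolic_fixed_point f z0"
    and "admissible_expansion_domain f z0 U"
    and "jordan_domain D" and "postsing_set f \<subseteq> D"
    and "valid_alpha f D \<alpha>"
    and "\<forall>s. external_address f D \<alpha> s \<and> periodic_address s \<longrightarrow>
           (\<exists>g. periodic_ray f g \<and> has_address f g s)"
  shows "\<exists>g. periodic_ray f g \<and> lands_at g z0"
proof (rule exists_landing_periodic_ray[OF assms(1-6)])
  show "\<exists>g. periodic_ray f g \<and> has_address f g s"
    if "external_address f D \<alpha> s" "periodic_address s" for s
    using assms(7) that by blast
qed

end
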